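(* Let $R$ be a commutative ring of characteristic $0$, let $p$ be a prime, let $L$ be a $C_p$-Green functor of Lie type over $R$, and let $M$ be an $L$-module having the additional structure of a $C_p$-Green functor of Lie type (for example $M=L$ via the adjoint representation). Then the cup product induced on the graded cohomology $H^*_K(L,M)=\bigoplus_n H^n_K(L,M)$, defined for all subgroups $K\le C_p$, endows $H^*(L,M)$ with the structure of a $C_p$-Green functor of graded Lie type.
   Context: Conventions. $R$ is a commutative ring of characteristic $0$; all modules, Lie algebras and (multi)linear maps are over $R$. $C_p=\langle g\rangle$ is the cyclic group of prime order $p$, with subgroups $e$ (trivial) and $C_p$. $C_p$-Mackey functor. A $C_p$-Mackey functor $M$ consists of $R$-modules $M(C_p)$, $M(e)$, $R$-linear maps $r=r_M:M(C_p)\to M(e)$ (restriction) and $t=t_M:M(e)\to M(C_p)$ (transfer), and an $R$-linear action of $C_p$ on $M(e)$ by conjugation maps $c_h$, $h\in C_p$ (the conjugations on $M(C_p)$ are the identity), such that $c_h r=r$, $t c_h=t$ for all $h\in C_p$, and $r t=\sum_{h\in C_p}c_h$. $C_p$-Green functor of Lie type. A $C_p$-Mackey functor $L$ such that $L(C_p)$ and $L(e)$ are Lie algebras, $r$ and all $c_h$ are Lie algebra homomorphisms, and $[t(a),b]=t[a,r(b)]$, $[b,t(a)]=t[r(b),a]$ for $a\in L(e)$, $b\in L(C_p)$. It is a $C_p$-Green functor of graded Lie type if $L(C_p)$ and $L(e)$ are graded Lie algebras and the restriction, transfer and conjugation maps respect the gradation, the other conditions being unchanged. Modules. A (left) module over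 $L$ is a $C_p$-Mackey functor $M$ such that $M(H)$ is a left module over the Lie algebra $L(H)$ for $H=e,C_p$, with $r(a\cdot m)=r(a)\cdot r(m)$, $c_h(x\cdot u)=c_h(x)\cdot c_h(u)$, $t(x)\cdot m=t(x\cdot r(m))$ and $a\cdot t(u)=t(r(a)\cdot u)$ for all $a\in L(C_p)$, $m\in M(C_p)$, $x\in L(e)$, $u\in M(e)$, $h\in C_p$. Cochains. $C^n_e(L,M)$ is the module of alternating $n$-linear maps $L(e)^n\to M(e)$ (so $C^0_e=M(e)$). $C^0_{C_p}(L,M)=M(C_p)$, where $m$ is identified with the pair $(m,r_M(m))$. For $n\ge 1$, $C^n_{C_p}(L,M)$ is the module of pairs $(f_{C_p},f_e)$ of alternating $n$-linear maps $f_{C_p}:L(C_p)^n\to M(C_p)$, $f_e:L(e)^n\to M(e)$ with $r_M f_{C_p}(a_1,\dots,a_n)=f_e(r_La_1,\dots,r_La_n)$, $c_h f_e(x_1,\dots,x_n)=f_e(c_hx_1,\dots,c_hx_n)$, and $f_{C_p}(t_L(x),a_2,\dots,a_n)=t_M(f_e(x,r_La_2,\dots,r_La_n))$ (and likewise in every other argument). Coboundaries. $b_n$ on $C^n_e(L,M)$ is the usual Chevalley–Eilenberg coboundary $$\delta f(x_1,\dots,x_{n+1})=\sum_{i}(-1)^{i+1}x_i f(\dots,\widehat{x_i},\dots)+\sum_{i<j}(-1)^{i+j}f([x_i,x_j],\dots,\widehat{x_i},\dots,\widehat{x_j},\dots),$$ and $b_n'$ on $C^n_{C_p}(L,M)$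 is $(f_{C_p},f_e)\mapsto(\delta f_{C_p},\delta f_e)$; in degree $0$, $b_0'(m)=(a\mapsto a\cdot m,\ x\mapsto x\cdot r_M(m))$. $H^n_{C_p}(L,M)$ and $H^n_e(L,M)$ are the cohomologies of these two complexes. Mackey structure. Restriction $R_n:C^n_{C_p}\to C^n_e$ is $(f_{C_p},f_e)\mapsto f_e$; conjugation on $C^n_e$ is $({}^h\theta)(x_1,\dots,x_n)=c_h\theta(c_h^{-1}x_1,\dots,c_h^{-1}x_n)$; transfer $T_n:C^n_e\to C^n_{C_p}$ is $T_n(\gamma)=(\mu,\delta_\gamma)$ with $\mu(a_1,\dots,a_n)=t_M(\gamma(r_La_1,\dots,r_La_n))$ and $\delta_\gamma=\sum_{i=0}^{p-1}c_g^{i}\circ\gamma\circ (c_g^{p-i}\times\cdots\times c_g^{p-i})$. In degree $0$ these are $r_M$, $c_h$, $t_M$. They induce restriction, conjugation and transfer maps on cohomology, where $H^n(L,M)(K)=H^n_K(L,M)$. Cup product. For alternating maps $f$ of $m$ and $g$ of $n$ arguments with values in the Lie algebra $M(H)$, $$(f\cup g)(x_1,\dots,x_{m+n})=\sum_{\sigma}\mathrm{sign}(\sigma)\,[f(x_{\sigma(1)},\dots,x_{\sigma(m)}),\,g(x_{\sigma(m+1)},\dots,x_{\sigma(m+n)})]_{M(H)},$$ the sum over permutations $\sigma$ of $\{1,\dots,m+n\}$ with $\sigma(1)<\cdots<\sigma(m)$ and $\sigma(m+1)<\cdots<\sigma(m+n)$. This is $\cup_e$ on $C^*_e(L,M)$,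 and $(f_{C_p},f_e)\cup_{C_p}(g_{C_p},g_e)=(f_{C_p}\cup g_{C_p},f_e\cup g_e)$ on $C^*_{C_p}(L,M)$.
   Formalization: The Lie structure on M is additionally required to be compatible with the L-action: x·[m,n]=[x·m,n]+[m,x·n] at both levels e and C_p (true for M=L adjoint); without this the cup product need not descend to cohomology. *)

theory Defs
  imports "HOL-Algebra.Algebra" "HOL-Combinatorics.Permutations"
begin

text \<open>
  Modules are those of \<^locale>\<open>module\<close>: explicit carriers over a commutative ring record.  The
  fields \<^const>\<open>monoid.mult\<close> and \<^const>\<open>one\<close>, which a module record inherits from the ring record, play no
  role and are left undefined in the modules constructed below.  Signs are integer multiples
  in the underlying abelian group, written with \<^const>\<open>add_pow\<close>.
\<close>

definition char_zero :: "('r, 'n) ring_scheme \<Rightarrow> bool" where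
  "char_zero R \<longleftrightarrow> (\<forall>n::nat. 0 < n \<longrightarrow> add_pow R n \<one>\<^bsub>R\<^esub> \<noteq> \<zero>\<^bsub>R\<^esub>)"

definition linear_map ::
  "('r, 'n) ring_scheme \<Rightarrow> ('r, 'a, 'k) module_scheme \<Rightarrow> ('r, 'b, 'l) module_scheme
    \<Rightarrow> ('a \<Rightarrow> 'b) \<Rightarrow> bool" where
  "linear_map R A B f \<longleftrightarrow>
     f \<in> carrier A \<rightarrow> carrier B \<and>
     (\<forall>x\<in>carrier A. \<forall>y\<in>carrier A. f (x \<oplus>\<^bsub>A\<^esub> y) = f x \<oplus>\<^bsub>B\<^esub> f y) \<and>
     (\<forall>s\<in>carrier R. \<forall>x\<in>carrier A. f (s \<odot>\<^bsub>A\<^esub> x) = s \<odot>\<^bsub>B\<^esub> f x)"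

definition bilinear_map ::
  "('r, 'n) ring_scheme \<Rightarrow> ('r, 'a, 'k) module_scheme \<Rightarrow> ('r, 'b, 'l) module_scheme
    \<Rightarrow> ('r, 'c, 'm) module_scheme \<Rightarrow> ('a \<Rightarrow> 'b \<Rightarrow> 'c) \<Rightarrow> bool" where
  "bilinear_map R A B C f \<longleftrightarrow>
     (\<forall>x\<in>carrier A. linear_map R B C (f x)) \<and>
     (\<forall>y\<in>carrier B. linear_map R A C (\<lambda>x. f x y))"


section \<open>Lie algebras and graded Lie algebras\<close>

locale lie_algebra = module R A
  for R :: "('r, 'n) ring_scheme" (structure) and A :: "('r, 'a, 'k) module_scheme" (structure) +
  fixes br :: "'a \<Rightarrow> 'a \<Rightarrow> 'a"
  assumes br_bilinear: "bilinear_map R A A A br"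
    and br_self: "x \<in> carrier A \<Longrightarrow> br x x = \<zero>\<^bsub>A\<^esub>"
    and jacobi: "\<lbrakk>x \<in> carrier A; y \<in> carrier A; z \<in> carrier A\<rbrakk> \<Longrightarrow>
      br x (br y z) \<oplus>\<^bsub>A\<^esub> br y (br z x) \<oplus>\<^bsub>A\<^esub> br z (br x y) = \<zero>\<^bsub>A\<^esub>"

locale lie_module = lie_algebra R A br + B?: module R B
  for R :: "('r, 'n) ring_scheme" (structure) and A :: "('r, 'a, 'k) module_scheme" (structure)
    and br :: "'a \<Rightarrow> 'a \<Rightarrow> 'a" and B :: "('r, 'b, 'l) module_scheme" (structure) +
  fixes act :: "'a \<Rightarrow> 'b \<Rightarrow> 'b"
  assumes act_bilinear: "bilinear_map R A B B act"
    and act_bracket: "\<lbrakk>x \<in> carrier A; y \<in> carrier A; m \<in> carrier B\<rbrakk> \<Longrightarrow>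
      act (br x y) m = act x (act y m) \<ominus>\<^bsub>B\<^esub> act y (act x m)"

text \<open>
  The cup product does not descend to cohomology for an arbitrary module structure on a Lie
  algebra (in degree 0 the annihilator of the action need not be closed under the bracket), so
  compatible module and Lie structures are understood to satisfy the following condition.  It
  holds for the adjoint representation.
\<close>

definition acts_by_derivations ::
  "('r, 'a, 'k) module_scheme \<Rightarrow> ('r, 'b, 'l) module_scheme \<Rightarrow> ('b \<Rightarrow> 'b \<Rightarrow> 'b)
    \<Rightarrow> ('a \<Rightarrow> 'b \<Rightarrow> 'b) \<Rightarrow> bool" where
  "acts_by_derivations A B br act \<longleftrightarrow>
     (\<forall>x\<in>carrier A. \<forall>m\<in>carrier B. \<forall>n\<in>carrier B.
        act x (br m n) = br (act x m) n \<oplus>\<^bsub>B\<^esub> br m (act x n))"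

lemma (in lie_algebra) adjoint_acts_by_derivations: "acts_by_derivations A A br br"
proof -
  have cl: "br x y \<in> carrier A" if "x \<in> carrier A" "y \<in> carrier A" for x y
    using br_bilinear that by (auto simp: bilinear_map_def linear_map_def)
  have addl: "br (x \<oplus>\<^bsub>A\<^esub> y) z = br x z \<oplus>\<^bsub>A\<^esub> br y z"
    and addr: "br z (x \<oplus>\<^bsub>A\<^esub> y) = br z x \<oplus>\<^bsub>A\<^esub> br z y"
    if "x \<in> carrier A" "y \<in> carrier A" "z \<in> carrier A" for x y z
    using br_bilinear that by (auto simp: bilinear_map_def linear_map_def)
  have neg: "x = \<ominus>\<^bsub>A\<^esub> y"
    if "x \<oplus>\<^bsub>A\<^esub> y = \<zero>\<^bsub>A\<^esub>" "x \<in> carrier A" "y \<in> carrier A" for x y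
    using that by (metis M.minus_equality)
  have swap: "br x y \<oplus>\<^bsub>A\<^esub> br y x = \<zero>\<^bsub>A\<^esub>" if "x \<in> carrier A" "y \<in> carrier A" for x y
  proof -
    have "\<zero>\<^bsub>A\<^esub> = br x (x \<oplus>\<^bsub>A\<^esub> y) \<oplus>\<^bsub>A\<^esub> br y (x \<oplus>\<^bsub>A\<^esub> y)"
      using br_self[of "x \<oplus>\<^bsub>A\<^esub> y"] addl[of x y "x \<oplus>\<^bsub>A\<^esub> y"] that by simp
    also have "\<dots> = br x y \<oplus>\<^bsub>A\<^esub> br y x"
      using that by (simp add: addr cl br_self)
    finally show ?thesis by simp
  qed
  have zr: "br z \<zero>\<^bsub>A\<^esub> = \<zero>\<^bsub>A\<^esub>" if "z \<in> carrier A" for z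
    using addr[of "\<zero>\<^bsub>A\<^esub>" "\<zero>\<^bsub>A\<^esub>" z] that cl by simp
  show ?thesis
    unfolding acts_by_derivations_def
  proof (intro ballI)
    fix x m n assume c: "x \<in> carrier A" "m \<in> carrier A" "n \<in> carrier A"
    have "br m (br n x) = \<ominus>\<^bsub>A\<^esub> br m (br x n)"
      using addr[of "br n x" "br x n" m] swap[of n x] zr[of m] c
      by (intro neg) (auto simp: cl)
    moreover have "br n (br x m) = \<ominus>\<^bsub>A\<^esub> br (br x m) n"
      using swap[of n "br x m"] c by (intro neg) (auto simp: cl)
    moreover have "br x (br m n) = \<ominus>\<^bsub>A\<^esub> (br m (br n x) \<oplus>\<^bsub>A\<^esub> br n (br x m))"
      using jacobi[of x m n] c by (intro neg) (auto simp: cl M.a_assoc)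
    ultimately show "br x (br m n) = br (br x m) n \<oplus>\<^bsub>A\<^esub> br m (br x n)"
      using c by (simp add: cl M.minus_add M.a_comm)
  qed
qed

text \<open>
  Graded Lie algebras carry the usual Koszul signs.  Since 2 and 3 need not be invertible, the
  vanishing of \<open>[x, x]\<close> for \<open>x\<close> of even degree and of \<open>[x, [x, x]]\<close> for \<open>x\<close> of odd degree is
  part of the definition, just as \<open>[x, x] = 0\<close> is for ungraded Lie algebras.
\<close>

locale graded_lie_algebra = module R A
  for R :: "('r, 'n) ring_scheme" (structure) and A :: "('r, 'a, 'k) module_scheme" (structure) +
  fixes gr :: "nat \<Rightarrow> 'a set" and br :: "'a \<Rightarrow> 'a \<Rightarrow> 'a"
  assumes gr_submodule: "submodule (gr n) R A"
    and gr_direct_sum: "a \<in> carrier A \<Longrightarrow>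
      \<exists>!u. (\<forall>n. u n \<in> gr n) \<and> finite {n. u n \<noteq> \<zero>\<^bsub>A\<^esub>} \<and>
           a = (\<Oplus>\<^bsub>A\<^esub>n\<in>{n. u n \<noteq> \<zero>\<^bsub>A\<^esub>}. u n)"
    and br_bilinear: "bilinear_map R A A A br"
    and br_graded: "\<lbrakk>x \<in> gr i; y \<in> gr j\<rbrakk> \<Longrightarrow> br x y \<in> gr (i + j)"
    and br_antisym: "\<lbrakk>x \<in> gr i; y \<in> gr j\<rbrakk> \<Longrightarrow>
      br x y = \<ominus>\<^bsub>A\<^esub> (add_pow A ((-1::int) ^ (i * j)) (br y x))"
    and br_jacobi: "\<lbrakk>x \<in> gr i; y \<in> gr j; z \<in> gr k\<rbrakk> \<Longrightarrow>
      br x (br y z) = br (br x y) z \<oplus>\<^bsub>A\<^esub> add_pow A ((-1::int) ^ (i * j)) (br y (br x z))"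
    and br_even: "\<lbrakk>even i; x \<in> gr i\<rbrakk> \<Longrightarrow> br x x = \<zero>\<^bsub>A\<^esub>"
    and br_odd: "\<lbrakk>odd i; x \<in> gr i\<rbrakk> \<Longrightarrow> br x (br x x) = \<zero>\<^bsub>A\<^esub>"


section \<open>Mackey and Green functors for a cyclic group of prime order\<close>

locale prime_cyclic_group = group G
  for G :: "('g, 'q) monoid_scheme" (structure) and p :: nat and g :: 'g +
  assumes prime: "Factorial_Ring.prime p"
    and order: "order G = p"
    and generator: "g \<in> carrier G" "generate G {g} = carrier G"

record ('r, 'g, 'x, 'y) mackey =
  at_Cp :: "('r, 'x) module"
  at_e :: "('r, 'y) module"
  res :: "'x \<Rightarrow> 'y"
  trf :: "'y \<Rightarrow> 'x"
  cnj :: "'g \<Rightarrow> 'y \<Rightarrow> 'y"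

record ('r, 'g, 'x, 'y) green = "('r, 'g, 'x, 'y) mackey" +
  br_Cp :: "'x \<Rightarrow> 'x \<Rightarrow> 'x"
  br_e :: "'y \<Rightarrow> 'y \<Rightarrow> 'y"

record ('r, 'g, 'x, 'y) graded_green = "('r, 'g, 'x, 'y) green" +
  gr_Cp :: "nat \<Rightarrow> 'x set"
  gr_e :: "nat \<Rightarrow> 'y set"

locale mackey_functor =
  fixes R :: "('r, 'n) ring_scheme" and G :: "('g, 'q) monoid_scheme"
    and M :: "('r, 'g, 'x, 'y, 'z) mackey_scheme"
  assumes module_Cp: "module R (at_Cp M)"
    and module_e: "module R (at_e M)"
    and res_linear: "linear_map R (at_Cp M) (at_e M) (res M)"
    and trf_linear: "linear_map R (at_e M) (at_Cp M) (trf M)"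
    and cnj_linear: "h \<in> carrier G \<Longrightarrow> linear_map R (at_e M) (at_e M) (cnj M h)"
    and cnj_one: "u \<in> carrier (at_e M) \<Longrightarrow> cnj M \<one>\<^bsub>G\<^esub> u = u"
    and cnj_mult: "\<lbrakk>h \<in> carrier G; k \<in> carrier G; u \<in> carrier (at_e M)\<rbrakk> \<Longrightarrow>
      cnj M (h \<otimes>\<^bsub>G\<^esub> k) u = cnj M h (cnj M k u)"
    and cnj_res: "\<lbrakk>h \<in> carrier G; m \<in> carrier (at_Cp M)\<rbrakk> \<Longrightarrow> cnj M h (res M m) = res M m"
    and trf_cnj: "\<lbrakk>h \<in> carrier G; u \<in> carrier (at_e M)\<rbrakk> \<Longrightarrow> trf M (cnj M h u) = trf M u"
    and res_trf: "u \<in> carrier (at_e M) \<Longrightarrow>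
      res M (trf M u) = (\<Oplus>\<^bsub>at_e M\<^esub>h\<in>carrier G. cnj M h u)"

text \<open>The bracket conditions common to Green functors of Lie type and of graded Lie type.\<close>

locale green_brackets = mackey_functor R G L
  for R :: "('r, 'n) ring_scheme" and G :: "('g, 'q) monoid_scheme"
    and L :: "('r, 'g, 'x, 'y, 'z) green_scheme" +
  assumes res_br: "\<lbrakk>a \<in> carrier (at_Cp L); b \<in> carrier (at_Cp L)\<rbrakk> \<Longrightarrow>
      res L (br_Cp L a b) = br_e L (res L a) (res L b)"
    and cnj_br: "\<lbrakk>h \<in> carrier G; x \<in> carrier (at_e L); y \<in> carrier (at_e L)\<rbrakk> \<Longrightarrow>
      cnj L h (br_e L x y) = br_e L (cnj L h x) (cnj L h y)"
    and frobenius_left: "\<lbrakk>x \<in> carrier (at_e L); b \<in> carrier (at_Cp L)\<rbrakk> \<Longrightarrow>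
      br_Cp L (trf L x) b = trf L (br_e L x (res L b))"
    and frobenius_right: "\<lbrakk>x \<in> carrier (at_e L); b \<in> carrier (at_Cp L)\<rbrakk> \<Longrightarrow>
      br_Cp L b (trf L x) = trf L (br_e L (res L b) x)"

locale lie_green_functor = green_brackets R G L
  for R :: "('r, 'n) ring_scheme" and G :: "('g, 'q) monoid_scheme"
    and L :: "('r, 'g, 'x, 'y, 'z) green_scheme" +
  assumes lie_Cp: "lie_algebra R (at_Cp L) (br_Cp L)"
    and lie_e: "lie_algebra R (at_e L) (br_e L)"

locale graded_lie_green_functor = green_brackets R G L
  for R :: "('r, 'n) ring_scheme" and G :: "('g, 'q) monoid_scheme"
    and L :: "('r, 'g, 'x, 'y, 'z) graded_green_scheme" +
  assumes graded_lie_Cp: "graded_lie_algebra R (at_Cp L) (gr_Cp L) (br_Cp L)"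
    and graded_lie_e: "graded_lie_algebra R (at_e L) (gr_e L) (br_e L)"
    and res_graded: "res L \<in> gr_Cp L n \<rightarrow> gr_e L n"
    and trf_graded: "trf L \<in> gr_e L n \<rightarrow> gr_Cp L n"
    and cnj_graded: "h \<in> carrier G \<Longrightarrow> cnj L h \<in> gr_e L n \<rightarrow> gr_e L n"

locale green_module = mackey_functor R G M
  for R :: "('r, 'n) ring_scheme" and G :: "('g, 'q) monoid_scheme"
    and L :: "('r, 'g, 'lc, 'le, 'z) green_scheme"
    and M :: "('r, 'g, 'mc, 'me, 'w) mackey_scheme" +
  fixes act_Cp :: "'lc \<Rightarrow> 'mc \<Rightarrow> 'mc" and act_e :: "'le \<Rightarrow> 'me \<Rightarrow> 'me"
  assumes lie_module_Cp: "lie_module R (at_Cp L) (br_Cp L) (at_Cp M) act_Cp"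
    and lie_module_e: "lie_module R (at_e L) (br_e L) (at_e M) act_e"
    and res_act: "\<lbrakk>a \<in> carrier (at_Cp L); m \<in> carrier (at_Cp M)\<rbrakk> \<Longrightarrow>
      res M (act_Cp a m) = act_e (res L a) (res M m)"
    and cnj_act: "\<lbrakk>h \<in> carrier G; x \<in> carrier (at_e L); u \<in> carrier (at_e M)\<rbrakk> \<Longrightarrow>
      cnj M h (act_e x u) = act_e (cnj L h x) (cnj M h u)"
    and trf_act: "\<lbrakk>x \<in> carrier (at_e L); m \<in> carrier (at_Cp M)\<rbrakk> \<Longrightarrow>
      act_Cp (trf L x) m = trf M (act_e x (res M m))"
    and act_trf: "\<lbrakk>a \<in> carrier (at_Cp L); u \<in> carrier (at_e M)\<rbrakk> \<Longrightarrow>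
      act_Cp a (trf M u) = trf M (act_e (res L a) u)"


section \<open>Alternating maps, Chevalley-Eilenberg differential, cup product\<close>

text \<open>
  An \<open>n\<close>-tuple is a list of length \<open>n\<close>, indexed from 0; this leaves all signs below unchanged.
  Multilinear maps are extensional functions on lists, so that they form a module.
\<close>

definition tuples :: "('r, 'a, 'k) module_scheme \<Rightarrow> nat \<Rightarrow> 'a list set" where
  "tuples A n = {xs. length xs = n \<and> set xs \<subseteq> carrier A}"

definition multilinear ::
  "('r, 'n) ring_scheme \<Rightarrow> ('r, 'a, 'k) module_scheme \<Rightarrow> ('r, 'b, 'l) module_scheme \<Rightarrow> nat
    \<Rightarrow> ('a list \<Rightarrow> 'b) \<Rightarrow> bool" where
  "multilinear R A B n f \<longleftrightarrow>
     (\<forall>xs\<in>tuples A n. \<forall>i<n. linear_map R A B (\<lambda>y. f (xs[i := y])))"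

definition alternating ::
  "('r, 'a, 'k) module_scheme \<Rightarrow> ('r, 'b, 'l) module_scheme \<Rightarrow> nat \<Rightarrow> ('a list \<Rightarrow> 'b) \<Rightarrow> bool" where
  "alternating A B n f \<longleftrightarrow>
     (\<forall>xs\<in>tuples A n. \<forall>i j. i < j \<and> j < n \<and> xs ! i = xs ! j \<longrightarrow> f xs = \<zero>\<^bsub>B\<^esub>)"

definition alt_maps ::
  "('r, 'n) ring_scheme \<Rightarrow> ('r, 'a, 'k) module_scheme \<Rightarrow> ('r, 'b, 'l) module_scheme \<Rightarrow> nat
    \<Rightarrow> ('r, 'a list \<Rightarrow> 'b) module" where
  "alt_maps R A B n =
     \<lparr>carrier = {f \<in> tuples A n \<rightarrow>\<^sub>E carrier B. multilinear R A B n f \<and> alternating A B n f},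
      monoid.mult = undefined, one = undefined,
      ring.zero = (\<lambda>xs\<in>tuples A n. \<zero>\<^bsub>B\<^esub>),
      add = (\<lambda>f f'. \<lambda>xs\<in>tuples A n. f xs \<oplus>\<^bsub>B\<^esub> f' xs),
      smult = (\<lambda>s f. \<lambda>xs\<in>tuples A n. s \<odot>\<^bsub>B\<^esub> f xs)\<rparr>"

definition ce_diff ::
  "('r, 'a, 'k) module_scheme \<Rightarrow> ('a \<Rightarrow> 'a \<Rightarrow> 'a) \<Rightarrow> ('r, 'b, 'l) module_scheme
    \<Rightarrow> ('a \<Rightarrow> 'b \<Rightarrow> 'b) \<Rightarrow> nat \<Rightarrow> ('a list \<Rightarrow> 'b) \<Rightarrow> 'a list \<Rightarrow> 'b" where
  "ce_diff A br B act n f =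
     (\<lambda>xs\<in>tuples A (Suc n).
        (\<Oplus>\<^bsub>B\<^esub>i\<in>{..n}. add_pow B ((-1::int) ^ i) (act (xs ! i) (f (nths xs (- {i}))))) \<oplus>\<^bsub>B\<^esub>
        finsum B (\<lambda>(i, j). add_pow B ((-1::int) ^ (i + j))
                    (f (br (xs ! i) (xs ! j) # nths xs (- {i, j}))))
          {(i, j). i < j \<and> j \<le> n})"

definition shuffle_perms :: "nat \<Rightarrow> nat \<Rightarrow> (nat \<Rightarrow> nat) set" where
  "shuffle_perms m n =
     {\<sigma>. \<sigma> permutes {..<m + n} \<and> strict_mono_on {..<m} \<sigma> \<and> strict_mono_on {m..<m + n} \<sigma>}"

definition cup ::
  "('r, 'a, 'k) module_scheme \<Rightarrow> ('r, 'b, 'l) module_scheme \<Rightarrow> ('b \<Rightarrow> 'b \<Rightarrow> 'b) \<Rightarrow> nat \<Rightarrow> nat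
    \<Rightarrow> ('a list \<Rightarrow> 'b) \<Rightarrow> ('a list \<Rightarrow> 'b) \<Rightarrow> 'a list \<Rightarrow> 'b" where
  "cup A B brB m n f f' =
     (\<lambda>xs\<in>tuples A (m + n).
        \<Oplus>\<^bsub>B\<^esub>\<sigma>\<in>shuffle_perms m n. add_pow B (sign \<sigma>)
          (brB (f (map (\<lambda>i. xs ! \<sigma> i) [0..<m])) (f' (map (\<lambda>i. xs ! \<sigma> i) [m..<m + n]))))"


section \<open>Quotients, cohomology and direct sums of modules\<close>

definition quotient_module :: "('r, 'a, 'k) module_scheme \<Rightarrow> 'a set \<Rightarrow> ('r, 'a set) module" where
  "quotient_module A N =
     \<lparr>carrier = a_rcosets\<^bsub>A\<^esub> N, monoid.mult = undefined, one = undefined,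
      ring.zero = N, add = set_add A,
      smult = (\<lambda>s S. \<Union>x\<in>S. N +>\<^bsub>A\<^esub> (s \<odot>\<^bsub>A\<^esub> x))\<rparr>"

definition cocycles :: "(nat \<Rightarrow> ('r, 'c) module) \<Rightarrow> (nat \<Rightarrow> 'c \<Rightarrow> 'c) \<Rightarrow> nat \<Rightarrow> 'c set" where
  "cocycles C d n = {f \<in> carrier (C n). d n f = \<zero>\<^bsub>C (Suc n)\<^esub>}"

definition coboundaries :: "(nat \<Rightarrow> ('r, 'c) module) \<Rightarrow> (nat \<Rightarrow> 'c \<Rightarrow> 'c) \<Rightarrow> nat \<Rightarrow> 'c set" where
  "coboundaries C d n = (case n of 0 \<Rightarrow> {\<zero>\<^bsub>C 0\<^esub>} | Suc k \<Rightarrow> d k ` carrier (C k))"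

definition cohomology ::
  "(nat \<Rightarrow> ('r, 'c) module) \<Rightarrow> (nat \<Rightarrow> 'c \<Rightarrow> 'c) \<Rightarrow> nat \<Rightarrow> ('r, 'c set) module" where
  "cohomology C d n =
     quotient_module ((C n)\<lparr>carrier := cocycles C d n\<rparr>) (coboundaries C d n)"

definition cohomology_class ::
  "(nat \<Rightarrow> ('r, 'c) module) \<Rightarrow> (nat \<Rightarrow> 'c \<Rightarrow> 'c) \<Rightarrow> nat \<Rightarrow> 'c \<Rightarrow> 'c set" where
  "cohomology_class C d n f = coboundaries C d n +>\<^bsub>C n\<^esub> f"

text \<open>
  Operations induced on cohomology are unions over all representatives, as in
  \<^const>\<open>rcoset_mult\<close>.  Such a union is a single coset only if all representatives yield
  the same class, so that closure of the carriers includes well-definedness.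
\<close>

definition induced_map ::
  "(nat \<Rightarrow> ('r, 'c) module) \<Rightarrow> (nat \<Rightarrow> 'c \<Rightarrow> 'c) \<Rightarrow> nat \<Rightarrow> ('b \<Rightarrow> 'c) \<Rightarrow> 'b set \<Rightarrow> 'c set" where
  "induced_map C d n \<phi> S = (\<Union>f\<in>S. cohomology_class C d n (\<phi> f))"

definition direct_sum :: "(nat \<Rightarrow> ('r, 'a) module) \<Rightarrow> ('r, nat \<Rightarrow> 'a) module" where
  "direct_sum A =
     \<lparr>carrier = {u. (\<forall>n. u n \<in> carrier (A n)) \<and> finite {n. u n \<noteq> \<zero>\<^bsub>A n\<^esub>}},
      monoid.mult = undefined, one = undefined,
      ring.zero = (\<lambda>n. \<zero>\<^bsub>A n\<^esub>),
      add = (\<lambda>u v n. u n \<oplus>\<^bsub>A n\<^esub> v n),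
      smult = (\<lambda>s u n. s \<odot>\<^bsub>A n\<^esub> u n)\<rparr>"

definition direct_sum_grading :: "(nat \<Rightarrow> ('r, 'a) module) \<Rightarrow> nat \<Rightarrow> (nat \<Rightarrow> 'a) set" where
  "direct_sum_grading A n = {u \<in> carrier (direct_sum A). \<forall>k. k \<noteq> n \<longrightarrow> u k = \<zero>\<^bsub>A k\<^esub>}"

text \<open>The product on the direct sum of the cohomology modules that is induced by a graded
  product of cochains.\<close>

definition induced_product ::
  "(nat \<Rightarrow> ('r, 'c) module) \<Rightarrow> (nat \<Rightarrow> 'c \<Rightarrow> 'c) \<Rightarrow> (nat \<Rightarrow> nat \<Rightarrow> 'c \<Rightarrow> 'c \<Rightarrow> 'c)
    \<Rightarrow> (nat \<Rightarrow> 'c set) \<Rightarrow> (nat \<Rightarrow> 'c set) \<Rightarrow> nat \<Rightarrow> 'c set" where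
  "induced_product C d P u v =
     (\<lambda>k. \<Oplus>\<^bsub>cohomology C d k\<^esub>i\<in>{..k}.
        (\<Union>f\<in>u i. \<Union>f'\<in>v (k - i). cohomology_class C d k (P i (k - i) f f')))"


section \<open>The cochain complexes of a module over a Green functor of Lie type\<close>

definition C_e ::
  "('r, 'n) ring_scheme \<Rightarrow> ('r, 'g, 'lc, 'le, 'z) green_scheme
    \<Rightarrow> ('r, 'g, 'mc, 'me, 'w) mackey_scheme \<Rightarrow> nat \<Rightarrow> ('r, 'le list \<Rightarrow> 'me) module" where
  "C_e R L M n = alt_maps R (at_e L) (at_e M) n"

text \<open>
  For \<open>n = 0\<close> the transfer condition is void and the pairs are exactly \<open>(m, res M m)\<close>,
  because \<open>cnj M h (res M m) = res M m\<close>.  Similarly all operations on cochains specialise to the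
  given ones in degree 0.
\<close>

definition C_Cp ::
  "('r, 'n) ring_scheme \<Rightarrow> ('g, 'q) monoid_scheme \<Rightarrow> ('r, 'g, 'lc, 'le, 'z) green_scheme
    \<Rightarrow> ('r, 'g, 'mc, 'me, 'w) mackey_scheme \<Rightarrow> nat
    \<Rightarrow> ('r, ('lc list \<Rightarrow> 'mc) \<times> ('le list \<Rightarrow> 'me)) module" where
  "C_Cp R G L M n =
     (let A = alt_maps R (at_Cp L) (at_Cp M) n; B = alt_maps R (at_e L) (at_e M) n in
      \<lparr>carrier = {(f, f'). f \<in> carrier A \<and> f' \<in> carrier B \<and>
         (\<forall>as\<in>tuples (at_Cp L) n. res M (f as) = f' (map (res L) as)) \<and>
         (\<forall>h\<in>carrier G. \<forall>xs\<in>tuples (at_e L) n. cnj M h (f' xs) = f' (map (cnj L h) xs)) \<and>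
         (\<forall>as\<in>tuples (at_Cp L) n. \<forall>i<n. \<forall>x\<in>carrier (at_e L).
            f (as[i := trf L x]) = trf M (f' ((map (res L) as)[i := x])))},
       monoid.mult = undefined, one = undefined,
       ring.zero = (\<zero>\<^bsub>A\<^esub>, \<zero>\<^bsub>B\<^esub>),
       add = (\<lambda>(f, f') (k, k'). (f \<oplus>\<^bsub>A\<^esub> k, f' \<oplus>\<^bsub>B\<^esub> k')),
       smult = (\<lambda>s (f, f'). (s \<odot>\<^bsub>A\<^esub> f, s \<odot>\<^bsub>B\<^esub> f'))\<rparr>)"

definition b_e ::
  "('r, 'g, 'lc, 'le, 'z) green_scheme \<Rightarrow> ('r, 'g, 'mc, 'me, 'w) mackey_scheme
    \<Rightarrow> ('le \<Rightarrow> 'me \<Rightarrow> 'me) \<Rightarrow> nat \<Rightarrow> ('le list \<Rightarrow> 'me) \<Rightarrow> 'le list \<Rightarrow> 'me" where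
  "b_e L M act_e n f = ce_diff (at_e L) (br_e L) (at_e M) act_e n f"

definition b_Cp ::
  "('r, 'g, 'lc, 'le, 'z) green_scheme \<Rightarrow> ('r, 'g, 'mc, 'me, 'w) mackey_scheme
    \<Rightarrow> ('lc \<Rightarrow> 'mc \<Rightarrow> 'mc) \<Rightarrow> ('le \<Rightarrow> 'me \<Rightarrow> 'me) \<Rightarrow> nat
    \<Rightarrow> ('lc list \<Rightarrow> 'mc) \<times> ('le list \<Rightarrow> 'me) \<Rightarrow> ('lc list \<Rightarrow> 'mc) \<times> ('le list \<Rightarrow> 'me)" where
  "b_Cp L M act_Cp act_e n = (\<lambda>(f, f').
     (ce_diff (at_Cp L) (br_Cp L) (at_Cp M) act_Cp n f,
      ce_diff (at_e L) (br_e L) (at_e M) act_e n f'))"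

definition conjugate_cochain ::
  "('g, 'q) monoid_scheme \<Rightarrow> ('r, 'g, 'lc, 'le, 'z) green_scheme
    \<Rightarrow> ('r, 'g, 'mc, 'me, 'w) mackey_scheme \<Rightarrow> nat \<Rightarrow> 'g
    \<Rightarrow> ('le list \<Rightarrow> 'me) \<Rightarrow> 'le list \<Rightarrow> 'me" where
  "conjugate_cochain G L M n h \<theta> =
     (\<lambda>xs\<in>tuples (at_e L) n. cnj M h (\<theta> (map (cnj L (inv\<^bsub>G\<^esub> h)) xs)))"

definition transfer_cochain ::
  "nat \<Rightarrow> 'g \<Rightarrow> ('r, 'g, 'lc, 'le, 'z) green_scheme \<Rightarrow> ('r, 'g, 'mc, 'me, 'w) mackey_scheme
    \<Rightarrow> nat \<Rightarrow> ('le list \<Rightarrow> 'me) \<Rightarrow> ('lc list \<Rightarrow> 'mc) \<times> ('le list \<Rightarrow> 'me)" where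
  "transfer_cochain p g L M n \<gamma> =
     ((\<lambda>as\<in>tuples (at_Cp L) n. trf M (\<gamma> (map (res L) as))),
      (\<lambda>xs\<in>tuples (at_e L) n.
         \<Oplus>\<^bsub>at_e M\<^esub>i\<in>{..<p}. (cnj M g ^^ i) (\<gamma> (map (cnj L g ^^ (p - i)) xs))))"

definition cup_e ::
  "('r, 'g, 'lc, 'le, 'z) green_scheme \<Rightarrow> ('r, 'g, 'mc, 'me, 'w) green_scheme \<Rightarrow> nat \<Rightarrow> nat
    \<Rightarrow> ('le list \<Rightarrow> 'me) \<Rightarrow> ('le list \<Rightarrow> 'me) \<Rightarrow> 'le list \<Rightarrow> 'me" where
  "cup_e L M m n f k = cup (at_e L) (at_e M) (br_e M) m n f k"

definition cup_Cp ::
  "('r, 'g, 'lc, 'le, 'z) green_scheme \<Rightarrow> ('r, 'g, 'mc, 'me, 'w) green_scheme \<Rightarrow> nat \<Rightarrow> nat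
    \<Rightarrow> ('lc list \<Rightarrow> 'mc) \<times> ('le list \<Rightarrow> 'me) \<Rightarrow> ('lc list \<Rightarrow> 'mc) \<times> ('le list \<Rightarrow> 'me)
    \<Rightarrow> ('lc list \<Rightarrow> 'mc) \<times> ('le list \<Rightarrow> 'me)" where
  "cup_Cp L M m n = (\<lambda>(f, f') (k, k').
     (cup (at_Cp L) (at_Cp M) (br_Cp M) m n f k, cup (at_e L) (at_e M) (br_e M) m n f' k'))"

text \<open>The graded cohomology, with its Mackey structure, the cup product and the grading.\<close>

definition cohomology_green ::
  "('r, 'n) ring_scheme \<Rightarrow> ('g, 'q) monoid_scheme \<Rightarrow> nat \<Rightarrow> 'g
    \<Rightarrow> ('r, 'g, 'lc, 'le, 'z) green_scheme \<Rightarrow> ('r, 'g, 'mc, 'me, 'w) green_scheme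
    \<Rightarrow> ('lc \<Rightarrow> 'mc \<Rightarrow> 'mc) \<Rightarrow> ('le \<Rightarrow> 'me \<Rightarrow> 'me)
    \<Rightarrow> ('r, 'g, nat \<Rightarrow> (('lc list \<Rightarrow> 'mc) \<times> ('le list \<Rightarrow> 'me)) set,
         nat \<Rightarrow> ('le list \<Rightarrow> 'me) set) graded_green" where
  "cohomology_green R G p g L M act_Cp act_e =
     (let CC = C_Cp R G L M; dC = b_Cp L M act_Cp act_e; HC = cohomology CC dC;
          CE = C_e R L M; dE = b_e L M act_e; HE = cohomology CE dE in
      \<lparr>at_Cp = direct_sum HC,
       at_e = direct_sum HE,
       res = (\<lambda>u n. induced_map CE dE n snd (u n)),
       trf = (\<lambda>u n. induced_map CC dC n (transfer_cochain p g L M n) (u n)),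
       cnj = (\<lambda>h u n. induced_map CE dE n (conjugate_cochain G L M n h) (u n)),
       br_Cp = induced_product CC dC (cup_Cp L M),
       br_e = induced_product CE dE (cup_e L M),
       gr_Cp = direct_sum_grading HC,
       gr_e = direct_sum_grading HE\<rparr>)"

end

(* Contraction with an element x of the Lie algebra determines an alternating map of positive degree.
   Cartan's formula expresses the contraction of the Chevalley-Eilenberg differential by the Lie
   derivative and the differential in smaller degree, and contraction is an antiderivation of the
   cup product.  So all identities for cochains (the square of d vanishes, Leibniz rule, graded
   antisymmetry and Jacobi identity, vanishing of [f,f] in even and of [f,[f,f]] in odd degree) follow
   by induction on the degree, over any ring.  Restriction, conjugation and transfer are chain maps
   compatible with the cup product already on cochains, so the Mackey and Frobenius conditions pass
   to cohomology. *)

theory Submission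
  imports Defs
begin

section \<open>Alternating maps on abelian groups\<close>

text \<open>The statement lives on explicit carriers: operations are partial, and cochains are
  extensional functions given by sums over pairs and shuffles. An induction by contraction there
  would drag membership conditions through every step. The calculus is therefore done for total
  functions on lists over types of class \<open>ab_group_add\<close>, with recursive
  \<open>ce\<close> and \<open>wedge\<close>, and tied to the explicit sums only once, by
  \<open>D_eq_sum\<close> and \<open>wedge_eq_sum\<close>. The way back is the type
  \<open>ambient\<close>, of which each carrier is a retract through \<open>emb\<close> and
  \<open>prj\<close>. Graded antisymmetry and Jacobi give only 2[f,f] = 0 in even and 3[f,[f,f]] = 0
  in odd degree; a single contraction splits the brackets into terms that cancel exactly, so nothing
  is divided. A further obstacle is the transfer condition on pairs of cochains. Transfer is no Lie
  homomorphism, and r(t(x)) is the sum of the conjugates of x, not x, so the condition does not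
  follow from naturality. It is checked in the first argument, contracting with t(x) above and x
  below; Frobenius reciprocity matches the results, and alternation supplies the other
  arguments.\<close>

definition alt_sign :: "nat \<Rightarrow> 'b::ab_group_add \<Rightarrow> 'b" where
  "alt_sign m v = (if even m then v else - v)"

lemma alt_sign_simps [simp]:
  "alt_sign 0 v = v" "alt_sign (Suc m) v = - alt_sign m v"
  "alt_sign m (- v) = - alt_sign m v" "alt_sign m 0 = 0"
  "alt_sign m (alt_sign m v) = v"
  by (auto simp: alt_sign_def)

lemma alt_sign_add: "alt_sign m (u + v) = alt_sign m u + alt_sign m v"
  and alt_sign_diff: "alt_sign m (u - v) = alt_sign m u - alt_sign m v"
  by (auto simp: alt_sign_def)

text \<open>The degree of a cochain is not recorded: a list argument carries it.  The recursion for
  \<open>ce\<close> is Cartan's formula \<open>\<iota>_x d = L_x - d \<iota>_x\<close>, that for \<open>wedge\<close> says that \<open>\<iota>_x\<close> is an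
  antiderivation; the value of \<open>wedge brB m f g\<close> on lists shorter than \<open>m\<close> is 0.\<close>

primrec lie_der ::
  "('a \<Rightarrow> 'a \<Rightarrow> 'a) \<Rightarrow> ('a \<Rightarrow> 'b \<Rightarrow> 'b) \<Rightarrow> 'a \<Rightarrow> ('a list \<Rightarrow> 'b::ab_group_add) \<Rightarrow> 'a list \<Rightarrow> 'b" where
  "lie_der br act x f [] = act x (f [])"
| "lie_der br act x f (y # ys) = lie_der br act x (\<lambda>zs. f (y # zs)) ys - f (br x y # ys)"

primrec ce ::
  "('a \<Rightarrow> 'a \<Rightarrow> 'a) \<Rightarrow> ('a \<Rightarrow> 'b \<Rightarrow> 'b) \<Rightarrow> ('a list \<Rightarrow> 'b::ab_group_add) \<Rightarrow> 'a list \<Rightarrow> 'b" where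
  "ce br act f [] = 0"
| "ce br act f (x # xs) = lie_der br act x f xs - ce br act (\<lambda>zs. f (x # zs)) xs"

primrec wedge ::
  "('b \<Rightarrow> 'b \<Rightarrow> 'b) \<Rightarrow> nat \<Rightarrow> ('a list \<Rightarrow> 'b) \<Rightarrow> ('a list \<Rightarrow> 'b::ab_group_add) \<Rightarrow> 'a list \<Rightarrow> 'b" where
  "wedge brB m f g [] = (if m = 0 then brB (f []) (g []) else 0)"
| "wedge brB m f g (x # xs) =
     (if m = 0 then 0 else wedge brB (m - 1) (\<lambda>zs. f (x # zs)) g xs) +
     alt_sign m (wedge brB m f (\<lambda>zs. g (x # zs)) xs)"

lemma lie_der_cong:
  "(\<And>zs. length zs = length xs \<Longrightarrow> f zs = f' zs) \<Longrightarrow> lie_der br act x f xs = lie_der br act x f' xs"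
proof (induction xs arbitrary: f f')
  case (Cons y ys)
  have "lie_der br act x (\<lambda>zs. f (y # zs)) ys = lie_der br act x (\<lambda>zs. f' (y # zs)) ys"
    by (rule Cons.IH) (simp add: Cons.prems)
  then show ?case by (simp add: Cons.prems)
qed simp

lemma ce_cong:
  "(\<And>zs. Suc (length zs) = length xs \<Longrightarrow> f zs = f' zs) \<Longrightarrow> ce br act f xs = ce br act f' xs"
proof (induction xs arbitrary: f f')
  case (Cons x xs)
  have "lie_der br act x f xs = lie_der br act x f' xs"
    by (rule lie_der_cong) (use Cons.prems in auto)
  moreover have "ce br act (\<lambda>zs. f (x # zs)) xs = ce br act (\<lambda>zs. f' (x # zs)) xs"
    by (rule Cons.IH) (use Cons.prems in auto)
  ultimately show ?case by simp
qed simp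

lemma wedge_cong:
  "(\<And>zs. length zs = m \<Longrightarrow> f zs = f' zs) \<Longrightarrow> (\<And>zs. m + length zs = length xs \<Longrightarrow> g zs = g' zs) \<Longrightarrow>
    wedge brB m f g xs = wedge brB m f' g' xs"
proof (induction xs arbitrary: m f f' g g')
  case (Cons x xs)
  have "m \<noteq> 0 \<Longrightarrow> wedge brB (m - 1) (\<lambda>zs. f (x # zs)) g xs = wedge brB (m - 1) (\<lambda>zs. f' (x # zs)) g' xs"
    by (rule Cons.IH) (use Cons.prems in auto)
  moreover have "wedge brB m f (\<lambda>zs. g (x # zs)) xs = wedge brB m f' (\<lambda>zs. g' (x # zs)) xs"
    by (rule Cons.IH) (use Cons.prems in auto)
  ultimately show ?case by simp
qed auto

lemma wedge_short: "length xs < m \<Longrightarrow> wedge brB m f g xs = 0"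
  by (induction xs arbitrary: m f g) auto

lemma wedge_0: "wedge brB 0 f g xs = brB (f []) (g xs)"
  by (induction xs arbitrary: f g) auto

text \<open>Relational parametricity.  Graphs of homomorphisms give naturality, converse graphs of the
  transfer give the Frobenius-type compatibilities.\<close>

lemma lie_der_rel:
  assumes "list_all2 RA xs xs'"
    and "\<And>ys ys'. list_all2 RA ys ys' \<Longrightarrow> length ys = length xs \<Longrightarrow> RB (act x (f ys)) (act' x' (f' ys'))"
    and "\<And>ys ys' i. list_all2 RA ys ys' \<Longrightarrow> length ys = length xs \<Longrightarrow> i < length ys \<Longrightarrow>
      RB (f (ys[i := br x (ys ! i)])) (f' (ys'[i := br' x' (ys' ! i)]))"
    and "\<And>u v u' v'. RB u u' \<Longrightarrow> RB v v' \<Longrightarrow> RB (u - v) (u' - v')"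
  shows "RB (lie_der br act x f xs) (lie_der br' act' x' f' xs')"
  using assms(1-3)
proof (induction xs xs' arbitrary: f f' rule: list_all2_induct)
  case Nil
  show ?case using Nil(1)[of "[]" "[]"] by simp
next
  case (Cons y ys y' ys')
  have 1: "RB (lie_der br act x (\<lambda>zs. f (y # zs)) ys) (lie_der br' act' x' (\<lambda>zs. f' (y' # zs)) ys')"
  proof (rule Cons.IH)
    show "RB (act x (f (y # zs))) (act' x' (f' (y' # zs')))"
      if "list_all2 RA zs zs'" "length zs = length ys" for zs zs'
      using Cons.prems(1)[of "y # zs" "y' # zs'"] Cons.hyps that by simp
    show "RB (f (y # zs[i := br x (zs ! i)])) (f' (y' # zs'[i := br' x' (zs' ! i)]))"
      if "list_all2 RA zs zs'" "length zs = length ys" "i < length zs" for zs zs' i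
      using Cons.prems(2)[of "y # zs" "y' # zs'" "Suc i"] Cons.hyps that by simp
  qed
  have 2: "RB (f (br x y # ys)) (f' (br' x' y' # ys'))"
    using Cons.prems(2)[of "y # ys" "y' # ys'" 0] Cons.hyps by simp
  show ?case using assms(4)[OF 1 2] by simp
qed

text \<open>Here the brackets must respect \<open>RA\<close>, because every entry of the list takes
  its turn as the x of a Lie derivative. \<open>lie_der_rel\<close> asks for no relation between its
  own x and x', only for the composite terms; this leaves room for the pair t(x), x, which the graph
  of restriction does not relate.\<close>

lemma ce_rel:
  assumes "list_all2 RA xs xs'"
    and "\<And>ys ys'. list_all2 RA ys ys' \<Longrightarrow> Suc (length ys) = length xs \<Longrightarrow> RB (f ys) (f' ys')"
    and "\<And>x y x' y'. RA x x' \<Longrightarrow> RA y y' \<Longrightarrow> RA (br x y) (br' x' y')"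
    and "\<And>x m x' m'. RA x x' \<Longrightarrow> RB m m' \<Longrightarrow> RB (act x m) (act' x' m')"
    and "RB 0 0" and "\<And>u v u' v'. RB u u' \<Longrightarrow> RB v v' \<Longrightarrow> RB (u - v) (u' - v')"
  shows "RB (ce br act f xs) (ce br' act' f' xs')"
  using assms(1,2)
proof (induction xs xs' arbitrary: f f' rule: list_all2_induct)
  case (Cons x xs x' xs')
  have 1: "RB (lie_der br act x f xs) (lie_der br' act' x' f' xs')"
  proof (rule lie_der_rel[OF Cons.hyps(2)])
    show "RB (act x (f ys)) (act' x' (f' ys'))" if "list_all2 RA ys ys'" "length ys = length xs" for ys ys'
      using that by (simp add: assms(4) Cons.prems Cons.hyps)
    show "RB (f (ys[i := br x (ys ! i)])) (f' (ys'[i := br' x' (ys' ! i)]))"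
      if "list_all2 RA ys ys'" "length ys = length xs" "i < length ys" for ys ys' i
    proof (rule Cons.prems)
      show "list_all2 RA (ys[i := br x (ys ! i)]) (ys'[i := br' x' (ys' ! i)])"
        using that by (simp add: list_all2_update_cong list_all2_nthD assms(3) Cons.hyps)
    qed (use that in simp)
  qed (rule assms(6))
  have 2: "RB (ce br act (\<lambda>zs. f (x # zs)) xs) (ce br' act' (\<lambda>zs. f' (x' # zs)) xs')"
    by (rule Cons.IH) (auto intro!: Cons.prems Cons.hyps)
  show ?case using assms(6)[OF 1 2] by simp
qed (simp add: assms(5))

text \<open>The values of the two factors and of the product may satisfy three different relations.
  Frobenius reciprocity needs this: one factor is related by transfer, the other by restriction, and
  the product again by transfer.\<close>

lemma wedge_rel:
  assumes "list_all2 RA xs xs'"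
    and "\<And>ys ys'. list_all2 RA ys ys' \<Longrightarrow> length ys = m \<Longrightarrow> R1 (f ys) (f' ys')"
    and "\<And>ys ys'. list_all2 RA ys ys' \<Longrightarrow> m + length ys = length xs \<Longrightarrow> R2 (g ys) (g' ys')"
    and "\<And>u v u' v'. R1 u u' \<Longrightarrow> R2 v v' \<Longrightarrow> RB (brB u v) (brB' u' v')"
    and "RB 0 0" and diff: "\<And>u v u' v'. RB u u' \<Longrightarrow> RB v v' \<Longrightarrow> RB (u - v) (u' - v')"
  shows "RB (wedge brB m f g xs) (wedge brB' m f' g' xs')"
  using assms(1-3)
proof (induction xs xs' arbitrary: f f' g g' m rule: list_all2_induct)
  case Nil
  show ?case using Nil(1)[of "[]" "[]"] Nil(2)[of "[]" "[]"] assms(4,5) by simp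
next
  case (Cons x xs x' xs')
  have neg: "RB (- u) (- u')" if "RB u u'" for u u'
    using diff[OF assms(5) that] by simp
  have add: "RB (u + v) (u' + v')" if "RB u u'" "RB v v'" for u u' v v'
    using diff[OF that(1) neg[OF that(2)]] by simp
  have sg: "RB (alt_sign k u) (alt_sign k u')" if "RB u u'" for u u' k
    using that neg by (simp add: alt_sign_def)
  have 1: "RB (wedge brB (m - 1) (\<lambda>zs. f (x # zs)) g xs) (wedge brB' (m - 1) (\<lambda>zs. f' (x' # zs)) g' xs')"
    if "m \<noteq> 0"
    by (rule Cons.IH) (use that in \<open>auto intro!: Cons.prems Cons.hyps\<close>)
  have 2: "RB (wedge brB m f (\<lambda>zs. g (x # zs)) xs) (wedge brB' m f' (\<lambda>zs. g' (x' # zs)) xs')"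
    by (rule Cons.IH) (auto intro!: Cons.prems Cons.hyps)
  show ?case using 1 add[OF _ sg[OF 2, of m]] assms(5) sg[OF 2, of m] by auto
qed

lemma lie_der_additive:
  assumes "\<And>x u v. act x (u + v) = act x u + act x v"
  shows "lie_der br act x (\<lambda>zs. f zs + g zs) xs = lie_der br act x f xs + lie_der br act x g xs"
    "lie_der br act x (\<lambda>zs. f zs - g zs) xs = lie_der br act x f xs - lie_der br act x g xs"
proof -
  have d: "act x (u - v) = act x u - act x v" for u v
    using assms[of x "u - v" v] by simp
  show "lie_der br act x (\<lambda>zs. f zs + g zs) xs = lie_der br act x f xs + lie_der br act x g xs"
    by (induction xs arbitrary: f g) (auto simp: assms)
  show "lie_der br act x (\<lambda>zs. f zs - g zs) xs = lie_der br act x f xs - lie_der br act x g xs"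
    by (induction xs arbitrary: f g) (auto simp: d)
qed

section \<open>Cartan calculus: Lie derivative and Chevalley-Eilenberg differential\<close>

text \<open>The scalars form a bare type acting by operators, because a ring on a carrier has no
  total operations that could be lifted. Homogeneity of forms only requires that these operators are
  additive on values and commute with bracket and action.\<close>

locale alt_calculus =
  fixes br :: "'a::ab_group_add \<Rightarrow> 'a \<Rightarrow> 'a" and act :: "'a \<Rightarrow> 'b::ab_group_add \<Rightarrow> 'b"
    and scA :: "'s \<Rightarrow> 'a \<Rightarrow> 'a" and scB :: "'s \<Rightarrow> 'b \<Rightarrow> 'b"
  assumes br_add: "br (x + y) z = br x z + br y z" "br z (x + y) = br z x + br z y"
    and br_self: "br x x = 0"
    and br_jacobi: "br x (br y z) + br y (br z x) + br z (br x y) = 0"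
    and act_add: "act (x + y) m = act x m + act y m" "act x (m + n) = act x m + act x n"
    and act_br: "act (br x y) m = act x (act y m) - act y (act x m)"
    and scB_add: "scB s (m + n) = scB s m + scB s n"
    and br_sc: "br (scA s x) y = scA s (br x y)" "br x (scA s y) = scA s (br x y)"
    and act_sc: "act (scA s x) m = scB s (act x m)" "act x (scB s m) = scB s (act x m)"
begin

abbreviation LD where "LD \<equiv> lie_der br act"
abbreviation D where "D \<equiv> ce br act"

lemma act_0 [simp]: "act x 0 = 0" "act 0 m = 0"
  using act_add(2)[of x 0 0] act_add(1)[of 0 0 m] by auto

lemma act_diff: "act (x - y) m = act x m - act y m" "act x (m - n) = act x m - act x n"
  using act_add(1)[of "x - y" y m] act_add(2)[of x "m - n" n] by (simp_all add: eq_diff_eq)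

lemma scB_0 [simp]: "scB s 0 = 0"
  using scB_add[of s 0 0] by auto

lemma scB_diff: "scB s (m - n) = scB s m - scB s n"
  using scB_add[of s "m - n" n] by auto

lemma scB_neg: "scB s (- m) = - scB s m"
  using scB_diff[of s 0 m] by simp

lemma br_swap: "br x y = - br y x"
proof -
  have "br x y + br y x = br (x + y) (x + y)"
    unfolding br_add by (simp add: br_self)
  then show ?thesis by (simp add: br_self eq_neg_iff_add_eq_0)
qed

lemma br_leibniz: "br x (br y z) - br y (br x z) = br (br x y) z"
proof -
  have "br y (br z x) = - br y (br x z)"
    using br_swap[of z x] br_add(2)[of y "br z x" "br x z"] br_add(2)[of y 0 0] by (simp add: eq_neg_iff_add_eq_0)
  moreover have "br z (br x y) = - br (br x y) z" by (rule br_swap)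
  ultimately show ?thesis using br_jacobi[of x y z] by (simp add: algebra_simps)
qed

text \<open>Multilinear alternating maps of degree n, in a form closed under contraction: linearity
  and vanishing are asked only of the first one or two arguments, and recursively of all
  contractions. Since adjacent repetitions generate the alternating condition, this is the usual
  notion; \<open>alt_formI\<close>, \<open>alt_form_multilinear\<close> and
  \<open>alt_form_alternating\<close> translate. Values on lists of other lengths are
  unconstrained.\<close>

primrec alt_form :: "nat \<Rightarrow> ('a list \<Rightarrow> 'b) \<Rightarrow> bool" where
  "alt_form 0 f \<longleftrightarrow> True"
| "alt_form (Suc n) f \<longleftrightarrow>
     (\<forall>x. alt_form n (\<lambda>zs. f (x # zs))) \<and>
     (\<forall>x y zs. length zs = n \<longrightarrow> f ((x + y) # zs) = f (x # zs) + f (y # zs)) \<and>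
     (\<forall>s x zs. length zs = n \<longrightarrow> f (scA s x # zs) = scB s (f (x # zs))) \<and>
     (\<forall>x zs. Suc (length zs) = n \<longrightarrow> f (x # x # zs) = 0)"

lemma alt_formD:
  assumes "alt_form (Suc n) f"
  shows "alt_form n (\<lambda>zs. f (x # zs))"
    and "length zs = n \<Longrightarrow> f ((x + y) # zs) = f (x # zs) + f (y # zs)"
    and "length zs = n \<Longrightarrow> f (scA s x # zs) = scB s (f (x # zs))"
    and "Suc (length zs) = n \<Longrightarrow> f (x # x # zs) = 0"
  using assms by auto

lemma alt_form_cons_diff:
  assumes "alt_form (Suc n) f" "length zs = n"
  shows "f ((x - y) # zs) = f (x # zs) - f (y # zs)"
  using alt_formD(2)[OF assms, of "x - y" y] by simp

lemma alt_form_swap: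
  assumes "alt_form (Suc (Suc n)) f" "length zs = n"
  shows "f (x # y # zs) = - f (y # x # zs)"
proof -
  have 0: "f (u # u # zs) = 0" for u using assms by auto
  have 1: "f ((u + v) # w # zs) = f (u # w # zs) + f (v # w # zs)" for u v w using assms by auto
  have 2: "f (w # (u + v) # zs) = f (w # u # zs) + f (w # v # zs)" for u v w
    using alt_formD(2)[OF alt_formD(1)[OF assms(1)] assms(2)] .
  have "f (x # y # zs) + f (y # x # zs) = f ((x + y) # (x + y) # zs)"
    unfolding 1 2 by (simp add: 0)
  then show ?thesis by (simp add: 0 eq_neg_iff_add_eq_0)
qed

lemma alt_form_cong:
  assumes "alt_form n f" "\<And>zs. length zs = n \<Longrightarrow> f zs = f' zs"
  shows "alt_form n f'"
  using assms
proof (induction n arbitrary: f f')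
  case (Suc n)
  show ?case
    unfolding alt_form.simps
  proof (intro conjI allI impI)
    show "alt_form n (\<lambda>zs. f' (x # zs))" for x
      by (rule Suc.IH[OF alt_formD(1)[OF Suc.prems(1)]]) (simp add: Suc.prems(2))
    show "f' ((x + y) # zs) = f' (x # zs) + f' (y # zs)" if "length zs = n" for x y zs
      using alt_formD(2)[OF Suc.prems(1) that] that by (simp add: Suc.prems(2))
    show "f' (scA s x # zs) = scB s (f' (x # zs))" if "length zs = n" for s x zs
      using alt_formD(3)[OF Suc.prems(1) that] that by (simp add: Suc.prems(2))
    show "f' (x # x # zs) = 0" if "Suc (length zs) = n" for x zs
      using alt_formD(4)[OF Suc.prems(1) that] that by (simp add: Suc.prems(2))
  qed
qed simp

lemma alt_form_diff:
  assumes "alt_form n f" "alt_form n g"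
  shows "alt_form n (\<lambda>zs. f zs - g zs)"
  using assms
  by (induction n arbitrary: f g) (auto simp: scB_diff)

lemma alt_form_zero: "alt_form n (\<lambda>zs. 0)"
  by (induction n) auto

lemma alt_form_neg: "alt_form n f \<Longrightarrow> alt_form n (\<lambda>zs. - f zs)"
  using alt_form_diff[OF alt_form_zero, of n f] by simp

lemma alt_form_add: "alt_form n f \<Longrightarrow> alt_form n g \<Longrightarrow> alt_form n (\<lambda>zs. f zs + g zs)"
  using alt_form_diff[OF _ alt_form_neg, of n f g] by simp

lemma alt_form_alt_sign: "alt_form n f \<Longrightarrow> alt_form n (\<lambda>zs. alt_sign k (f zs))"
  using alt_form_neg[of n f] by (cases "even k") (auto simp: alt_sign_def)

lemma LD_add: "LD x (\<lambda>zs. f zs + g zs) xs = LD x f xs + LD x g xs"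
  and LD_diff: "LD x (\<lambda>zs. f zs - g zs) xs = LD x f xs - LD x g xs"
  by (rule lie_der_additive[of act, OF act_add(2)])+

lemma LD_zero: "LD x (\<lambda>zs. 0) xs = 0"
  using LD_diff[of x "\<lambda>zs. 0" "\<lambda>zs. 0" xs] by simp

lemma LD_scB: "LD x (\<lambda>zs. scB s (f zs)) xs = scB s (LD x f xs)"
  by (induction xs arbitrary: f) (auto simp: act_sc scB_diff)

lemma LD_neg: "LD x (\<lambda>zs. - f zs) xs = - LD x f xs"
  using LD_diff[of x "\<lambda>zs. 0" f xs] by (simp add: LD_zero)

text \<open>The entry x reaches f only inside brackets in its arguments, so additivity in x rests on
  multilinearity of f and hence on the degree condition.\<close>

lemma LD_arg_add:
  assumes "alt_form (length xs) f"
  shows "LD (x + y) f xs = LD x f xs + LD y f xs"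
  using assms by (induction xs arbitrary: f) (auto simp: act_add br_add)

lemma LD_arg_sc:
  assumes "alt_form (length xs) f"
  shows "LD (scA s x) f xs = scB s (LD x f xs)"
  using assms by (induction xs arbitrary: f) (auto simp: act_sc br_sc scB_diff)

lemma alt_form_LD:
  assumes "alt_form n f"
  shows "alt_form n (LD x f)"
  using assms
proof (induction n arbitrary: f)
  case (Suc n)
  note a = alt_formD[OF Suc.prems]
  show ?case
    unfolding alt_form.simps
  proof (intro conjI allI impI)
    show "alt_form n (\<lambda>zs. LD x f (y # zs))" for y
      by (simp add: alt_form_diff Suc.IH a(1))
    show "LD x f ((y + y') # zs) = LD x f (y # zs) + LD x f (y' # zs)" if "length zs = n" for y y' zs
    proof -
      have "LD x (\<lambda>zs. f ((y + y') # zs)) zs = LD x (\<lambda>zs. f (y # zs) + f (y' # zs)) zs"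
        by (rule lie_der_cong) (simp add: a(2) that)
      then show ?thesis by (simp add: LD_add a(2) that br_add)
    qed
    show "LD x f (scA s y # zs) = scB s (LD x f (y # zs))" if "length zs = n" for s y zs
    proof -
      have "LD x (\<lambda>zs. f (scA s y # zs)) zs = LD x (\<lambda>zs. scB s (f (y # zs))) zs"
        by (rule lie_der_cong) (simp add: a(3) that)
      then show ?thesis by (simp add: LD_scB a(3) that br_sc scB_diff)
    qed
    show "LD x f (y # y # zs) = 0" if "Suc (length zs) = n" for y zs
    proof -
      have "LD x (\<lambda>zs. f (y # y # zs)) zs = LD x (\<lambda>zs. 0) zs"
        by (rule lie_der_cong) (simp add: a(4) that)
      \<comment> \<open>Unfolding two contractions leaves f(y,[x,y],...) and f([x,y],y,...) with the
        same sign; they cancel by antisymmetry.\<close>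
      then show ?thesis
        using alt_form_swap[of "length zs" f zs y "br x y"] Suc.prems that by (auto simp: LD_zero)
    qed
  qed
qed simp

text \<open>The Cartan relation for two Lie derivatives. On the empty list it is the module axiom,
  and each further entry z costs one use of the Jacobi identity for x, y, z.\<close>

lemma LD_commutator:
  assumes "alt_form (length xs) f"
  shows "LD x (LD y f) xs - LD y (LD x f) xs = LD (br x y) f xs"
  using assms
proof (induction xs arbitrary: f)
  case Nil
  then show ?case by (simp add: act_br)
next
  case (Cons z zs)
  have IH: "LD x (LD y (\<lambda>ws. f (z # ws))) zs - LD y (LD x (\<lambda>ws. f (z # ws))) zs = LD (br x y) (\<lambda>ws. f (z # ws)) zs"
    using Cons.prems by (intro Cons.IH) simp
  \<comment> \<open>The two mixed terms together are symmetric in u and v, so they drop out of the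
    commutator.\<close>
  have e: "LD u (LD v f) (z # zs) = LD u (LD v (\<lambda>ws. f (z # ws))) zs - LD u (\<lambda>ws. f (br v z # ws)) zs
       - (LD v (\<lambda>ws. f (br u z # ws)) zs - f (br v (br u z) # zs))" for u v
    by (simp add: LD_diff)
  have "f (br (br x y) z # zs) = f (br x (br y z) # zs) - f (br y (br x z) # zs)"
    using Cons.prems alt_form_cons_diff[of "length zs" f zs] by (simp flip: br_leibniz)
  then show ?case unfolding e by (simp add: IH[symmetric])
qed

lemma D_diff: "D (\<lambda>zs. f zs - g zs) xs = D f xs - D g xs"
  by (induction xs arbitrary: f g) (auto simp: LD_diff)

lemma D_zero: "D (\<lambda>zs. 0) xs = 0"
  using D_diff[of "\<lambda>zs. 0" "\<lambda>zs. 0" xs] by simp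

lemma D_neg: "D (\<lambda>zs. - f zs) xs = - D f xs"
  using D_diff[of "\<lambda>zs. 0" f xs] by (simp add: D_zero)

lemma D_add: "D (\<lambda>zs. f zs + g zs) xs = D f xs + D g xs"
  using D_diff[of f "\<lambda>zs. - g zs" xs] by (simp add: D_neg)

lemma D_alt_sign: "D (\<lambda>zs. alt_sign k (f zs)) xs = alt_sign k (D f xs)"
  by (simp add: alt_sign_def D_neg)

lemma D_scB: "D (\<lambda>zs. scB s (f zs)) xs = scB s (D f xs)"
  by (induction xs arbitrary: f) (auto simp: LD_scB scB_diff)

text \<open>Contract both sides with y. The terms d(f([x,y],...)) agree, the terms L_x d f(y,...)
  and d L_x f(y,...) agree by induction, and what remains is the commutator relation for L_x and
  L_y.\<close>

lemma LD_D:
  assumes "alt_form n f" "length xs = Suc n"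
  shows "LD x (D f) xs = D (LD x f) xs"
  using assms
proof (induction xs arbitrary: f n)
  case (Cons y ys)
  have "LD x (D f) (y # ys) = LD x (LD y f) ys - LD x (D (\<lambda>zs. f (y # zs))) ys
      - LD (br x y) f ys + D (\<lambda>zs. f (br x y # zs)) ys"
    by (simp add: LD_diff)
  moreover have "D (LD x f) (y # ys) = LD y (LD x f) ys - D (LD x (\<lambda>ws. f (y # ws))) ys
      + D (\<lambda>ws. f (br x y # ws)) ys"
    by (simp add: D_diff)
  moreover have "LD x (D (\<lambda>zs. f (y # zs))) ys = D (LD x (\<lambda>ws. f (y # ws))) ys"
  proof (cases n)
    case 0
    then show ?thesis using Cons.prems by simp
  next
    case (Suc k)
    then show ?thesis using Cons by (intro Cons.IH[of k]) auto
  qed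
  moreover have "LD x (LD y f) ys - LD y (LD x f) ys = LD (br x y) f ys"
    using Cons.prems by (intro LD_commutator) simp
  ultimately show ?case by (simp add: algebra_simps)
qed simp

text \<open>With i_x for contraction, i_x d d f = L_x d f - d L_x f + d d i_x f. The first two terms
  cancel by \<open>LD_D\<close>, the last vanishes by induction.\<close>

lemma D_D:
  assumes "alt_form n f" "length xs = Suc (Suc n)"
  shows "D (D f) xs = 0"
  using assms
proof (induction n arbitrary: f xs)
  case 0
  then obtain x y where "xs = [x, y]" by (auto simp: length_Suc_conv)
  then show ?case by (simp add: act_br act_diff)
next
  case (Suc n)
  then obtain x ys where xs: "xs = x # ys" "length ys = Suc (Suc n)" by (auto simp: length_Suc_conv)
  have "D (\<lambda>zs. D f (x # zs)) ys = D (LD x f) ys - D (D (\<lambda>zs. f (x # zs))) ys"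
    by (simp add: D_diff)
  also have "\<dots> = D (LD x f) ys"
    using Suc xs by simp
  also have "\<dots> = LD x (D f) ys"
    using LD_D[OF Suc.prems(1) xs(2)] by simp
  finally show ?case by (simp add: xs(1))
qed

lemma alt_form_D:
  assumes "alt_form n f"
  shows "alt_form (Suc n) (D f)"
  using assms
proof (induction n arbitrary: f)
  case 0
  show ?case by (auto simp: act_add act_sc)
next
  case (Suc n)
  note a = alt_formD[OF Suc.prems]
  show ?case
    unfolding alt_form.simps(2)[of "Suc n"]
  proof (intro conjI allI impI)
    show "alt_form (Suc n) (\<lambda>zs. D f (x # zs))" for x
      using alt_form_diff[OF alt_form_LD[OF Suc.prems, of x] Suc.IH[OF a(1)[of x]]] by simp
    show "D f ((x + y) # zs) = D f (x # zs) + D f (y # zs)" if "length zs = Suc n" for x y zs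
    proof -
      have "D (\<lambda>ws. f ((x + y) # ws)) zs = D (\<lambda>ws. f (x # ws) + f (y # ws)) zs"
        by (rule ce_cong) (simp add: a(2) that)
      then show ?thesis using that LD_arg_add[of zs f x y] Suc.prems by (simp add: D_add)
    qed
    show "D f (scA s x # zs) = scB s (D f (x # zs))" if "length zs = Suc n" for s x zs
    proof -
      have "D (\<lambda>ws. f (scA s x # ws)) zs = D (\<lambda>ws. scB s (f (x # ws))) zs"
        by (rule ce_cong) (simp add: a(3) that)
      then show ?thesis using that LD_arg_sc[of zs f s x] Suc.prems by (simp add: D_scB scB_diff)
    qed
    show "D f (x # x # zs) = 0" if "Suc (length zs) = Suc n" for x zs
    proof -
      have "D (\<lambda>ws. f (x # x # ws)) zs = D (\<lambda>ws. 0) zs"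
        by (rule ce_cong) (use that in \<open>simp add: a(4)\<close>)
      moreover have "f (0 # zs) = 0"
        using alt_form_cons_diff[OF Suc.prems, of zs 0 0] that by simp
      \<comment> \<open>The two Lie derivatives of f(x,...) cancel; left over are f([x,x],...) =
        f(0,...) and the differential of the zero form.\<close>
      ultimately show ?thesis by (simp add: br_self D_zero)
    qed
  qed
qed

end

section \<open>The cup product of alternating forms\<close>

locale lie_alt_calculus = alt_calculus br act scA scB
  for br :: "'a::ab_group_add \<Rightarrow> 'a \<Rightarrow> 'a" and act :: "'a \<Rightarrow> 'b::ab_group_add \<Rightarrow> 'b"
    and scA :: "'s \<Rightarrow> 'a \<Rightarrow> 'a" and scB :: "'s \<Rightarrow> 'b \<Rightarrow> 'b" +
  fixes brB :: "'b \<Rightarrow> 'b \<Rightarrow> 'b"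
  assumes brB_add: "brB (m + n) k = brB m k + brB n k" "brB k (m + n) = brB k m + brB k n"
    and brB_self: "brB m m = 0"
    and brB_jacobi: "brB m (brB n k) + brB n (brB k m) + brB k (brB m n) = 0"
    and brB_sc: "brB (scB s m) n = scB s (brB m n)" "brB m (scB s n) = scB s (brB m n)"
    and act_brB: "act x (brB m n) = brB (act x m) n + brB m (act x n)"
begin

abbreviation W where "W \<equiv> wedge brB"

lemma brB_0 [simp]: "brB m 0 = 0" "brB 0 m = 0"
  using brB_add(2)[of m 0 0] brB_add(1)[of 0 0 m] by auto

lemma brB_diff: "brB (m - n) k = brB m k - brB n k" "brB k (m - n) = brB k m - brB k n"
  using brB_add(1)[of "m - n" n k] brB_add(2)[of k "m - n" n] by auto

lemma brB_swap: "brB m n = - brB n m"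
proof -
  have "brB m n + brB n m = brB (m + n) (m + n)"
    unfolding brB_add by (simp add: brB_self)
  then show ?thesis by (simp add: brB_self eq_neg_iff_add_eq_0)
qed

lemma brB_leibniz: "brB m (brB n k) = brB (brB m n) k + brB n (brB m k)"
proof -
  have "brB n (brB k m) = - brB n (brB m k)" using brB_swap[of k m] brB_diff(2)[of n 0 "brB m k"] by simp
  moreover have "brB k (brB m n) = - brB (brB m n) k" by (rule brB_swap)
  ultimately show ?thesis using brB_jacobi[of m n k] by (simp add: algebra_simps)
qed

lemma wedge_diff: "W m (\<lambda>zs. f zs - f' zs) g xs = W m f g xs - W m f' g xs"
  "W m f (\<lambda>zs. g zs - g' zs) xs = W m f g xs - W m f g' xs"
proof -
  show "W m (\<lambda>zs. f zs - f' zs) g xs = W m f g xs - W m f' g xs"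
    by (induction xs arbitrary: m f f' g) (auto simp: brB_diff alt_sign_diff)
  show "W m f (\<lambda>zs. g zs - g' zs) xs = W m f g xs - W m f g' xs"
    by (induction xs arbitrary: m f g g') (auto simp: brB_diff alt_sign_diff)
qed

lemma wedge_zero: "W m (\<lambda>zs. 0) g xs = 0" "W m f (\<lambda>zs. 0) xs = 0"
  using wedge_diff(1)[of m "\<lambda>zs. 0" "\<lambda>zs. 0" g xs] wedge_diff(2)[of m f "\<lambda>zs. 0" "\<lambda>zs. 0" xs] by auto

lemma wedge_neg: "W m (\<lambda>zs. - f zs) g xs = - W m f g xs" "W m f (\<lambda>zs. - g zs) xs = - W m f g xs"
  using wedge_diff(1)[of m "\<lambda>zs. 0" f g xs] wedge_diff(2)[of m f "\<lambda>zs. 0" g xs] by (auto simp: wedge_zero)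

lemma wedge_add: "W m (\<lambda>zs. f zs + f' zs) g xs = W m f g xs + W m f' g xs"
  "W m f (\<lambda>zs. g zs + g' zs) xs = W m f g xs + W m f g' xs"
  using wedge_diff(1)[of m f "\<lambda>zs. - f' zs" g xs] wedge_diff(2)[of m f g "\<lambda>zs. - g' zs" xs]
  by (auto simp: wedge_neg)

lemma wedge_scB: "W m (\<lambda>zs. scB s (f zs)) g xs = scB s (W m f g xs)"
  "W m f (\<lambda>zs. scB s (g zs)) xs = scB s (W m f g xs)"
proof -
  have sg: "alt_sign k (scB s u) = scB s (alt_sign k u)" for k u by (simp add: alt_sign_def scB_neg)
  show "W m (\<lambda>zs. scB s (f zs)) g xs = scB s (W m f g xs)"
    by (induction xs arbitrary: m f g) (auto simp: brB_sc sg scB_add)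
  show "W m f (\<lambda>zs. scB s (g zs)) xs = scB s (W m f g xs)"
    by (induction xs arbitrary: m f g) (auto simp: brB_sc sg scB_add)
qed

lemma LD_alt_sign: "LD x (\<lambda>zs. alt_sign k (f zs)) xs = alt_sign k (LD x f xs)"
  by (simp add: alt_sign_def LD_neg)

text \<open>This is where the action by derivations enters: on the empty list the claim is
  \<open>act_brB\<close>, and contraction carries it to all degrees. The Leibniz rule for d rests on
  it.\<close>

lemma LD_wedge: "LD x (W m f g) xs = W m (LD x f) g xs + W m f (LD x g) xs"
proof (induction xs arbitrary: m f g)
  case Nil
  show ?case by (simp add: act_brB)
next
  case (Cons y ys)
  show ?case
    by (cases m) (simp_all add: LD_add LD_diff LD_neg LD_zero LD_alt_sign Cons.IH wedge_diff alt_sign_diff alt_sign_add algebra_simps)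
qed

text \<open>Contract with x. As i_x d = L_x - d i_x, L_x is a derivation and i_x an antiderivation
  of the product, both sides expand to the same terms once the rule is known for the contracted
  factors.\<close>

lemma D_wedge: "D (W m f g) xs = W (Suc m) (D f) g xs + alt_sign m (W m f (D g) xs)"
proof (induction xs arbitrary: m f g)
  case Nil
  show ?case by simp
next
  case (Cons x xs)
  show ?case
  proof (cases m)
    case 0
    \<comment> \<open>For f of degree 0 the recursion on the right still contracts d f and produces
      the differential of a contraction of f, which has no counterpart on the left; it contributes 0
      because \<open>ce\<close> is 0 on the empty list.\<close>
    have "W 0 (D (\<lambda>zs. f (x # zs))) g xs = 0" by (simp add: wedge_0)
    with 0 show ?thesis
      by (simp add: LD_wedge Cons.IH wedge_diff algebra_simps)
  next
    case (Suc k)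
    then show ?thesis
      by (simp add: LD_wedge D_add D_diff D_neg D_alt_sign Cons.IH wedge_diff alt_sign_diff alt_sign_add algebra_simps)
  qed
qed

text \<open>The degree of the second factor is read off from the length of the list, so the length
  is pinned to m + n in order that both products speak of the same degrees. Contraction lowers the
  total degree, and the empty list is antisymmetry of the bracket.\<close>

lemma wedge_antisym:
  assumes "length xs = m + n"
  shows "W m f g xs = - alt_sign (m * n) (W n g f xs)"
  using assms
proof (induction xs arbitrary: m n f g)
  case Nil
  then show ?case using brB_swap[of "f []" "g []"] by simp
next
  case (Cons x xs)
  have 1: "W (m - 1) (\<lambda>zs. f (x # zs)) g xs = - alt_sign ((m - 1) * n) (W n g (\<lambda>zs. f (x # zs)) xs)"
    if "m \<noteq> 0" using Cons that by auto
  have 2: "W m f (\<lambda>zs. g (x # zs)) xs = - alt_sign (m * (n - 1)) (W (n - 1) (\<lambda>zs. g (x # zs)) f xs)"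
    if "n \<noteq> 0" using Cons that by auto
  \<comment> \<open>A factor of degree 0 cannot absorb x: the recursion still writes down its
    contraction, but then too few entries remain for the other factor and the value is 0.\<close>
  have 3: "W m f (\<lambda>zs. g (x # zs)) xs = 0" if "n = 0"
    using that Cons.prems by (intro wedge_short) simp
  have 4: "W n g (\<lambda>zs. f (x # zs)) xs = 0" if "m = 0"
    using that Cons.prems by (intro wedge_short) simp
  show ?case
  proof (cases "m = 0")
    case True
    with 2 3 4 show ?thesis by (cases "n = 0") auto
  next
    case m: False
    show ?thesis
    proof (cases "n = 0")
      case True
      with 1 3 m show ?thesis by simp
    next
      case False
      have "alt_sign ((m - 1) * n) v = alt_sign (m * n) (alt_sign n v)"
        "alt_sign m (alt_sign (m * (n - 1)) v) = alt_sign (m * n) v" for v :: 'b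
        using m False by (auto simp: alt_sign_def)
      then show ?thesis
        using m False 1 2 by (simp add: alt_sign_add)
    qed
  qed
qed

text \<open>On contraction x falls into f, g or h; each time the identity for the contracted triple
  applies, and the signs depend only on the parities of m and n. The empty list is the derivation
  form of the Jacobi identity of the coefficients.\<close>

lemma wedge_jacobi:
  "W m f (W n g h) xs = W (m + n) (W m f g) h xs + alt_sign (m * n) (W n g (W m f h) xs)"
proof (induction xs arbitrary: m n f g h)
  case Nil
  show ?case using brB_leibniz[of "f []" "g []" "h []"] by auto
next
  case (Cons x xs)
  \<comment> \<open>For n = 0 the contraction of g is spurious. It occurs inside a product whose
    factor f wants m arguments but which is evaluated on m - 1 entries, where \<open>wedge\<close>
    is 0.\<close>
  have z: "W (m - Suc 0) (W m f (\<lambda>zs. g (x # zs))) h xs = 0" if "m \<noteq> 0"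
  proof -
    have "W (m - Suc 0) (W m f (\<lambda>zs. g (x # zs))) h xs = W (m - Suc 0) (\<lambda>zs. 0) h xs"
      by (rule wedge_cong) (use that in \<open>auto simp: wedge_short\<close>)
    then show ?thesis by (simp add: wedge_zero)
  qed
  note i1 = Cons.IH[of "m - 1" "\<lambda>zs. f (x # zs)" n g h]
  note i2 = Cons.IH[of m f "n - 1" "\<lambda>zs. g (x # zs)" h]
  note i3 = Cons.IH[of m f n g "\<lambda>zs. h (x # zs)"]
  show ?case
    by (cases m; cases n; cases "even m"; cases "even n")
      (use z i1 i2 i3 in \<open>simp_all add: wedge_diff wedge_add wedge_neg wedge_zero alt_sign_def\<close>)
qed

lemma alt_form_wedge:
  assumes "alt_form m f" "alt_form n g"
  shows "alt_form (m + n) (W m f g)"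
  using assms
proof (induction "m + n" arbitrary: m n f g)
  case 0
  then show ?case by simp
next
  case (Suc k)
  \<comment> \<open>The recursion with the contraction into g suppressed for n = 0, where it
    vanishes on lists of length k. The induction hypothesis can only be used for contractions that
    have a degree.\<close>
  have Wcons: "W m f g (x # zs) = (if m = 0 then 0 else W (m - 1) (\<lambda>zs. f (x # zs)) g zs) +
     (if n = 0 then 0 else alt_sign m (W m f (\<lambda>zs. g (x # zs)) zs))"
    if "length zs = k" for x :: 'a and zs
    using that Suc.hyps by (auto simp: wedge_short)
  have f: "alt_form (Suc (m - 1)) f" if "m \<noteq> 0" using that Suc.prems by simp
  have g: "alt_form (Suc (n - 1)) g" if "n \<noteq> 0" using that Suc.prems by simp
  have fadd: "W (m - 1) (\<lambda>zs. f ((x + y) # zs)) g zs =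
      W (m - 1) (\<lambda>zs. f (x # zs)) g zs + W (m - 1) (\<lambda>zs. f (y # zs)) g zs" if "m \<noteq> 0" for x y :: 'a and zs
    unfolding wedge_add(1)[symmetric] by (rule wedge_cong) (simp_all add: alt_formD(2)[OF f[OF that]])
  have fsc: "W (m - 1) (\<lambda>zs. f (scA s x # zs)) g zs = scB s (W (m - 1) (\<lambda>zs. f (x # zs)) g zs)"
    if "m \<noteq> 0" for s and x :: 'a and zs
    unfolding wedge_scB(1)[symmetric] by (rule wedge_cong) (simp_all add: alt_formD(3)[OF f[OF that]])
  have gadd: "W m f (\<lambda>zs. g ((x + y) # zs)) zs =
      W m f (\<lambda>zs. g (x # zs)) zs + W m f (\<lambda>zs. g (y # zs)) zs" if "n \<noteq> 0" "length zs = k" for x y zs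
    unfolding wedge_add(2)[symmetric]
    by (rule wedge_cong) (use that Suc.hyps in \<open>simp_all add: alt_formD(2)[OF g[OF that(1)]]\<close>)
  have gsc: "W m f (\<lambda>zs. g (scA s x # zs)) zs = scB s (W m f (\<lambda>zs. g (x # zs)) zs)"
    if "n \<noteq> 0" "length zs = k" for s x zs
    unfolding wedge_scB(2)[symmetric]
    by (rule wedge_cong) (use that Suc.hyps in \<open>simp_all add: alt_formD(3)[OF g[OF that(1)]]\<close>)
  have sg: "alt_sign j (scB s u) = scB s (alt_sign j u)" for j s u
    by (simp add: alt_sign_def scB_neg)
  show ?case
    unfolding Suc.hyps(2)[symmetric] alt_form.simps
  proof (intro conjI allI impI)
    fix x
    have 1: "alt_form k (W (m - 1) (\<lambda>zs. f (x # zs)) g)" if "m \<noteq> 0"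
    proof -
      have "k = m - 1 + n" using that Suc.hyps by simp
      then show ?thesis using Suc.hyps(1)[OF _ alt_formD(1)[OF f[OF that]] Suc.prems(2)] by simp
    qed
    have 2: "alt_form k (W m f (\<lambda>zs. g (x # zs)))" if "n \<noteq> 0"
    proof -
      have "k = m + (n - 1)" using that Suc.hyps by simp
      then show ?thesis using Suc.hyps(1)[OF _ Suc.prems(1) alt_formD(1)[OF g[OF that]]] by simp
    qed
    show "alt_form k (\<lambda>zs. W m f g (x # zs))"
    proof (rule alt_form_cong)
      show "alt_form k (\<lambda>zs. (if m = 0 then 0 else W (m - 1) (\<lambda>zs. f (x # zs)) g zs) +
        (if n = 0 then 0 else alt_sign m (W m f (\<lambda>zs. g (x # zs)) zs)))"
        using 1 2 by (cases "m = 0"; cases "n = 0")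
          (simp_all add: alt_form_zero alt_form_add alt_form_alt_sign)
    qed (rule Wcons[symmetric])
  next
    fix x y :: 'a and zs :: "'a list" assume l: "length zs = k"
    show "W m f g ((x + y) # zs) = W m f g (x # zs) + W m f g (y # zs)"
      unfolding Wcons[OF l] using fadd gadd[OF _ l] by (simp add: alt_sign_add)
  next
    fix s and x :: 'a and zs :: "'a list" assume l: "length zs = k"
    show "W m f g (scA s x # zs) = scB s (W m f g (x # zs))"
      unfolding Wcons[OF l] using fsc gsc[OF _ l] by (simp add: scB_add sg)
  next
    fix x :: 'a and zs :: "'a list" assume l: "Suc (length zs) = k"
    have 1: "W (m - 2) (\<lambda>zs. f (x # x # zs)) g zs = 0" if "2 \<le> m"
    proof -
      have "f (x # x # ws) = 0" if "length ws = m - 2" for ws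
        using that \<open>2 \<le> m\<close> alt_formD(4)[OF f, of ws x] by simp
      then have "W (m - 2) (\<lambda>zs. f (x # x # zs)) g zs = W (m - 2) (\<lambda>zs. 0) g zs"
        by (intro wedge_cong) auto
      then show ?thesis by (simp add: wedge_zero)
    qed
    have 2: "W m f (\<lambda>zs. g (x # x # zs)) zs = 0"
    proof (cases "2 \<le> n")
      case True
      have "g (x # x # ws) = 0" if "m + length ws = length zs" for ws
        using that l Suc.hyps True alt_formD(4)[OF g, of ws x] by simp
      then have "W m f (\<lambda>zs. g (x # x # zs)) zs = W m f (\<lambda>zs. 0) zs"
        by (intro wedge_cong) auto
      then show ?thesis by (simp add: wedge_zero)
    qed (use l Suc.hyps in \<open>simp add: wedge_short\<close>)
    have 3: "W (m - 1) (\<lambda>zs. f (x # zs)) (\<lambda>zs. g (x # zs)) zs = 0" if "n = 0" "m \<noteq> 0"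
      using that l Suc.hyps by (simp add: wedge_short)
    consider "m = 0" | "m = 1" | "2 \<le> m" by linarith
    \<comment> \<open>Of the four terms of the double contraction, those with both copies of x in
      one factor vanish, and the two mixed ones are the product of f(x,...) and g(x,...) with
      opposite signs.\<close>
    then show "W m f g (x # x # zs) = 0"
    proof cases
      case 3
      then obtain j where "m = Suc (Suc j)" by (metis add_2_eq_Suc le_Suc_ex)
      then show ?thesis using 1[OF 3] 2 by simp
    qed (use 2 in \<open>simp_all add: alt_sign_def\<close>)
  qed
qed

text \<open>Contraction gives [f_x, f] + [f, f_x] with f_x = f(x,...), and for m even antisymmetry
  makes the second term the negative of the first. In degree 0 this is
  \<open>brB_self\<close>.\<close>

lemma wedge_even_self:
  assumes "even m" "length xs = m + m"
  shows "W m f f xs = 0"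
proof (cases m)
  case 0
  then show ?thesis using assms by (simp add: brB_self)
next
  case (Suc k)
  then obtain x ys where xs: "xs = x # ys" "length ys = m + k" using assms by (auto simp: length_Suc_conv)
  have "W m f (\<lambda>zs. f (x # zs)) ys = - alt_sign (m * k) (W k (\<lambda>zs. f (x # zs)) f ys)"
    by (rule wedge_antisym) (rule xs)
  then show ?thesis using assms(1) by (simp add: xs(1) Suc alt_sign_def)
qed

text \<open>With h = f(x,...), of even degree, contraction of [f,f] gives 2[h,f], hence that of
  [f,[f,f]] gives [h,[f,f]] - 2[f,[h,f]]. Jacobi rewrites [h,[f,f]] as [[h,f],f] + [f,[h,f]], and
  [[h,f],f] = [f,[h,f]] because [h,f] and f both have odd degree.\<close>

lemma wedge_odd_self:
  assumes "odd m" "length xs = m + (m + m)"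
  shows "W m f (W m f f) xs = 0"
proof -
  obtain k where k: "m = Suc k" using assms(1) by (cases m) auto
  then obtain x ys where xs: "xs = x # ys" "length ys = m + (m + k)" using assms by (auto simp: length_Suc_conv)
  define h where "h = (\<lambda>zs. f (x # zs))"
  have sq: "W m f f (x # zs) = W k h f zs + W k h f zs" if "length zs = m + k" for zs
  proof -
    have "W m f h zs = - alt_sign (m * k) (W k h f zs)" by (rule wedge_antisym) (rule that)
    then show ?thesis using assms(1) by (simp add: k h_def alt_sign_def)
  qed
  have "W m f (\<lambda>zs. W m f f (x # zs)) ys = W m f (\<lambda>zs. W k h f zs + W k h f zs) ys"
    by (rule wedge_cong) (use sq xs(2) in auto)
  then have 1: "W m f (W m f f) xs = W k h (W m f f) ys - (W m f (W k h f) ys + W m f (W k h f) ys)"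
    unfolding wedge_add using assms(1) by (simp add: xs(1) k h_def alt_sign_def)
  have "W k h (W m f f) ys = W (k + m) (W k h f) f ys + W m f (W k h f) ys"
    using assms(1) by (subst wedge_jacobi) (simp add: k alt_sign_def)
  moreover have "W (k + m) (W k h f) f ys = - alt_sign ((k + m) * m) (W m f (W k h f) ys)"
    by (rule wedge_antisym) (use xs(2) in simp)
  ultimately show ?thesis using assms(1) 1 by (simp add: k alt_sign_def)
qed

end

section \<open>The explicit formulas for the differential and the cup product\<close>

lemma nths_Cons_remove:
  "nths (x # xs) (- {0}) = xs" "nths (x # xs) (- {Suc i}) = x # nths xs (- {i})"
  "nths (x # xs) (- {0, Suc i}) = nths xs (- {i})"
  "nths (x # xs) (- {Suc i, Suc j}) = x # nths xs (- {i, j})"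
proof -
  have "{j. Suc j \<in> - {0::nat}} = UNIV" "{j. Suc j \<in> - {Suc i}} = - {i}"
    "{j. Suc j \<in> - {0, Suc i}} = - {i}" "{k. Suc k \<in> - {Suc i, Suc j}} = - {i, j}" by auto
  then show "nths (x # xs) (- {0}) = xs" "nths (x # xs) (- {Suc i}) = x # nths xs (- {i})"
    "nths (x # xs) (- {0, Suc i}) = nths xs (- {i})"
    "nths (x # xs) (- {Suc i, Suc j}) = x # nths xs (- {i, j})"
    by (simp_all add: nths_Cons nths_all)
qed

lemma length_nths_remove: "i < length xs \<Longrightarrow> length (nths xs (- {i})) = length xs - 1"
proof (induction xs arbitrary: i)
  case (Cons x xs)
  then show ?case by (cases i) (auto simp: nths_Cons_remove)
qed simp

lemma length_nths_remove2:
  "i < j \<Longrightarrow> j < length xs \<Longrightarrow> length (nths xs (- {i, j})) = length xs - 2"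
proof (induction xs arbitrary: i j)
  case (Cons x xs)
  then obtain k where "j = Suc k" by (cases j) auto
  with Cons show ?case by (cases i) (auto simp: nths_Cons_remove length_nths_remove)
qed simp

lemma ordered_pairs_Suc:
  "{(i, j). i < j \<and> j \<le> Suc n} =
    (\<lambda>j. (0, Suc j)) ` {..n} \<union> map_prod Suc Suc ` {(i, j). i < j \<and> j \<le> n}" (is "?L = ?R")
proof
  show "?L \<subseteq> ?R"
  proof clarify
    fix i j assume a: "i < j" "j \<le> Suc n" "(i, j) \<notin> map_prod Suc Suc ` {(i, j). i < j \<and> j \<le> n}"
    then obtain l where j: "j = Suc l" by (cases j) auto
    have "i = 0"
    proof (rule ccontr)
      assume "i \<noteq> 0"
      then obtain k where "i = Suc k" by (cases i) auto
      with a j show False by force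
    qed
    with a j show "(i, j) \<in> (\<lambda>j. (0, Suc j)) ` {..n}" by auto
  qed
qed auto

lemma finite_ordered_pairs: "finite {(i, j). i < j \<and> j \<le> (n::nat)}"
  by (rule finite_subset[of _ "{..n} \<times> {..n}"]) auto

context alt_calculus begin

text \<open>Moving the entry in position i past its i predecessors costs (-1)^i. This reconciles the
  Lie derivative, which brackets in place, with the classical formula, which puts the bracket in
  front.\<close>

lemma alt_form_update:
  assumes "alt_form (length xs) f" "i < length xs"
  shows "f (xs[i := y]) = alt_sign i (f (y # nths xs (- {i})))"
  using assms
proof (induction xs arbitrary: f i)
  case (Cons x xs)
  show ?case
  proof (cases i)
    case 0
    then show ?thesis by (simp add: nths_Cons_remove)
  next
    case (Suc j)
    obtain n where n: "length xs = Suc n" using Cons.prems Suc by (cases xs) auto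
    have "f (x # xs[j := y]) = alt_sign j (f (x # y # nths xs (- {j})))"
      using Cons.prems Suc by (intro Cons.IH) auto
    moreover have "f (x # y # nths xs (- {j})) = - f (y # x # nths xs (- {j}))"
      using Cons.prems Suc n by (intro alt_form_swap[of n]) (auto simp: length_nths_remove)
    ultimately show ?thesis by (simp add: Suc nths_Cons_remove)
  qed
qed simp

lemma LD_eq_sum: "LD x f xs = act x (f xs) - (\<Sum>i<length xs. f (xs[i := br x (xs ! i)]))"
  by (induction xs arbitrary: f) (simp_all add: sum.lessThan_Suc_shift del: sum.lessThan_Suc)

text \<open>Split off the first entry x. The summand i = 0 and the pairs (0, j) make up L_x f on the
  rest. All other summands carry one extra sign, from the index shift in the first sum and from
  moving x in front of the bracket in the second, and make up minus the differential of
  f(x,...).\<close>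

lemma D_eq_sum:
  assumes "alt_form n f" "length xs = Suc n"
  shows "D f xs = (\<Sum>i\<le>n. alt_sign i (act (xs ! i) (f (nths xs (- {i}))))) +
    (\<Sum>(i, j)\<in>{(i, j). i < j \<and> j \<le> n}. alt_sign (i + j) (f (br (xs ! i) (xs ! j) # nths xs (- {i, j}))))"
  using assms
proof (induction n arbitrary: f xs)
  case 0
  then obtain x where "xs = [x]" by (auto simp: length_Suc_conv)
  moreover have e: "{(i, j). i < j \<and> j \<le> (0::nat)} = {}" by auto
  ultimately show ?case unfolding e by (simp add: nths_Cons_remove)
next
  case (Suc n)
  obtain x ys where xs: "xs = x # ys" and l: "length ys = Suc n"
    using Suc.prems(2) by (auto simp: length_Suc_conv)
  let ?A = "\<lambda>i. alt_sign i (act (ys ! i) (f (x # nths ys (- {i}))))"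
  let ?B = "\<lambda>(i, j). alt_sign (i + j) (f (x # br (ys ! i) (ys ! j) # nths ys (- {i, j})))"
  have D: "D f xs = LD x f ys - ((\<Sum>i\<le>n. ?A i) + (\<Sum>ij\<in>{(i, j). i < j \<and> j \<le> n}. ?B ij))"
    using Suc.IH[of "\<lambda>zs. f (x # zs)" ys] Suc.prems(1) l by (simp add: xs case_prod_unfold)
  have A: "(\<Sum>i\<le>Suc n. alt_sign i (act (xs ! i) (f (nths xs (- {i}))))) = act x (f ys) - (\<Sum>i\<le>n. ?A i)"
    by (simp add: sum.atMost_Suc_shift xs nths_Cons_remove sum_negf del: sum.atMost_Suc)
  have B0: "(\<Sum>j\<le>n. alt_sign (Suc j) (f (br x (ys ! j) # nths ys (- {j})))) =
      - (\<Sum>i<length ys. f (ys[i := br x (ys ! i)]))"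
    unfolding sum_negf[symmetric] using Suc.prems(1) l
    by (intro sum.cong) (auto simp: alt_form_update)
  have B1: "(\<Sum>(i, j)\<in>{(i, j). i < j \<and> j \<le> n}.
      alt_sign (Suc i + Suc j) (f (br (ys ! i) (ys ! j) # x # nths ys (- {i, j})))) =
      - (\<Sum>ij\<in>{(i, j). i < j \<and> j \<le> n}. ?B ij)"
    unfolding sum_negf[symmetric]
  proof (intro sum.cong refl, clarify)
    fix i j assume ij: "i < j" "j \<le> n"
    then obtain k where n: "n = Suc k" by (cases n) auto
    have "length (nths ys (- {i, j})) = k" using ij l n by (simp add: length_nths_remove2)
    then have "f (br (ys ! i) (ys ! j) # x # nths ys (- {i, j})) =
        - f (x # br (ys ! i) (ys ! j) # nths ys (- {i, j}))"
      using Suc.prems(1) unfolding n by (intro alt_form_swap)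
    then show "alt_sign (Suc i + Suc j) (f (br (ys ! i) (ys ! j) # x # nths ys (- {i, j}))) =
        - alt_sign (i + j) (f (x # br (ys ! i) (ys ! j) # nths ys (- {i, j})))"
      by simp
  qed
  have "(\<Sum>(i, j)\<in>{(i, j). i < j \<and> j \<le> Suc n}.
      alt_sign (i + j) (f (br (xs ! i) (xs ! j) # nths xs (- {i, j})))) =
    (\<Sum>j\<le>n. alt_sign (Suc j) (f (br x (ys ! j) # nths ys (- {j})))) +
    (\<Sum>(i, j)\<in>{(i, j). i < j \<and> j \<le> n}.
      alt_sign (Suc i + Suc j) (f (br (ys ! i) (ys ! j) # x # nths ys (- {i, j}))))"
    unfolding ordered_pairs_Suc
    by (subst sum.union_disjoint)
      (use finite_ordered_pairs[of n] in \<open>auto simp: sum.reindex inj_on_def xs nths_Cons_remove case_prod_unfold\<close>)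
  then show ?case unfolding A D B0 B1 LD_eq_sum by simp
qed

end

text \<open>In a shuffle the value 0 is taken at position 0 or at position \<open>m\<close>; accordingly the shuffle is
  \<open>lift_perm \<tau>\<close> or \<open>lift_perm \<tau> \<circ> front_cycle m\<close> for a smaller shuffle \<open>\<tau>\<close>.\<close>

definition lift_perm :: "(nat \<Rightarrow> nat) \<Rightarrow> nat \<Rightarrow> nat" where
  "lift_perm \<tau> i = (case i of 0 \<Rightarrow> 0 | Suc j \<Rightarrow> Suc (\<tau> j))"

lemma lift_perm_simps [simp]: "lift_perm \<tau> 0 = 0" "lift_perm \<tau> (Suc j) = Suc (\<tau> j)"
  by (simp_all add: lift_perm_def)

definition front_cycle :: "nat \<Rightarrow> nat \<Rightarrow> nat" where
  "front_cycle m i = (if i < m then Suc i else if i = m then 0 else i)"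

lemma front_cycle_Suc: "front_cycle (Suc m) = front_cycle m \<circ> transpose m (Suc m)"
  by (auto simp: front_cycle_def transpose_def fun_eq_iff)

text \<open>By \<open>front_cycle_Suc\<close> the cycle is a product of m adjacent transpositions.
  Its sign is the \<open>alt_sign m\<close> in the recursion for \<open>wedge\<close>: the first
  argument passes the m arguments of f on its way into g.\<close>

lemma front_cycle_permutes_sign:
  "front_cycle m permutes {..m} \<and> sign (front_cycle m) = (-1) ^ m"
proof (induction m)
  case 0
  have "front_cycle 0 = id" by (auto simp: front_cycle_def fun_eq_iff)
  then show ?case by (simp only: permutes_id sign_id power_0)
next
  case (Suc m)
  have t: "transpose m (Suc m) permutes {..Suc m}" by (rule permutes_swap_id) auto
  have c: "front_cycle m permutes {..Suc m}" using Suc by (auto intro: permutes_subset)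
  show ?case
    unfolding front_cycle_Suc
    using permutes_compose[OF t c] Suc sign_compose[OF permutes_imp_permutation[OF _ c] permutes_imp_permutation[OF _ t]]
    by (simp add: sign_swap_id comp_def)
qed

text \<open>Away from 0 this is \<tau> transported along the injection \<open>Suc\<close>, and
  transport along an injection preserves signs.\<close>

lemma lift_perm_permutes:
  assumes "\<tau> permutes {..<k}"
  shows "lift_perm \<tau> permutes {..<Suc k}" "sign (lift_perm \<tau>) = sign \<tau>"
proof -
  have inj: "inj_on Suc {..<k}" by simp
  have im: "Suc ` {..<k} = {1..<Suc k}"
    by (metis One_nat_def image_Suc_lessThan atLeastLessThanSuc_atLeastAtMost)
  have e: "lift_perm \<tau> = map_permutation {..<k} Suc \<tau>"
  proof
    fix i
    show "lift_perm \<tau> i = map_permutation {..<k} Suc \<tau> i"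
    proof (cases i)
      case 0
      then show ?thesis by (auto simp: map_permutation_def restrict_id_def)
    next
      case (Suc j)
      show ?thesis
      proof (cases "j < k")
        case True
        then show ?thesis using inv_into_f_f[OF inj, of j] by (simp add: Suc map_permutation_def restrict_id_def)
      next
        case False
        then have "\<tau> j = j" using permutes_not_in[OF assms] by simp
        then show ?thesis using False by (auto simp: Suc map_permutation_def restrict_id_def)
      qed
    qed
  qed
  have "map_permutation {..<k} Suc \<tau> permutes (Suc ` {..<k})"
    by (rule map_permutation_permutes[OF inj_on_imp_bij_betw[OF inj] assms])
  then show "lift_perm \<tau> permutes {..<Suc k}"
    unfolding e by (rule permutes_subset) auto
  show "sign (lift_perm \<tau>) = sign \<tau>"
    unfolding e by (rule sign_map_permutation[OF inj assms]) simp
qed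

lemma lift_perm_surj:
  assumes "\<rho> permutes {..<Suc k}" "\<rho> 0 = 0"
  obtains \<tau> where "\<tau> permutes {..<k}" "\<rho> = lift_perm \<tau>"
proof
  define \<tau> where "\<tau> j = \<rho> (Suc j) - 1" for j
  have nz: "\<rho> (Suc j) \<noteq> 0" for j
    using permutes_inj[OF assms(1)] assms(2) by (metis injD nat.distinct(1))
  show e: "\<rho> = lift_perm \<tau>"
  proof
    show "\<rho> i = lift_perm \<tau> i" for i
      using nz by (cases i) (auto simp: assms(2) \<tau>_def)
  qed
  have s: "Suc (\<tau> j) = \<rho> (Suc j)" for j by (simp add: e)
  have "bij \<tau>"
  proof (rule bijI)
    show "inj \<tau>"
      by (rule injI) (metis s permutes_inj[OF assms(1)] injD Suc_inject)
    show "surj \<tau>"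
    proof (unfold surj_def, rule allI)
      fix y
      obtain i where i: "\<rho> i = Suc y" using permutes_surj[OF assms(1)] by (metis surjD)
      have "i \<noteq> 0"
      proof
        assume "i = 0"
        then show False using i assms(2) by simp
      qed
      then obtain j where "i = Suc j" by (cases i) auto
      then have "y = \<tau> j" using i s[of j] by simp
      then show "\<exists>x. y = \<tau> x" ..
    qed
  qed
  moreover have "\<tau> j = j" if "j \<notin> {..<k}" for j
    using permutes_not_in[OF assms(1), of "Suc j"] that s[of j] by simp
  ultimately show "\<tau> permutes {..<k}" unfolding permutes_def bij_iff by auto
qed

lemma shuffle_perms_Suc:
  assumes "m + n = Suc k"
  shows "shuffle_perms m n =
    (if m = 0 then {} else lift_perm ` shuffle_perms (m - 1) n) \<union>
    (if n = 0 then {} else (\<lambda>\<tau>. lift_perm \<tau> \<circ> front_cycle m) ` shuffle_perms m (n - 1))" (is "_ = ?R")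
proof
  show "shuffle_perms m n \<subseteq> ?R"
  proof
    fix \<sigma> assume "\<sigma> \<in> shuffle_perms m n"
    then have p: "\<sigma> permutes {..<Suc k}" and m1: "strict_mono_on {..<m} \<sigma>" and m2: "strict_mono_on {m..<m + n} \<sigma>"
      by (auto simp: shuffle_perms_def assms)
    obtain j where j: "\<sigma> j = 0" using permutes_surj[OF p] by (metis surjD)
    have jk: "j < Suc k" using permutes_not_in[OF p, of j] j by (metis lessThan_iff not_less_zero zero_less_Suc)
    show "\<sigma> \<in> ?R"
    proof (cases "j < m")
      case True
      \<comment> \<open>The value 0 is minimal and a shuffle increases on each block, so 0 is taken
        at the start of its block.\<close>
      have "j = 0"
        using strict_mono_onD[OF m1, of 0 j] True j by (cases "j = 0") auto
      then obtain \<tau> where t: "\<tau> permutes {..<k}" "\<sigma> = lift_perm \<tau>"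
        using lift_perm_surj[OF p] j by auto
      have k: "k = m - 1 + n" using assms True by simp
      have "strict_mono_on {..<m - 1} \<tau>"
        using strict_mono_onD[OF m1, of "Suc _" "Suc _"] t(2) by (intro strict_mono_onI) auto
      moreover have "strict_mono_on {m - 1..<m - 1 + n} \<tau>"
      proof (rule strict_mono_onI)
        fix r s assume "r \<in> {m - 1..<m - 1 + n}" "s \<in> {m - 1..<m - 1 + n}" "r < s"
        then show "\<tau> r < \<tau> s"
          using strict_mono_onD[OF m2, of "Suc r" "Suc s"] t(2) True by auto
      qed
      ultimately show ?thesis using t True k by (auto simp: shuffle_perms_def)
    next
      case False
      have "j = m"
        using strict_mono_onD[OF m2, of m j] False j jk assms by (cases "j = m") auto
      then have sm: "\<sigma> m = 0" using j by simp
      have n: "n \<noteq> 0" using \<open>j = m\<close> jk assms by simp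
      have c: "front_cycle m permutes {..<Suc k}"
        using front_cycle_permutes_sign[of m] n assms by (auto intro: permutes_subset)
      \<comment> \<open>Undoing the cycle brings the value 0 from position m to position 0, so that
        \<open>lift_perm_surj\<close> yields the smaller permutation.\<close>
      have "\<sigma> \<circ> inv_into UNIV (front_cycle m) permutes {..<Suc k}"
        by (rule permutes_compose[OF permutes_inv[OF c] p])
      moreover have "inv_into UNIV (front_cycle m) 0 = m"
        by (rule inv_f_eq[OF permutes_inj[OF c]]) (simp add: front_cycle_def)
      then have "(\<sigma> \<circ> inv_into UNIV (front_cycle m)) 0 = 0" using sm by simp
      ultimately obtain \<tau> where t: "\<tau> permutes {..<k}" "\<sigma> \<circ> inv_into UNIV (front_cycle m) = lift_perm \<tau>"
        by (rule lift_perm_surj)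
      have s: "\<sigma> = lift_perm \<tau> \<circ> front_cycle m"
        using permutes_inv_o(2)[OF c] by (simp flip: t(2) add: comp_assoc)
      have s1: "\<sigma> i = Suc (\<tau> i)" if "i < m" for i
        using that by (simp add: s front_cycle_def)
      have s2: "\<sigma> (Suc i) = Suc (\<tau> i)" if "m \<le> i" for i
        using that by (simp add: s front_cycle_def)
      have k: "k = m + (n - 1)" using assms n by simp
      have "strict_mono_on {..<m} \<tau>"
        using strict_mono_onD[OF m1] s1 by (intro strict_mono_onI) fastforce
      moreover have "strict_mono_on {m..<m + (n - 1)} \<tau>"
      proof (rule strict_mono_onI)
        fix r l assume "r \<in> {m..<m + (n - 1)}" "l \<in> {m..<m + (n - 1)}" "r < l"
        then show "\<tau> r < \<tau> l"
          using strict_mono_onD[OF m2, of "Suc r" "Suc l"] s2[of r] s2[of l] by auto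
      qed
      ultimately have "\<tau> \<in> shuffle_perms m (n - 1)" using t(1) k by (simp add: shuffle_perms_def)
      then show ?thesis using n s by auto
    qed
  qed
next
  show "?R \<subseteq> shuffle_perms m n"
  proof
    fix \<sigma> assume "\<sigma> \<in> ?R"
    then consider \<tau> where "m \<noteq> 0" "\<tau> \<in> shuffle_perms (m - 1) n" "\<sigma> = lift_perm \<tau>"
      | \<tau> where "n \<noteq> 0" "\<tau> \<in> shuffle_perms m (n - 1)" "\<sigma> = lift_perm \<tau> \<circ> front_cycle m"
      by (auto split: if_splits)
    then show "\<sigma> \<in> shuffle_perms m n"
    proof cases
      case 1
      have k: "k = m - 1 + n" using assms 1 by simp
      have t: "\<tau> permutes {..<k}" "strict_mono_on {..<m - 1} \<tau>" "strict_mono_on {m - 1..<m - 1 + n} \<tau>"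
        using 1 k by (auto simp: shuffle_perms_def)
      have "strict_mono_on {..<m} \<sigma>"
      proof (rule strict_mono_onI)
        fix r s assume "r \<in> {..<m}" "s \<in> {..<m}" "r < s"
        then show "\<sigma> r < \<sigma> s"
          using strict_mono_onD[OF t(2)] by (cases r; cases s) (auto simp: 1)
      qed
      moreover have "strict_mono_on {m..<m + n} \<sigma>"
      proof (rule strict_mono_onI)
        fix r s assume "r \<in> {m..<m + n}" "s \<in> {m..<m + n}" "r < s"
        then show "\<sigma> r < \<sigma> s"
          using strict_mono_onD[OF t(3)] 1(1) by (cases r; cases s) (auto simp: 1(3))
      qed
      ultimately show ?thesis
        using lift_perm_permutes(1)[OF t(1)] by (simp add: shuffle_perms_def assms 1(3))
    next
      case 2
      have k: "k = m + (n - 1)" using assms 2 by simp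
      have t: "\<tau> permutes {..<k}" "strict_mono_on {..<m} \<tau>" "strict_mono_on {m..<m + (n - 1)} \<tau>"
        using 2 k by (auto simp: shuffle_perms_def)
      have c: "front_cycle m permutes {..<Suc k}"
        using front_cycle_permutes_sign[of m] 2 assms by (auto intro: permutes_subset)
      have "strict_mono_on {..<m} \<sigma>"
        using strict_mono_onD[OF t(2)] by (intro strict_mono_onI) (auto simp: 2(3) front_cycle_def)
      moreover have "strict_mono_on {m..<m + n} \<sigma>"
      proof (rule strict_mono_onI)
        fix r s assume "r \<in> {m..<m + n}" "s \<in> {m..<m + n}" "r < s"
        then show "\<sigma> r < \<sigma> s"
          using strict_mono_onD[OF t(3)] 2(1) by (cases r; cases s) (auto simp: 2(3) front_cycle_def)
      qed
      ultimately show ?thesis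
        using permutes_compose[OF c lift_perm_permutes(1)[OF t(1)]] by (simp add: shuffle_perms_def assms 2(3))
    qed
  qed
qed

lemma inj_lift_perm: "inj lift_perm"
proof (rule injI)
  fix \<sigma> \<tau> assume "lift_perm \<sigma> = lift_perm \<tau>"
  then have "lift_perm \<sigma> (Suc i) = lift_perm \<tau> (Suc i)" for i by simp
  then show "\<sigma> = \<tau>" by auto
qed

lemma finite_shuffle_perms: "finite (shuffle_perms m n)"
  by (rule finite_subset[OF _ finite_permutations[of "{..<m + n}"]]) (auto simp: shuffle_perms_def)

text \<open>Applied only to signs of permutations, so that any integer other than 1 stands for
  -1.\<close>

definition signed :: "int \<Rightarrow> 'b::ab_group_add \<Rightarrow> 'b" where
  "signed k v = (if k = 1 then v else - v)"

text \<open>The two families of shuffles are disjoint, since \<open>lift_perm\<close> fixes 0 while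
  its composite with the cycle sends 0 to a successor when m > 0. The sum thus splits exactly as the
  recursion for \<open>wedge\<close> does.\<close>

lemma sum_shuffle_perms_Suc:
  fixes F :: "(nat \<Rightarrow> nat) \<Rightarrow> 'b::ab_group_add"
  assumes "m + n = Suc k"
  shows "(\<Sum>\<sigma>\<in>shuffle_perms m n. signed (sign \<sigma>) (F \<sigma>)) =
    (if m = 0 then 0 else \<Sum>\<tau>\<in>shuffle_perms (m - 1) n. signed (sign \<tau>) (F (lift_perm \<tau>))) +
    (if n = 0 then 0 else alt_sign m (\<Sum>\<tau>\<in>shuffle_perms m (n - 1). signed (sign \<tau>) (F (lift_perm \<tau> \<circ> front_cycle m))))"
proof -
  let ?A = "if m = 0 then {} else lift_perm ` shuffle_perms (m - 1) n"
  let ?B = "if n = 0 then {} else (\<lambda>\<tau>. lift_perm \<tau> \<circ> front_cycle m) ` shuffle_perms m (n - 1)"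
  have disj: "?A \<inter> ?B = {}"
  proof -
    have "lift_perm \<tau> \<noteq> lift_perm \<tau>' \<circ> front_cycle m" if "m \<noteq> 0" for \<tau> \<tau>'
    proof
      assume "lift_perm \<tau> = lift_perm \<tau>' \<circ> front_cycle m"
      then have "lift_perm \<tau> 0 = lift_perm \<tau>' (front_cycle m 0)" by simp
      then show False using that by (simp add: front_cycle_def)
    qed
    then show ?thesis by auto
  qed
  have A: "(\<Sum>\<sigma>\<in>?A. signed (sign \<sigma>) (F \<sigma>)) =
    (if m = 0 then 0 else \<Sum>\<tau>\<in>shuffle_perms (m - 1) n. signed (sign \<tau>) (F (lift_perm \<tau>)))"
  proof (cases "m = 0")
    case False
    then have k: "m - 1 + n = k" using assms by simp
    have "sign (lift_perm \<tau>) = sign \<tau>" if "\<tau> \<in> shuffle_perms (m - 1) n" for \<tau>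
      by (rule lift_perm_permutes(2)[of _ k]) (use that k in \<open>simp add: shuffle_perms_def\<close>)
    then show ?thesis
      using False inj_on_subset[OF inj_lift_perm] by (simp add: sum.reindex)
  qed simp
  have B: "(\<Sum>\<sigma>\<in>?B. signed (sign \<sigma>) (F \<sigma>)) =
    (if n = 0 then 0 else alt_sign m (\<Sum>\<tau>\<in>shuffle_perms m (n - 1). signed (sign \<tau>) (F (lift_perm \<tau> \<circ> front_cycle m))))"
  proof (cases "n = 0")
    case False
    then have k: "m + (n - 1) = k" using assms by simp
    have c: "front_cycle m permutes {..<Suc k}"
      using front_cycle_permutes_sign[of m] False assms by (auto intro: permutes_subset)
    have sg: "signed (sign (lift_perm \<tau> \<circ> front_cycle m)) v = alt_sign m (signed (sign \<tau>) v)"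
      if "\<tau> \<in> shuffle_perms m (n - 1)" for \<tau> and v :: 'b
    proof -
      have t: "\<tau> permutes {..<k}" using that k by (simp add: shuffle_perms_def)
      have "sign (lift_perm \<tau> \<circ> front_cycle m) = sign \<tau> * (-1) ^ m"
        using sign_compose[OF permutes_imp_permutation[OF _ lift_perm_permutes(1)[OF t]] permutes_imp_permutation[OF _ c]]
          lift_perm_permutes(2)[OF t] front_cycle_permutes_sign[of m] by simp
      then show ?thesis
        by (cases "even m"; cases \<tau> rule: sign_cases) (simp_all add: signed_def alt_sign_def)
    qed
    have inj: "inj (\<lambda>\<tau>. lift_perm \<tau> \<circ> front_cycle m)"
    proof (rule injI)
      fix \<sigma> \<tau> assume "lift_perm \<sigma> \<circ> front_cycle m = lift_perm \<tau> \<circ> front_cycle m"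
      then have "lift_perm \<sigma> = lift_perm \<tau>"
        using permutes_surj[OF c] by (metis comp_assoc comp_id surj_iff)
      then show "\<sigma> = \<tau>" using inj_lift_perm by (auto dest: injD)
    qed
    have sum: "(\<Sum>\<tau>\<in>S. alt_sign m (G \<tau>)) = alt_sign m (\<Sum>\<tau>\<in>S. G \<tau>)" for S and G :: "(nat \<Rightarrow> nat) \<Rightarrow> 'b"
      by (simp add: alt_sign_def sum_negf)
    then show ?thesis
      using False inj_on_subset[OF inj] sg by (simp add: sum.reindex sum)
  qed simp
  show ?thesis
    unfolding shuffle_perms_Suc[OF assms] A[symmetric] B[symmetric]
    by (rule sum.union_disjoint) (use disj in \<open>simp_all add: finite_shuffle_perms\<close>)
qed

context lie_alt_calculus begin

text \<open>Shuffles that take the value 0 at position 0 hand the first argument to f, those that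
  take it at position m hand it to g; both times a sum over shuffles of the tail remains, which is
  the contracted product.\<close>

lemma wedge_eq_sum:
  assumes "length xs = m + n"
  shows "W m f g xs = (\<Sum>\<sigma>\<in>shuffle_perms m n. signed (sign \<sigma>)
    (brB (f (map (\<lambda>i. xs ! \<sigma> i) [0..<m])) (g (map (\<lambda>i. xs ! \<sigma> i) [m..<m + n]))))"
  using assms
proof (induction xs arbitrary: m n f g)
  case Nil
  then have "shuffle_perms m n = {id}" by (auto simp: shuffle_perms_def)
  with Nil show ?case by (simp add: signed_def)
next
  case (Cons x xs)
  let ?f = "\<lambda>\<sigma>. f (map (\<lambda>i. (x # xs) ! \<sigma> i) [0..<m])"
  let ?g = "\<lambda>\<sigma>. g (map (\<lambda>i. (x # xs) ! \<sigma> i) [m..<m + n])"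
  have 1: "W (m - 1) (\<lambda>zs. f (x # zs)) g xs =
    (\<Sum>\<tau>\<in>shuffle_perms (m - 1) n. signed (sign \<tau>) (brB (?f (lift_perm \<tau>)) (?g (lift_perm \<tau>))))" if "m \<noteq> 0"
  proof -
    define l where "l = m - 1"
    with that have l: "m = Suc l" by simp
    have "[0..<Suc l] = 0 # map Suc [0..<l]" by (simp add: map_Suc_upt upt_conv_Cons del: upt_Suc)
    then have fm: "map (\<lambda>i. (x # xs) ! lift_perm \<tau> i) [0..<Suc l] = x # map (\<lambda>i. xs ! \<tau> i) [0..<l]" for \<tau>
      by simp
    have "[Suc l..<Suc l + n] = map Suc [l..<l + n]" by (simp add: map_Suc_upt)
    then have gm: "map (\<lambda>i. (x # xs) ! lift_perm \<tau> i) [Suc l..<Suc l + n] = map (\<lambda>i. xs ! \<tau> i) [l..<l + n]" for \<tau>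
      by simp
    show ?thesis
      using Cons.IH[of l n "\<lambda>zs. f (x # zs)" g] Cons.prems by (simp only: l fm gm) simp
  qed
  have 2: "W m f (\<lambda>zs. g (x # zs)) xs = (if n = 0 then 0 else
    (\<Sum>\<tau>\<in>shuffle_perms m (n - 1). signed (sign \<tau>)
      (brB (?f (lift_perm \<tau> \<circ> front_cycle m)) (?g (lift_perm \<tau> \<circ> front_cycle m)))))"
  proof (cases n)
    case 0
    then show ?thesis using Cons.prems by (simp add: wedge_short)
  next
    case (Suc l)
    have fm: "map (\<lambda>i. (x # xs) ! (lift_perm \<tau> \<circ> front_cycle m) i) [0..<m] = map (\<lambda>i. xs ! \<tau> i) [0..<m]" for \<tau>
      by (auto simp: front_cycle_def)
    have u: "[m..<m + Suc l] = m # map Suc [m..<m + l]" by (simp add: map_Suc_upt upt_conv_Cons del: upt_Suc)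
    have gm: "map (\<lambda>i. (x # xs) ! (lift_perm \<tau> \<circ> front_cycle m) i) [m..<m + Suc l] =
        x # map (\<lambda>i. xs ! \<tau> i) [m..<m + l]" for \<tau>
      unfolding u by (auto simp: front_cycle_def)
    show ?thesis
      using Cons.IH[of m l f "\<lambda>zs. g (x # zs)"] Cons.prems by (simp only: Suc fm gm) simp
  qed
  have k: "m + n = Suc (length xs)" using Cons.prems by simp
  show ?case
    unfolding sum_shuffle_perms_Suc[OF k] using 1 2 by simp
qed

end

section \<open>Embedding groups with a carrier into a type class\<close>

lemma one_in_prod: "(\<lambda>S\<in>{S::'b monoid. comm_group S}. \<one>\<^bsub>S\<^esub>) \<in> (\<Pi>\<^sub>E S\<in>{S. comm_group S}. carrier S)"
  by (auto simp: comm_group_def group_def intro: monoid.one_closed)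

text \<open>The product of all abelian groups carried by subsets of \<open>'b\<close>.  It is a type of class
  \<^class>\<open>ab_group_add\<close>, every one of those groups is a direct summand of it, and this turns
  identities between partial operations on carriers into identities between total ones.\<close>

typedef 'b ambient = "\<Pi>\<^sub>E S\<in>{S::'b monoid. comm_group S}. carrier S"
  using one_in_prod by blast

lemma Rep_ambient_closed: "comm_group S \<Longrightarrow> Rep_ambient u S \<in> carrier S"
  using Rep_ambient[of u] by auto

lemma ambient_eqI: "(\<And>S. comm_group S \<Longrightarrow> Rep_ambient u S = Rep_ambient v S) \<Longrightarrow> u = v"
  using Rep_ambient[of u] Rep_ambient[of v] by (intro Rep_ambient_inject[THEN iffD1] PiE_ext) auto

instantiation ambient :: (type) ab_group_add
begin

definition "0 = Abs_ambient (\<lambda>S\<in>{S. comm_group S}. \<one>\<^bsub>S\<^esub>)"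
definition "u + v = Abs_ambient (\<lambda>S\<in>{S. comm_group S}. Rep_ambient u S \<otimes>\<^bsub>S\<^esub> Rep_ambient v S)"
definition "- u = Abs_ambient (\<lambda>S\<in>{S. comm_group S}. inv\<^bsub>S\<^esub> Rep_ambient u S)"
definition "u - v = u + (- v)" for u v :: "'a ambient"

lemma Rep_ambient_ops:
  assumes "comm_group S"
  shows "Rep_ambient 0 S = \<one>\<^bsub>S\<^esub>" "Rep_ambient (u + v) S = Rep_ambient u S \<otimes>\<^bsub>S\<^esub> Rep_ambient v S"
    "Rep_ambient (- u) S = inv\<^bsub>S\<^esub> Rep_ambient u S"
proof -
  have g: "group S" if "comm_group S" for S :: "'a monoid" using that by (simp add: comm_group_def)
  note m = group.is_monoid[OF g]
  show "Rep_ambient 0 S = \<one>\<^bsub>S\<^esub>"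
    unfolding zero_ambient_def using one_in_prod assms by (subst Abs_ambient_inverse) auto
  show "Rep_ambient (u + v) S = Rep_ambient u S \<otimes>\<^bsub>S\<^esub> Rep_ambient v S"
    unfolding plus_ambient_def using assms m by (subst Abs_ambient_inverse)
      (auto intro!: monoid.m_closed Rep_ambient_closed)
  show "Rep_ambient (- u) S = inv\<^bsub>S\<^esub> Rep_ambient u S"
    unfolding uminus_ambient_def using assms g by (subst Abs_ambient_inverse)
      (auto intro!: group.inv_closed Rep_ambient_closed)
qed

instance
proof
  fix u v w :: "'a ambient"
  have g: "group S" "comm_monoid S" "monoid S" if "comm_group S" for S :: "'a monoid"
    using that by (simp_all add: comm_group_def group.is_monoid)
  show "u + v + w = u + (v + w)"
    by (rule ambient_eqI) (auto simp: Rep_ambient_ops Rep_ambient_closed monoid.m_assoc g)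
  show "u + v = v + u"
    by (rule ambient_eqI) (auto simp: Rep_ambient_ops Rep_ambient_closed comm_monoid.m_comm g)
  show "0 + u = u"
    by (rule ambient_eqI) (auto simp: Rep_ambient_ops Rep_ambient_closed monoid.l_one g)
  show "- u + u = 0"
    by (rule ambient_eqI) (auto simp: Rep_ambient_ops Rep_ambient_closed group.l_inv g)
  show "u - v = u + - v"
    by (rule minus_ambient_def)
qed

end

text \<open>Truncates the record to the type \<open>'b monoid\<close>, so that a module with any
  record extension indexes a factor of \<open>ambient\<close>.\<close>

definition additive_group :: "('b, 'k) ring_scheme \<Rightarrow> 'b monoid" where
  "additive_group B = \<lparr>carrier = carrier B, monoid.mult = add B, one = ring.zero B\<rparr>"

definition emb :: "('b, 'k) ring_scheme \<Rightarrow> 'b \<Rightarrow> 'b ambient" where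
  "emb B b = Abs_ambient (\<lambda>S\<in>{S. comm_group S}. if S = additive_group B then b else \<one>\<^bsub>S\<^esub>)"

definition prj :: "('b, 'k) ring_scheme \<Rightarrow> 'b ambient \<Rightarrow> 'b" where
  "prj B u = Rep_ambient u (additive_group B)"

context abelian_group begin

lemma comm_group_additive: "comm_group (additive_group G)"
proof (rule comm_groupI)
  fix x assume "x \<in> carrier (additive_group G)"
  then show "\<exists>y\<in>carrier (additive_group G). y \<otimes>\<^bsub>additive_group G\<^esub> x = \<one>\<^bsub>additive_group G\<^esub>"
    by (intro bexI[of _ "\<ominus> x"]) (auto simp: additive_group_def l_neg)
qed (auto simp: additive_group_def a_ac)

lemma inv_additive: "inv\<^bsub>additive_group G\<^esub> x = \<ominus> x"
  by (simp add: a_inv_def m_inv_def additive_group_def)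

lemma prj_closed [simp, intro]: "prj G u \<in> carrier G"
  using Rep_ambient_closed[OF comm_group_additive] by (auto simp: prj_def additive_group_def)

lemma prj_add: "prj G (u + v) = prj G u \<oplus> prj G v"
  and prj_zero: "prj G 0 = \<zero>"
  and prj_uminus: "prj G (- u) = \<ominus> prj G u"
proof -
  note r = Rep_ambient_ops[OF comm_group_additive]
  show "prj G (u + v) = prj G u \<oplus> prj G v"
    unfolding prj_def r by (simp add: additive_group_def)
  show "prj G 0 = \<zero>"
    unfolding prj_def r by (simp add: additive_group_def)
  show "prj G (- u) = \<ominus> prj G u"
    unfolding prj_def r by (rule inv_additive)
qed

lemma prj_diff: "prj G (u - v) = prj G u \<ominus> prj G v"
  using prj_add[of u "- v"] by (simp add: prj_uminus a_minus_def)

lemma emb_Rep: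
  assumes "b \<in> carrier G" "comm_group S"
  shows "Rep_ambient (emb G b) S = (if S = additive_group G then b else \<one>\<^bsub>S\<^esub>)"
proof -
  have "b \<in> carrier (additive_group G)" using assms by (simp add: additive_group_def)
  then have "(\<lambda>S\<in>{S. comm_group S}. if S = additive_group G then b else \<one>\<^bsub>S\<^esub>) \<in>
      (\<Pi>\<^sub>E S\<in>{S. comm_group S}. carrier S)"
    by (auto simp: comm_group_def group_def intro: monoid.one_closed)
  then show ?thesis using assms(2) by (simp add: emb_def Abs_ambient_inverse)
qed

lemma prj_emb [simp]: "b \<in> carrier G \<Longrightarrow> prj G (emb G b) = b"
  by (simp add: prj_def emb_Rep comm_group_additive)

lemma emb_add: "b \<in> carrier G \<Longrightarrow> c \<in> carrier G \<Longrightarrow> emb G (b \<oplus> c) = emb G b + emb G c"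
  by (rule ambient_eqI) (auto simp: emb_Rep Rep_ambient_ops additive_group_def comm_group_def group_def monoid.l_one
    intro: monoid.one_closed)

lemma emb_zero: "emb G \<zero> = 0"
  using emb_add[of \<zero> \<zero>] by simp

lemma emb_diff: "b \<in> carrier G \<Longrightarrow> c \<in> carrier G \<Longrightarrow> emb G (b \<ominus> c) = emb G b - emb G c"
  using emb_add[of "b \<ominus> c" c] by (simp add: a_minus_def a_assoc l_neg)

lemma prj_sum: "finite S \<Longrightarrow> prj G (\<Sum>i\<in>S. f i) = (\<Oplus>i\<in>S. prj G (f i))"
  by (induction S rule: finite_induct) (auto simp: prj_zero prj_add)

lemma add_pow_neg_one: "x \<in> carrier G \<Longrightarrow> add_pow G (- 1 :: int) x = \<ominus> x"
  and add_pow_one: "x \<in> carrier G \<Longrightarrow> add_pow G (1 :: int) x = x"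
  by (simp_all add: add_pow_int_lt add_pow_int_ge)

lemma prj_alt_sign: "prj G (alt_sign k u) = add_pow G ((- 1 :: int) ^ k) (prj G u)"
  by (simp add: alt_sign_def prj_uminus add_pow_neg_one add_pow_one)

lemma prj_signed: "prj G (signed (sign \<sigma>) u) = add_pow G (sign \<sigma>) (prj G u)"
  by (cases \<sigma> rule: sign_cases) (simp_all add: signed_def prj_uminus add_pow_neg_one add_pow_one)

end

section \<open>Cochains with values in a module\<close>

lemma abelian_group_of_module: "module R A \<Longrightarrow> abelian_group A"
  by (rule module.axioms(2))

lemma linear_mapD:
  assumes "linear_map R A B f"
  shows "x \<in> carrier A \<Longrightarrow> f x \<in> carrier B"
    "x \<in> carrier A \<Longrightarrow> y \<in> carrier A \<Longrightarrow> f (x \<oplus>\<^bsub>A\<^esub> y) = f x \<oplus>\<^bsub>B\<^esub> f y"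
    "s \<in> carrier R \<Longrightarrow> x \<in> carrier A \<Longrightarrow> f (s \<odot>\<^bsub>A\<^esub> x) = s \<odot>\<^bsub>B\<^esub> f x"
  using assms by (auto simp: linear_map_def)

lemma linear_mapI:
  assumes "\<And>x. x \<in> carrier A \<Longrightarrow> f x \<in> carrier B"
    "\<And>x y. x \<in> carrier A \<Longrightarrow> y \<in> carrier A \<Longrightarrow> f (x \<oplus>\<^bsub>A\<^esub> y) = f x \<oplus>\<^bsub>B\<^esub> f y"
    "\<And>s x. s \<in> carrier R \<Longrightarrow> x \<in> carrier A \<Longrightarrow> f (s \<odot>\<^bsub>A\<^esub> x) = s \<odot>\<^bsub>B\<^esub> f x"
  shows "linear_map R A B f"
  using assms by (auto simp: linear_map_def)

lemma linear_map_group_hom: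
  assumes "module R A" "module R B" "linear_map R A B f"
  shows "f \<zero>\<^bsub>A\<^esub> = \<zero>\<^bsub>B\<^esub>" "x \<in> carrier A \<Longrightarrow> f (\<ominus>\<^bsub>A\<^esub> x) = \<ominus>\<^bsub>B\<^esub> f x"
    "x \<in> carrier A \<Longrightarrow> y \<in> carrier A \<Longrightarrow> f (x \<ominus>\<^bsub>A\<^esub> y) = f x \<ominus>\<^bsub>B\<^esub> f y"
    "finite S \<Longrightarrow> h \<in> S \<rightarrow> carrier A \<Longrightarrow> f (\<Oplus>\<^bsub>A\<^esub>i\<in>S. h i) = (\<Oplus>\<^bsub>B\<^esub>i\<in>S. f (h i))"
proof -
  interpret A: abelian_group A by (rule abelian_group_of_module[OF assms(1)])
  interpret B: abelian_group B by (rule abelian_group_of_module[OF assms(2)])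
  note f = linear_mapD[OF assms(3)]
  have "f \<zero>\<^bsub>A\<^esub> \<oplus>\<^bsub>B\<^esub> f \<zero>\<^bsub>A\<^esub> = f \<zero>\<^bsub>A\<^esub> \<oplus>\<^bsub>B\<^esub> \<zero>\<^bsub>B\<^esub>" using f(2)[of "\<zero>\<^bsub>A\<^esub>" "\<zero>\<^bsub>A\<^esub>"] f(1) by simp
  then show z: "f \<zero>\<^bsub>A\<^esub> = \<zero>\<^bsub>B\<^esub>" using f(1) B.add.l_cancel by blast
  show n: "f (\<ominus>\<^bsub>A\<^esub> x) = \<ominus>\<^bsub>B\<^esub> f x" if "x \<in> carrier A" for x
    using f(2)[of "\<ominus>\<^bsub>A\<^esub> x" x] that f(1) z by (intro B.minus_equality[symmetric]) (auto simp: A.l_neg)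
  show "f (x \<ominus>\<^bsub>A\<^esub> y) = f x \<ominus>\<^bsub>B\<^esub> f y" if "x \<in> carrier A" "y \<in> carrier A"
    using that by (simp add: a_minus_def f n)
  show "f (\<Oplus>\<^bsub>A\<^esub>i\<in>S. h i) = (\<Oplus>\<^bsub>B\<^esub>i\<in>S. f (h i))" if "finite S" "h \<in> S \<rightarrow> carrier A"
    using that by (induction S rule: finite_induct) (auto simp: z f Pi_def)
qed

lemma bilinear_mapD:
  assumes "bilinear_map R A B C h" "x \<in> carrier A" "y \<in> carrier B"
  shows "h x y \<in> carrier C"
    "x' \<in> carrier A \<Longrightarrow> h (x \<oplus>\<^bsub>A\<^esub> x') y = h x y \<oplus>\<^bsub>C\<^esub> h x' y"
    "y' \<in> carrier B \<Longrightarrow> h x (y \<oplus>\<^bsub>B\<^esub> y') = h x y \<oplus>\<^bsub>C\<^esub> h x y'"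
    "s \<in> carrier R \<Longrightarrow> h (s \<odot>\<^bsub>A\<^esub> x) y = s \<odot>\<^bsub>C\<^esub> h x y"
    "s \<in> carrier R \<Longrightarrow> h x (s \<odot>\<^bsub>B\<^esub> y) = s \<odot>\<^bsub>C\<^esub> h x y"
  using assms by (auto simp: bilinear_map_def linear_map_def)

lemma (in abelian_group) prj_sum_eq:
  "finite S \<Longrightarrow> (\<And>i. i \<in> S \<Longrightarrow> prj G (f i) = g i) \<Longrightarrow> prj G (\<Sum>i\<in>S. f i) = (\<Oplus>i\<in>S. g i)"
proof -
  assume S: "finite S" and e: "\<And>i. i \<in> S \<Longrightarrow> prj G (f i) = g i"
  have "g \<in> S \<rightarrow> carrier G"
    using e prj_closed by (intro Pi_I) metis
  then show ?thesis
    unfolding prj_sum[OF S] by (intro finsum_cong') (auto simp: e)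
qed

lemma linear_map_compose:
  "linear_map R A B f \<Longrightarrow> linear_map R B C h \<Longrightarrow> linear_map R A C (\<lambda>x. h (f x))"
  by (auto simp: linear_map_def Pi_def)

lemma linear_map_sum:
  assumes "module R B" "\<And>i. i \<in> S \<Longrightarrow> linear_map R A B (F i)" "finite S"
  shows "linear_map R A B (\<lambda>x. \<Oplus>\<^bsub>B\<^esub>i\<in>S. F i x)"
proof -
  interpret B: module R B by (rule assms(1))
  note F = linear_mapD[OF assms(2)]
  show ?thesis
  proof (rule linear_mapI)
    fix x assume x: "x \<in> carrier A"
    show "(\<Oplus>\<^bsub>B\<^esub>i\<in>S. F i x) \<in> carrier B" by (rule B.M.finsum_closed) (auto simp: F x)
    show "(\<Oplus>\<^bsub>B\<^esub>i\<in>S. F i (x \<oplus>\<^bsub>A\<^esub> y)) = (\<Oplus>\<^bsub>B\<^esub>i\<in>S. F i x) \<oplus>\<^bsub>B\<^esub> (\<Oplus>\<^bsub>B\<^esub>i\<in>S. F i y)"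
      if y: "y \<in> carrier A" for y
    proof -
      have "(\<Oplus>\<^bsub>B\<^esub>i\<in>S. F i (x \<oplus>\<^bsub>A\<^esub> y)) = (\<Oplus>\<^bsub>B\<^esub>i\<in>S. F i x \<oplus>\<^bsub>B\<^esub> F i y)"
        by (rule B.M.finsum_cong') (auto simp: F x y)
      then show ?thesis by (simp add: Pi_def F x y)
    qed
    show "(\<Oplus>\<^bsub>B\<^esub>i\<in>S. F i (s \<odot>\<^bsub>A\<^esub> x)) = s \<odot>\<^bsub>B\<^esub> (\<Oplus>\<^bsub>B\<^esub>i\<in>S. F i x)" if s: "s \<in> carrier R" for s
      using x s by (subst B.finsum_smult_ldistr[OF assms(3)]) (auto simp: F intro!: B.M.finsum_cong')
  qed
qed

section \<open>Lifting operations and cochains to the ambient type\<close>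

definition lift2 ::
  "('a, 'i) ring_scheme \<Rightarrow> ('b, 'j) ring_scheme \<Rightarrow> ('c, 'k) ring_scheme \<Rightarrow> ('a \<Rightarrow> 'b \<Rightarrow> 'c)
    \<Rightarrow> 'a ambient \<Rightarrow> 'b ambient \<Rightarrow> 'c ambient" where
  "lift2 A B C h u v = emb C (h (prj A u) (prj B v))"

text \<open>Scalars outside the carrier act as 0. With this default the operator is additive and
  commutes with lifted bilinear maps for every value of the type, as the calculus demands.\<close>

definition lift_scalar ::
  "('r, 'n) ring_scheme \<Rightarrow> ('r, 'b, 'k) module_scheme \<Rightarrow> 'r \<Rightarrow> 'b ambient \<Rightarrow> 'b ambient" where
  "lift_scalar R B s u = emb B (if s \<in> carrier R then s \<odot>\<^bsub>B\<^esub> prj B u else \<zero>\<^bsub>B\<^esub>)"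

definition lift_fun ::
  "('a, 'i) ring_scheme \<Rightarrow> ('b, 'j) ring_scheme \<Rightarrow> ('a list \<Rightarrow> 'b) \<Rightarrow> 'a ambient list \<Rightarrow> 'b ambient" where
  "lift_fun A B f us = emb B (f (map (prj A) us))"

text \<open>Only the projection of F is prescribed. The relation survives sums, signs,
  \<open>ce\<close> and \<open>wedge\<close>, and an identity between representing functions still
  forces one between cochains, so no canonical choice of F has to be maintained.\<close>

definition represents ::
  "('a, 'i) ring_scheme \<Rightarrow> ('b, 'j) ring_scheme \<Rightarrow> nat \<Rightarrow> ('a list \<Rightarrow> 'b) \<Rightarrow> ('a ambient list \<Rightarrow> 'b ambient) \<Rightarrow> bool" where
  "represents A B n f F \<longleftrightarrow> (\<forall>us. length us = n \<longrightarrow> prj B (F us) = f (map (prj A) us))"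

lemma lift2_bilinear:
  assumes "module R A" "module R B" "module R C" "bilinear_map R A B C h"
  shows "prj C (lift2 A B C h u v) = h (prj A u) (prj B v)"
    "lift2 A B C h (u + u') v = lift2 A B C h u v + lift2 A B C h u' v"
    "lift2 A B C h u (v + v') = lift2 A B C h u v + lift2 A B C h u v'"
    "lift2 A B C h (lift_scalar R A s u) v = lift_scalar R C s (lift2 A B C h u v)"
    "lift2 A B C h u (lift_scalar R B s v) = lift_scalar R C s (lift2 A B C h u v)"
proof -
  interpret A: abelian_group A by (rule abelian_group_of_module[OF assms(1)])
  interpret B: abelian_group B by (rule abelian_group_of_module[OF assms(2)])
  interpret C: abelian_group C by (rule abelian_group_of_module[OF assms(3)])
  note h = bilinear_mapD[OF assms(4) A.prj_closed B.prj_closed]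
  have h0: "h \<zero>\<^bsub>A\<^esub> (prj B v) = \<zero>\<^bsub>C\<^esub>" "h (prj A u) \<zero>\<^bsub>B\<^esub> = \<zero>\<^bsub>C\<^esub>"
    using linear_map_group_hom(1)[OF assms(1,3), of "\<lambda>x. h x (prj B v)"]
      linear_map_group_hom(1)[OF assms(2,3), of "h (prj A u)"] assms(4)
    by (auto simp: bilinear_map_def)
  have sA: "s \<odot>\<^bsub>A\<^esub> prj A u \<in> carrier A" and sB: "s \<odot>\<^bsub>B\<^esub> prj B v \<in> carrier B" if "s \<in> carrier R"
    using that by (auto intro!: module.smult_closed assms)
  show p: "prj C (lift2 A B C h u v) = h (prj A u) (prj B v)" by (simp add: lift2_def h)
  show "lift2 A B C h (u + u') v = lift2 A B C h u v + lift2 A B C h u' v"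
    "lift2 A B C h u (v + v') = lift2 A B C h u v + lift2 A B C h u v'"
    by (simp_all add: lift2_def A.prj_add B.prj_add h C.emb_add[symmetric])
  show "lift2 A B C h (lift_scalar R A s u) v = lift_scalar R C s (lift2 A B C h u v)"
    "lift2 A B C h u (lift_scalar R B s v) = lift_scalar R C s (lift2 A B C h u v)"
    by (simp_all add: lift_scalar_def p) (simp_all add: lift2_def h h0 sA sB)
qed

lemma lift_scalar_simps:
  assumes "module R B"
  shows "prj B (lift_scalar R B s u) = (if s \<in> carrier R then s \<odot>\<^bsub>B\<^esub> prj B u else \<zero>\<^bsub>B\<^esub>)"
    "lift_scalar R B s (u + v) = lift_scalar R B s u + lift_scalar R B s v"
proof -
  interpret B: module R B by (rule assms)
  show "prj B (lift_scalar R B s u) = (if s \<in> carrier R then s \<odot>\<^bsub>B\<^esub> prj B u else \<zero>\<^bsub>B\<^esub>)"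
    by (simp add: lift_scalar_def)
  show "lift_scalar R B s (u + v) = lift_scalar R B s u + lift_scalar R B s v"
    by (auto simp: lift_scalar_def B.emb_zero B.prj_add B.smult_r_distr B.emb_add)
qed

lemma lift_calculus_jacobi:
  assumes "lie_algebra R A br"
  defines "b \<equiv> lift2 A A A br"
  shows "b u u = 0" "b u (b v w) + b v (b w u) + b w (b u v) = 0"
proof -
  interpret A: lie_algebra R A br by (rule assms)
  note br = bilinear_mapD[OF A.br_bilinear]
  show "b u u = 0" by (simp add: b_def lift2_def A.br_self A.M.emb_zero)
  show "b u (b v w) + b v (b w u) + b w (b u v) = 0"
    by (simp add: b_def lift2_def br A.M.emb_add[symmetric] A.jacobi A.M.emb_zero)
qed

text \<open>\<open>prj\<close> always lands in the carrier and \<open>emb\<close> is additive there,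
  so each axiom is the image under \<open>emb\<close> of the corresponding identity in A or
  B.\<close>

lemma lift_alt_calculus:
  assumes "lie_module R A br B act"
  shows "alt_calculus (lift2 A A A br) (lift2 A B B act) (lift_scalar R A) (lift_scalar R B)"
proof -
  interpret lie_module R A br B act by (rule assms)
  have mA: "module R A" and mB: "module R B" by unfold_locales
  note [simp] = bilinear_mapD[OF br_bilinear] bilinear_mapD[OF act_bilinear]
  note b = lift2_bilinear[OF mA mA mA br_bilinear] lift2_bilinear[OF mA mB mB act_bilinear]
  show ?thesis
  proof
    show "lift2 A B B act (lift2 A A A br x y) m =
        lift2 A B B act x (lift2 A B B act y m) - lift2 A B B act y (lift2 A B B act x m)" for x y m
      by (simp add: lift2_def act_bracket B.M.emb_diff)
    show "lift2 A A A br x x = 0" "lift2 A A A br x (lift2 A A A br y z) +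
       lift2 A A A br y (lift2 A A A br z x) + lift2 A A A br z (lift2 A A A br x y) = 0" for x y z
      using lift_calculus_jacobi[of R A br] lie_algebra_axioms by auto
  qed (simp_all add: b lift_scalar_simps[OF mB])
qed

text \<open>The situation at a single subgroup; the theorem uses two instances, at C_p and at
  e.\<close>

locale lie_coefficients = lie_module R A br B act
  for R :: "('r, 'n) ring_scheme" and A :: "('r, 'a, 'k) module_scheme"
    and br :: "'a \<Rightarrow> 'a \<Rightarrow> 'a" and B :: "('r, 'b, 'l) module_scheme"
    and act :: "'a \<Rightarrow> 'b \<Rightarrow> 'b" +
  fixes brB :: "'b \<Rightarrow> 'b \<Rightarrow> 'b"
  assumes lie_B: "lie_algebra R B brB"
    and derivations: "acts_by_derivations A B brB act"

lemma lift_lie_alt_calculus: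
  assumes "lie_coefficients R A br B act brB"
  shows "lie_alt_calculus (lift2 A A A br) (lift2 A B B act) (lift_scalar R A) (lift_scalar R B) (lift2 B B B brB)"
proof -
  interpret lie_coefficients R A br B act brB by (rule assms)
  have mA: "module R A" and mB: "module R B" by unfold_locales
  interpret alt_calculus "lift2 A A A br" "lift2 A B B act" "lift_scalar R A" "lift_scalar R B"
    by (rule lift_alt_calculus) unfold_locales
  note bb = lie_algebra.br_bilinear[OF lie_B]
  note [simp] = bilinear_mapD[OF act_bilinear] bilinear_mapD[OF bb]
  show ?thesis
  proof
    show "lift2 B B B brB x x = 0" "lift2 B B B brB x (lift2 B B B brB y z) +
       lift2 B B B brB y (lift2 B B B brB z x) + lift2 B B B brB z (lift2 B B B brB x y) = 0" for x y z
      using lift_calculus_jacobi[OF lie_B] by auto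
    show "lift2 A B B act x (lift2 B B B brB m n) =
       lift2 B B B brB (lift2 A B B act x m) n + lift2 B B B brB m (lift2 A B B act x n)" for x m n
      using derivations by (simp add: lift2_def acts_by_derivations_def B.M.emb_add)
  qed (simp_all add: lift2_bilinear[OF mB mB mB bb])
qed

context alt_calculus begin

lemma alt_form_alternating:
  assumes "alt_form (length us) f" "i < j" "j < length us" "us ! i = us ! j"
  shows "f us = 0"
  using assms
proof (induction us arbitrary: f i j)
  case (Cons u us)
  obtain k where j: "j = Suc k" using Cons.prems by (cases j) auto
  show ?case
  proof (cases i)
    case (Suc l)
    then show ?thesis using Cons.IH[of "\<lambda>zs. f (u # zs)" l k] Cons.prems j by simp
  next
    case 0
    then have k: "k < length us" "us ! k = u" using Cons.prems j by auto
    then obtain n where n: "length us = Suc n" by (cases us) auto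
    \<comment> \<open>The update changes nothing, as position k already holds u; it serves to bring
      the repeated entry next to the first one at the cost of a sign.\<close>
    have "f (u # us[k := u]) = alt_sign k (f (u # u # nths us (- {k})))"
      using Cons.prems(1) k by (intro alt_form_update) auto
    also have "f (u # u # nths us (- {k})) = 0"
      using Cons.prems(1) k n by (intro alt_formD(4)[of "length us"]) (auto simp: length_nths_remove)
    finally show ?thesis using k(2) by (metis alt_sign_simps(4) list_update_id)
  qed
qed simp

lemma alt_form_multilinear:
  assumes "alt_form (length us) f" "i < length us"
  shows "f (us[i := x + y]) = f (us[i := x]) + f (us[i := y])"
    "f (us[i := scA s x]) = scB s (f (us[i := x]))"
proof -
  obtain n where n: "length us = Suc n" using assms by (cases us) auto
  have l: "length (nths us (- {i})) = n" using assms n by (simp add: length_nths_remove)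
  note a = assms(1)[unfolded n]
  show "f (us[i := x + y]) = f (us[i := x]) + f (us[i := y])"
    using alt_formD(2)[OF a l] by (simp add: alt_form_update[OF assms] alt_sign_add)
  show "f (us[i := scA s x]) = scB s (f (us[i := x]))"
    using alt_formD(3)[OF a l] by (simp add: alt_form_update[OF assms] alt_sign_def scB_neg)
qed

lemma alt_formI:
  assumes "\<And>us i x y. length us = n \<Longrightarrow> i < n \<Longrightarrow> f (us[i := x + y]) = f (us[i := x]) + f (us[i := y])"
    and "\<And>us i s x. length us = n \<Longrightarrow> i < n \<Longrightarrow> f (us[i := scA s x]) = scB s (f (us[i := x]))"
    and "\<And>us i j. length us = n \<Longrightarrow> i < j \<Longrightarrow> j < n \<Longrightarrow> us ! i = us ! j \<Longrightarrow> f us = 0"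
  shows "alt_form n f"
  using assms
proof (induction n arbitrary: f)
  case (Suc n)
  show ?case
    unfolding alt_form.simps
  proof (intro conjI allI impI)
    fix x
    show "alt_form n (\<lambda>zs. f (x # zs))"
    proof (rule Suc.IH)
      show "f (x # us[i := u + v]) = f (x # us[i := u]) + f (x # us[i := v])" if "length us = n" "i < n" for us i u v
        using Suc.prems(1)[of "x # us" "Suc i" u v] that by simp
      show "f (x # us[i := scA s u]) = scB s (f (x # us[i := u]))" if "length us = n" "i < n" for us i s u
        using Suc.prems(2)[of "x # us" "Suc i" s u] that by simp
      show "f (x # us) = 0" if "length us = n" "i < j" "j < n" "us ! i = us ! j" for us i j
        using Suc.prems(3)[of "x # us" "Suc i" "Suc j"] that by simp
    qed
  next
    show "f ((x + y) # zs) = f (x # zs) + f (y # zs)" if "length zs = n" for x y zs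
      using Suc.prems(1)[of "x # zs" 0 x y] that by simp
    show "f (scA s x # zs) = scB s (f (x # zs))" if "length zs = n" for s x zs
      using Suc.prems(2)[of "x # zs" 0 s x] that by simp
    show "f (x # x # zs) = 0" if "Suc (length zs) = n" for x zs
      using Suc.prems(3)[of "x # x # zs" 0 1] that by simp
  qed
qed simp

end

lemma tuples_prj: "abelian_group A \<Longrightarrow> map (prj A) us \<in> tuples A (length us)"
  by (auto simp: tuples_def abelian_group.prj_closed)

lemma map_prj_emb: "abelian_group A \<Longrightarrow> xs \<in> tuples A n \<Longrightarrow> map (prj A) (map (emb A) xs) = xs"
  by (auto simp: tuples_def abelian_group.prj_emb intro!: map_idI)

lemma tuples_update: "xs \<in> tuples A n \<Longrightarrow> x \<in> carrier A \<Longrightarrow> xs[i := x] \<in> tuples A n"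
  using set_update_subset_insert[of xs i x] by (auto simp: tuples_def)

lemma tuples_length: "xs \<in> tuples A n \<Longrightarrow> length xs = n"
  by (simp add: tuples_def)

lemma tuples_Cons: "x # xs \<in> tuples A n \<longleftrightarrow> (\<exists>m. n = Suc m \<and> x \<in> carrier A \<and> xs \<in> tuples A m)"
  by (cases n) (auto simp: tuples_def)

lemma tuples_nth: "xs \<in> tuples A n \<Longrightarrow> i < n \<Longrightarrow> xs ! i \<in> carrier A"
  by (auto simp: tuples_def)

lemma represents_apply:
  assumes "represents A B n f F" "abelian_group A" "xs \<in> tuples A n"
  shows "prj B (F (map (emb A) xs)) = f xs"
proof -
  have "prj B (F (map (emb A) xs)) = f (map (prj A) (map (emb A) xs))"
    using assms(1) tuples_length[OF assms(3)] unfolding represents_def by simp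
  then show ?thesis unfolding map_prj_emb[OF assms(2,3)] .
qed

text \<open>Every tuple over the carrier is the projection of its embedding, so testing on embedded
  tuples suffices. This is how identities of the calculus become identities of cochains.\<close>

lemma represents_eqI:
  assumes "abelian_group A" "f \<in> extensional (tuples A n)" "f' \<in> extensional (tuples A n)"
    "represents A B n f F" "represents A B n f' F'" "\<And>us. length us = n \<Longrightarrow> F us = F' us"
  shows "f = f'"
proof (rule extensionalityI[OF assms(2,3)])
  fix xs assume xs: "xs \<in> tuples A n"
  show "f xs = f' xs"
    using xs represents_apply[OF assms(4,1) xs] represents_apply[OF assms(5,1) xs] assms(6)[of "map (emb A) xs"]
    by (simp add: tuples_length)
qed

lemma represents_lift_fun:
  assumes "abelian_group A" "abelian_group B" "f \<in> tuples A n \<rightarrow> carrier B"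
  shows "represents A B n f (lift_fun A B f)"
proof -
  have "f (map (prj A) us) \<in> carrier B" if "length us = n" for us
    using assms(3) tuples_prj[OF assms(1), of us] that by auto
  then show ?thesis
    by (simp add: represents_def lift_fun_def abelian_group.prj_emb[OF assms(2)])
qed

section \<open>Modules of cochains and their differential\<close>

context lie_module begin

sublocale calc: alt_calculus "lift2 A A A br" "lift2 A B B act" "lift_scalar R A" "lift_scalar R B"
  by (rule lift_alt_calculus) unfold_locales

abbreviation Alt where "Alt n \<equiv> alt_maps R A B n"

lemma module_A: "module R A" and module_B: "module R B"
  by unfold_locales

lemmas agA = abelian_group_of_module[OF module_A]
lemmas agB = abelian_group_of_module[OF module_B]

lemma alt_mapsD:
  assumes "f \<in> carrier (Alt n)"
  shows "f \<in> tuples A n \<rightarrow>\<^sub>E carrier B" "f \<in> extensional (tuples A n)" "f \<in> tuples A n \<rightarrow> carrier B"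
    "multilinear R A B n f" "alternating A B n f"
  using assms by (auto simp: alt_maps_def PiE_def)

lemma represents_Alt: "f \<in> carrier (Alt n) \<Longrightarrow> represents A B n f (lift_fun A B f)"
  by (rule represents_lift_fun[OF agA agB alt_mapsD(3)])

lemma alt_form_lift_fun:
  assumes "f \<in> carrier (Alt n)"
  shows "calc.alt_form n (lift_fun A B f)"
proof (rule calc.alt_formI)
  note f = alt_mapsD[OF assms]
  fix us :: "'a ambient list" and i assume l: "length us = n"
  have t: "map (prj A) us \<in> tuples A n" using tuples_prj[OF agA, of us] l by simp
  {
    assume i: "i < n"
    note lin = linear_mapD[OF f(4)[unfolded multilinear_def, rule_format, OF t i]]
    show "lift_fun A B f (us[i := x + y]) = lift_fun A B f (us[i := x]) + lift_fun A B f (us[i := y])" for x y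
      by (simp add: lift_fun_def map_update abelian_group.prj_add[OF agA] lin B.M.emb_add)
    have "f ((map (prj A) us)[i := \<zero>\<^bsub>A\<^esub>]) = \<zero>\<^bsub>B\<^esub>"
      using linear_map_group_hom(1)[OF module_A module_B f(4)[unfolded multilinear_def, rule_format, OF t i]] .
    then show "lift_fun A B f (us[i := lift_scalar R A s x]) = lift_scalar R B s (lift_fun A B f (us[i := x]))" for s x
      by (simp add: lift_fun_def map_update lift_scalar_simps[OF module_A] lin lift_scalar_def)
  }
  fix j assume "i < j" "j < n" "us ! i = us ! j"
  then have "f (map (prj A) us) = \<zero>\<^bsub>B\<^esub>"
    using f(5)[unfolded alternating_def, rule_format, OF t, of i j] l by simp
  then show "lift_fun A B f us = 0" by (simp add: lift_fun_def B.M.emb_zero)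
qed

text \<open>Converse to \<open>alt_form_lift_fun\<close>: an alternating representative makes an
  extensional function a cochain. Closure of the cochain modules under each operation is reduced in
  this way to closure of \<open>alt_form\<close>.\<close>

lemma Alt_I:
  assumes "f \<in> extensional (tuples A n)" "represents A B n f F" "calc.alt_form n F"
  shows "f \<in> carrier (Alt n)"
proof -
  have f: "f xs = prj B (F (map (emb A) xs))" if "xs \<in> tuples A n" for xs
    by (rule represents_apply[OF assms(2) agA that, symmetric])
  have "f \<in> tuples A n \<rightarrow> carrier B" by (auto simp: f)
  moreover have "multilinear R A B n f"
    unfolding multilinear_def
  proof (intro ballI allI impI)
    fix xs i assume xs: "xs \<in> tuples A n" and i: "i < n"
    let ?us = "map (emb A) xs"
    have u: "f (xs[i := y]) = prj B (F (?us[i := emb A y]))" if "y \<in> carrier A" for y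
      using f[OF tuples_update[OF xs that]] by (simp add: map_update)
    have l: "length ?us = n" using xs by (simp add: tuples_length)
    note ml = calc.alt_form_multilinear[of ?us F i, unfolded l, OF assms(3) i]
    have sc: "f (xs[i := s \<odot>\<^bsub>A\<^esub> y]) = s \<odot>\<^bsub>B\<^esub> f (xs[i := y])" if "s \<in> carrier R" "y \<in> carrier A" for s y
    proof -
      have "emb A (s \<odot>\<^bsub>A\<^esub> y) = lift_scalar R A s (emb A y)"
        using that by (simp add: lift_scalar_def)
      then show ?thesis using that by (simp add: u ml(2) lift_scalar_simps[OF module_B])
    qed
    show "linear_map R A B (\<lambda>y. f (xs[i := y]))"
      by (rule linear_mapI) (simp_all add: sc, simp_all add: u abelian_group.emb_add[OF agA] ml(1) B.M.prj_add)
  qed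
  moreover have "alternating A B n f"
    unfolding alternating_def
  proof (intro ballI allI impI)
    fix xs i j assume xs: "xs \<in> tuples A n" and ij: "i < j \<and> j < n \<and> xs ! i = xs ! j"
    then have "F (map (emb A) xs) = 0"
      using assms(3) by (intro calc.alt_form_alternating[of _ _ i j]) (auto simp: tuples_length)
    then show "f xs = \<zero>\<^bsub>B\<^esub>" using xs by (simp add: f B.M.prj_zero)
  qed
  ultimately show ?thesis using assms(1) by (auto simp: alt_maps_def PiE_def)
qed

lemma Alt_eqI:
  assumes "f \<in> extensional (tuples A n)" "f' \<in> extensional (tuples A n)"
    "represents A B n f F" "represents A B n f' F'" "\<And>us. length us = n \<Longrightarrow> F us = F' us"
  shows "f = f'"
  by (rule represents_eqI[OF agA assms])

lemma represents_zero: "represents A B n \<zero>\<^bsub>Alt n\<^esub> (\<lambda>us. 0)"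
  and represents_add: "represents A B n f F \<Longrightarrow> represents A B n f' F' \<Longrightarrow>
    represents A B n (f \<oplus>\<^bsub>Alt n\<^esub> f') (\<lambda>us. F us + F' us)"
  and represents_smult: "represents A B n f F \<Longrightarrow> s \<in> carrier R \<Longrightarrow>
    represents A B n (s \<odot>\<^bsub>Alt n\<^esub> f) (\<lambda>us. lift_scalar R B s (F us))"
  using tuples_prj[OF agA]
  by (auto simp: represents_def alt_maps_def B.M.prj_zero B.M.prj_add lift_scalar_simps[OF module_B])

lemma extensional_Alt_ops:
  "\<zero>\<^bsub>Alt n\<^esub> \<in> extensional (tuples A n)" "f \<oplus>\<^bsub>Alt n\<^esub> f' \<in> extensional (tuples A n)"
  "s \<odot>\<^bsub>Alt n\<^esub> f \<in> extensional (tuples A n)"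
  by (auto simp: alt_maps_def)

text \<open>Homogeneity of s F needs s to commute with every other scalar, so the commutativity of R
  enters here; a scalar outside the carrier gives 0 on both sides.\<close>

lemma alt_form_scalar: "calc.alt_form n F \<Longrightarrow> s \<in> carrier R \<Longrightarrow> calc.alt_form n (\<lambda>us. lift_scalar R B s (F us))"
proof (induction n arbitrary: F)
  case (Suc n)
  have "lift_scalar R B s (lift_scalar R B s' m) = lift_scalar R B s' (lift_scalar R B s m)" for s' m
  proof (cases "s' \<in> carrier R")
    case True
    then show ?thesis
      using Suc.prems(2) by (simp add: lift_scalar_def B.smult_assoc1[symmetric] R.m_comm)
  qed (use Suc.prems(2) in \<open>simp add: lift_scalar_def\<close>)
  with Suc show ?case by (auto simp: calc.scB_add)
qed simp

lemma Alt_module: "module R (Alt n)"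
proof -
  have c: "f \<oplus>\<^bsub>Alt n\<^esub> f' \<in> carrier (Alt n)" if "f \<in> carrier (Alt n)" "f' \<in> carrier (Alt n)" for f f'
    by (rule Alt_I[OF extensional_Alt_ops(2) represents_add[OF represents_Alt represents_Alt]])
      (auto intro: that calc.alt_form_add alt_form_lift_fun)
  have z: "\<zero>\<^bsub>Alt n\<^esub> \<in> carrier (Alt n)"
    by (rule Alt_I[OF extensional_Alt_ops(1) represents_zero calc.alt_form_zero])
  have s: "s \<odot>\<^bsub>Alt n\<^esub> f \<in> carrier (Alt n)" if "s \<in> carrier R" "f \<in> carrier (Alt n)" for s f
    by (rule Alt_I[OF extensional_Alt_ops(3) represents_smult[OF represents_Alt]])
      (auto intro: that alt_form_scalar alt_form_lift_fun)
  have v: "f xs \<in> carrier B" if "f \<in> carrier (Alt n)" "xs \<in> tuples A n" for f xs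
    using alt_mapsD(3)[OF that(1)] that(2) by auto
  have e: "f = f'" if "f \<in> carrier (Alt n)" "f' \<in> carrier (Alt n)" "\<And>xs. xs \<in> tuples A n \<Longrightarrow> f xs = f' xs" for f f'
    by (rule extensionalityI[OF alt_mapsD(2)[OF that(1)] alt_mapsD(2)[OF that(2)] that(3)])
  have add: "(f \<oplus>\<^bsub>Alt n\<^esub> f') xs = f xs \<oplus>\<^bsub>B\<^esub> f' xs" and zero: "\<zero>\<^bsub>Alt n\<^esub> xs = \<zero>\<^bsub>B\<^esub>"
    and smult: "(s \<odot>\<^bsub>Alt n\<^esub> f) xs = s \<odot>\<^bsub>B\<^esub> f xs" if "xs \<in> tuples A n" for f f' s xs
    using that by (auto simp: alt_maps_def)
  show ?thesis
  proof (rule moduleI)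
    show "cring R" by (rule R.is_cring)
    show "abelian_group (Alt n)"
    proof (rule abelian_groupI)
      fix f assume f: "f \<in> carrier (Alt n)"
      show "\<exists>f'\<in>carrier (Alt n). f' \<oplus>\<^bsub>Alt n\<^esub> f = \<zero>\<^bsub>Alt n\<^esub>"
      proof
        \<comment> \<open>The additive inverse is produced as the multiple by -1, for which closure
          is already known.\<close>
        show m: "(\<ominus>\<^bsub>R\<^esub> \<one>\<^bsub>R\<^esub>) \<odot>\<^bsub>Alt n\<^esub> f \<in> carrier (Alt n)" using s f by simp
        show "(\<ominus>\<^bsub>R\<^esub> \<one>\<^bsub>R\<^esub>) \<odot>\<^bsub>Alt n\<^esub> f \<oplus>\<^bsub>Alt n\<^esub> f = \<zero>\<^bsub>Alt n\<^esub>"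
          by (rule e) (auto simp: add zero smult c z m f v B.smult_l_minus B.M.l_neg)
      qed
    qed (auto intro!: e simp: add zero smult c z s v B.M.a_ac)
  qed (auto intro!: e simp: add zero smult c z s v B.smult_l_distr B.smult_r_distr B.smult_assoc1)
qed

lemma represents_uminus:
  assumes "represents A B n f F" "f \<in> carrier (Alt n)"
  shows "represents A B n (\<ominus>\<^bsub>Alt n\<^esub> f) (\<lambda>us. - F us)"
proof -
  interpret Alt: module R "Alt n" by (rule Alt_module)
  have "\<ominus>\<^bsub>Alt n\<^esub> f = (\<ominus>\<^bsub>R\<^esub> \<one>\<^bsub>R\<^esub>) \<odot>\<^bsub>Alt n\<^esub> f"
    using assms(2) by (simp add: Alt.smult_l_minus)
  then show ?thesis
    using represents_smult[OF assms(1), of "\<ominus>\<^bsub>R\<^esub> \<one>\<^bsub>R\<^esub>"]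
    by (simp add: represents_def lift_scalar_simps[OF module_B] B.smult_l_minus B.M.prj_uminus)
qed

lemma represents_alt_sign:
  assumes "represents A B n f F" "f \<in> carrier (Alt n)"
  shows "represents A B n (add_pow (Alt n) ((-1::int) ^ k) f) (\<lambda>us. alt_sign k (F us))"
proof -
  interpret Alt: module R "Alt n" by (rule Alt_module)
  show ?thesis
    using represents_uminus[OF assms] assms
    by (cases "even k") (simp_all add: alt_sign_def Alt.M.add_pow_one Alt.M.add_pow_neg_one)
qed

abbreviation CE where "CE \<equiv> ce_diff A br B act"

lemma CE_extensional: "CE n f \<in> extensional (tuples A (Suc n))"
  by (simp add: ce_diff_def)

text \<open>The recursive differential meets the explicit one: \<open>D_eq_sum\<close> is projected
  summand by summand, \<open>prj\<close> being additive and compatible with bracket, action and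
  signs.\<close>

lemma represents_CE:
  assumes "calc.alt_form n F" "represents A B n f F"
  shows "represents A B (Suc n) (CE n f) (calc.D F)"
  unfolding represents_def
proof (intro allI impI)
  fix us :: "'a ambient list" assume l: "length us = Suc n"
  let ?xs = "map (prj A) us"
  have t: "?xs \<in> tuples A (Suc n)" using tuples_prj[OF agA, of us] l by simp
  have p: "prj B (F zs) = f (map (prj A) zs)" if "length zs = n" for zs
    using assms(2) that by (simp add: represents_def)
  note pb = lift2_bilinear(1)[OF module_A module_A module_A br_bilinear]
    lift2_bilinear(1)[OF module_A module_B module_B act_bilinear]
  have 1: "prj B (\<Sum>i\<le>n. alt_sign i (lift2 A B B act (us ! i) (F (nths us (- {i}))))) =
    (\<Oplus>\<^bsub>B\<^esub>i\<in>{..n}. add_pow B ((-1::int) ^ i) (act (?xs ! i) (f (nths ?xs (- {i})))))"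
  proof (rule B.M.prj_sum_eq)
    fix i assume "i \<in> {..n}"
    then have i: "i < length us" using l by simp
    then have "prj B (F (nths us (- {i}))) = f (nths ?xs (- {i}))"
      by (subst p) (auto simp: length_nths_remove l nths_map)
    then show "prj B (alt_sign i (lift2 A B B act (us ! i) (F (nths us (- {i}))))) =
        add_pow B ((-1::int) ^ i) (act (?xs ! i) (f (nths ?xs (- {i}))))"
      using i by (simp add: B.M.prj_alt_sign pb)
  qed simp
  have 2: "prj B (\<Sum>(i, j)\<in>{(i, j). i < j \<and> j \<le> n}.
      alt_sign (i + j) (F (lift2 A A A br (us ! i) (us ! j) # nths us (- {i, j})))) =
    finsum B (\<lambda>(i, j). add_pow B ((-1::int) ^ (i + j)) (f (br (?xs ! i) (?xs ! j) # nths ?xs (- {i, j}))))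
      {(i, j). i < j \<and> j \<le> n}"
  proof (rule B.M.prj_sum_eq[OF finite_ordered_pairs], clarify)
    fix i j assume ij: "i < j" "j \<le> n"
    then have "prj B (F (lift2 A A A br (us ! i) (us ! j) # nths us (- {i, j}))) =
        f (br (?xs ! i) (?xs ! j) # nths ?xs (- {i, j}))"
      using l by (subst p) (auto simp: length_nths_remove2 nths_map pb)
    then show "prj B (alt_sign (i + j) (F (lift2 A A A br (us ! i) (us ! j) # nths us (- {i, j})))) =
        add_pow B ((-1::int) ^ (i + j)) (f (br (?xs ! i) (?xs ! j) # nths ?xs (- {i, j})))"
      by (simp add: B.M.prj_alt_sign)
  qed
  show "prj B (calc.D F us) = CE n f ?xs"
    unfolding calc.D_eq_sum[OF assms(1) l] B.M.prj_add 1 2 using t by (simp add: ce_diff_def)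
qed

end

text \<open>A differential graded Lie algebra whose components stay in separate modules C n.
  Cochains at e and compatible pairs at C_p are both instances, so the descent to cohomology is done
  once.\<close>

locale dg_lie =
  fixes R :: "('r, 'n) ring_scheme" and C :: "nat \<Rightarrow> ('r, 'c) module"
    and d :: "nat \<Rightarrow> 'c \<Rightarrow> 'c" and P :: "nat \<Rightarrow> nat \<Rightarrow> 'c \<Rightarrow> 'c \<Rightarrow> 'c"
  assumes module_C: "module R (C n)"
    and d_linear: "linear_map R (C n) (C (Suc n)) (d n)"
    and d_d: "f \<in> carrier (C n) \<Longrightarrow> d (Suc n) (d n f) = \<zero>\<^bsub>C (Suc (Suc n))\<^esub>"
    and P_bilinear: "bilinear_map R (C m) (C n) (C (m + n)) (P m n)"
    and P_leibniz: "\<lbrakk>f \<in> carrier (C m); k \<in> carrier (C n)\<rbrakk> \<Longrightarrow>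
      d (m + n) (P m n f k) = P (Suc m) n (d m f) k \<oplus>\<^bsub>C (Suc (m + n))\<^esub>
        add_pow (C (Suc (m + n))) ((-1::int) ^ m) (P m (Suc n) f (d n k))"
    and P_antisym: "\<lbrakk>f \<in> carrier (C m); k \<in> carrier (C n)\<rbrakk> \<Longrightarrow>
      P m n f k = \<ominus>\<^bsub>C (m + n)\<^esub> (add_pow (C (m + n)) ((-1::int) ^ (m * n)) (P n m k f))"
    and P_jacobi: "\<lbrakk>f \<in> carrier (C i); k \<in> carrier (C j); l \<in> carrier (C n)\<rbrakk> \<Longrightarrow>
      P i (j + n) f (P j n k l) = P (i + j) n (P i j f k) l \<oplus>\<^bsub>C (i + j + n)\<^esub>
        add_pow (C (i + j + n)) ((-1::int) ^ (i * j)) (P j (i + n) k (P i n f l))"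
    and P_even: "\<lbrakk>even i; f \<in> carrier (C i)\<rbrakk> \<Longrightarrow> P i i f f = \<zero>\<^bsub>C (i + i)\<^esub>"
    and P_odd: "\<lbrakk>odd i; f \<in> carrier (C i)\<rbrakk> \<Longrightarrow> P i (i + i) f (P i i f f) = \<zero>\<^bsub>C (i + (i + i))\<^esub>"

context lie_module begin

lemma CE_closed: "f \<in> carrier (Alt n) \<Longrightarrow> CE n f \<in> carrier (Alt (Suc n))"
  by (rule Alt_I[OF CE_extensional represents_CE[OF alt_form_lift_fun represents_Alt] calc.alt_form_D[OF alt_form_lift_fun]])

lemma Alt_add_closed: "f \<in> carrier (Alt n) \<Longrightarrow> f' \<in> carrier (Alt n) \<Longrightarrow> f \<oplus>\<^bsub>Alt n\<^esub> f' \<in> carrier (Alt n)"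
  and Alt_smult_closed: "f \<in> carrier (Alt n) \<Longrightarrow> s \<in> carrier R \<Longrightarrow> s \<odot>\<^bsub>Alt n\<^esub> f \<in> carrier (Alt n)"
proof -
  interpret Alt: module R "Alt n" by (rule Alt_module)
  show "f \<in> carrier (Alt n) \<Longrightarrow> f' \<in> carrier (Alt n) \<Longrightarrow> f \<oplus>\<^bsub>Alt n\<^esub> f' \<in> carrier (Alt n)" by simp
  show "f \<in> carrier (Alt n) \<Longrightarrow> s \<in> carrier R \<Longrightarrow> s \<odot>\<^bsub>Alt n\<^esub> f \<in> carrier (Alt n)" by simp
qed

text \<open>The pattern of the cochain identities that follow: both sides are extensional and
  represented by explicit functions, \<open>Alt_eqI\<close> compares the representatives, and the
  last rule is the identity of the calculus.\<close>

lemma CE_linear: "linear_map R (Alt n) (Alt (Suc n)) (CE n)"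
proof (rule linear_mapI)
  fix f assume f: "f \<in> carrier (Alt n)"
  show "CE n f \<in> carrier (Alt (Suc n))" by (rule CE_closed[OF f])
  note rf = represents_Alt[OF f] and af = alt_form_lift_fun[OF f]
  {
    fix f' assume f': "f' \<in> carrier (Alt n)"
    note rf' = represents_Alt[OF f'] and af' = alt_form_lift_fun[OF f']
    show "CE n (f \<oplus>\<^bsub>Alt n\<^esub> f') = CE n f \<oplus>\<^bsub>Alt (Suc n)\<^esub> CE n f'"
      by (rule Alt_eqI[OF CE_extensional extensional_Alt_ops(2)
          represents_CE[OF calc.alt_form_add[OF af af'] represents_add[OF rf rf']]
          represents_add[OF represents_CE[OF af rf] represents_CE[OF af' rf']]])
        (rule calc.D_add)
  }
  fix s assume s: "s \<in> carrier R"
  show "CE n (s \<odot>\<^bsub>Alt n\<^esub> f) = s \<odot>\<^bsub>Alt (Suc n)\<^esub> CE n f"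
    by (rule Alt_eqI[OF CE_extensional extensional_Alt_ops(3)
        represents_CE[OF alt_form_scalar[OF af s] represents_smult[OF rf s]]
        represents_smult[OF represents_CE[OF af rf] s]])
      (rule calc.D_scB)
qed

lemma CE_CE:
  assumes "f \<in> carrier (Alt n)"
  shows "CE (Suc n) (CE n f) = \<zero>\<^bsub>Alt (Suc (Suc n))\<^esub>"
proof -
  note rf = represents_Alt[OF assms] and af = alt_form_lift_fun[OF assms]
  show ?thesis
    by (rule Alt_eqI[OF CE_extensional extensional_Alt_ops(1)
        represents_CE[OF calc.alt_form_D[OF af] represents_CE[OF af rf]] represents_zero])
      (rule calc.D_D[OF af])
qed

end

context lie_coefficients begin

sublocale lcalc: lie_alt_calculus "lift2 A A A br" "lift2 A B B act" "lift_scalar R A" "lift_scalar R B" "lift2 B B B brB"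
  by (rule lift_lie_alt_calculus) unfold_locales

abbreviation CUP where "CUP \<equiv> cup A B brB"

lemma CUP_extensional: "CUP m n f k \<in> extensional (tuples A (m + n))"
  by (simp add: cup_def)

text \<open>Counterpart of \<open>represents_CE\<close>: \<open>wedge_eq_sum\<close> is projected
  shuffle by shuffle. A shuffle keeps positions within the list, so projecting commutes with
  selecting entries.\<close>

lemma represents_CUP:
  assumes "represents A B m f F" "represents A B n k K"
  shows "represents A B (m + n) (CUP m n f k) (lcalc.W m F K)"
  unfolding represents_def
proof (intro allI impI)
  fix us :: "'a ambient list" assume l: "length us = m + n"
  let ?xs = "map (prj A) us"
  have t: "?xs \<in> tuples A (m + n)" using tuples_prj[OF agA, of us] l by simp
  have "prj B (lcalc.W m F K us) = (\<Oplus>\<^bsub>B\<^esub>\<sigma>\<in>shuffle_perms m n. add_pow B (sign \<sigma>)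
          (brB (f (map (\<lambda>i. ?xs ! \<sigma> i) [0..<m])) (k (map (\<lambda>i. ?xs ! \<sigma> i) [m..<m + n]))))"
    unfolding lcalc.wedge_eq_sum[OF l]
  proof (rule B.M.prj_sum_eq[OF finite_shuffle_perms])
    fix \<sigma> assume "\<sigma> \<in> shuffle_perms m n"
    then have p: "\<sigma> permutes {..<m + n}" by (simp add: shuffle_perms_def)
    have s: "map (prj A) (map (\<lambda>i. us ! \<sigma> i) is) = map (\<lambda>i. ?xs ! \<sigma> i) is"
      if "set is \<subseteq> {..<m + n}" for "is"
    proof -
      have "\<sigma> i < length us" if "i \<in> set is" for i
        using that \<open>set is \<subseteq> _\<close> permutes_in_image[OF p, of i] l by auto
      then show ?thesis by simp
    qed
    have "prj B (F (map (\<lambda>i. us ! \<sigma> i) [0..<m])) = f (map (\<lambda>i. ?xs ! \<sigma> i) [0..<m])"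
      using assms(1) by (subst s[symmetric]) (auto simp: represents_def)
    moreover have "prj B (K (map (\<lambda>i. us ! \<sigma> i) [m..<m + n])) = k (map (\<lambda>i. ?xs ! \<sigma> i) [m..<m + n])"
      using assms(2) by (subst s[symmetric]) (auto simp: represents_def)
    ultimately show "prj B (signed (sign \<sigma>) (lift2 B B B brB (F (map (\<lambda>i. us ! \<sigma> i) [0..<m])) (K (map (\<lambda>i. us ! \<sigma> i) [m..<m + n])))) =
      add_pow B (sign \<sigma>) (brB (f (map (\<lambda>i. ?xs ! \<sigma> i) [0..<m])) (k (map (\<lambda>i. ?xs ! \<sigma> i) [m..<m + n])))"
      using lift2_bilinear(1)[OF module_B module_B module_B lie_algebra.br_bilinear[OF lie_B]]
      by (simp add: B.M.prj_signed)
  qed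
  then show "prj B (lcalc.W m F K us) = CUP m n f k ?xs" using t by (simp add: cup_def)
qed

lemma CUP_closed: "f \<in> carrier (Alt m) \<Longrightarrow> k \<in> carrier (Alt n) \<Longrightarrow> CUP m n f k \<in> carrier (Alt (m + n))"
  by (rule Alt_I[OF CUP_extensional represents_CUP[OF represents_Alt represents_Alt]
        lcalc.alt_form_wedge[OF alt_form_lift_fun alt_form_lift_fun]])

lemma CUP_bilinear: "bilinear_map R (Alt m) (Alt n) (Alt (m + n)) (CUP m n)"
  unfolding bilinear_map_def
proof (intro conjI ballI linear_mapI)
  fix f k assume f: "f \<in> carrier (Alt m)" and k: "k \<in> carrier (Alt n)"
  show "CUP m n f k \<in> carrier (Alt (m + n))" by (rule CUP_closed[OF f k])
  note rf = represents_Alt[OF f] and rk = represents_Alt[OF k]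
  {
    fix k' assume k': "k' \<in> carrier (Alt n)"
    note rk' = represents_Alt[OF k']
    show "CUP m n f (k \<oplus>\<^bsub>Alt n\<^esub> k') = CUP m n f k \<oplus>\<^bsub>Alt (m + n)\<^esub> CUP m n f k'"
      by (rule Alt_eqI[OF CUP_extensional extensional_Alt_ops(2)
          represents_CUP[OF rf represents_add[OF rk rk']]
          represents_add[OF represents_CUP[OF rf rk] represents_CUP[OF rf rk']]])
        (rule lcalc.wedge_add)
  }
  {
    fix s assume s: "s \<in> carrier R"
    show "CUP m n f (s \<odot>\<^bsub>Alt n\<^esub> k) = s \<odot>\<^bsub>Alt (m + n)\<^esub> CUP m n f k"
      by (rule Alt_eqI[OF CUP_extensional extensional_Alt_ops(3)
          represents_CUP[OF rf represents_smult[OF rk s]]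
          represents_smult[OF represents_CUP[OF rf rk] s]])
        (rule lcalc.wedge_scB)
  }
next
  fix f k assume f: "f \<in> carrier (Alt m)" and k: "k \<in> carrier (Alt n)"
  show "CUP m n f k \<in> carrier (Alt (m + n))" by (rule CUP_closed[OF f k])
  note rf = represents_Alt[OF f] and rk = represents_Alt[OF k]
  {
    fix f' assume f': "f' \<in> carrier (Alt m)"
    note rf' = represents_Alt[OF f']
    show "CUP m n (f \<oplus>\<^bsub>Alt m\<^esub> f') k = CUP m n f k \<oplus>\<^bsub>Alt (m + n)\<^esub> CUP m n f' k"
      by (rule Alt_eqI[OF CUP_extensional extensional_Alt_ops(2)
          represents_CUP[OF represents_add[OF rf rf'] rk]
          represents_add[OF represents_CUP[OF rf rk] represents_CUP[OF rf' rk]]])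
        (rule lcalc.wedge_add)
  }
  fix s assume s: "s \<in> carrier R"
  show "CUP m n (s \<odot>\<^bsub>Alt m\<^esub> f) k = s \<odot>\<^bsub>Alt (m + n)\<^esub> CUP m n f k"
    by (rule Alt_eqI[OF CUP_extensional extensional_Alt_ops(3)
        represents_CUP[OF represents_smult[OF rf s] rk]
        represents_smult[OF represents_CUP[OF rf rk] s]])
      (rule lcalc.wedge_scB)
qed

lemma Alt_extensional: "f \<in> carrier (Alt n) \<Longrightarrow> f \<in> extensional (tuples A n)"
  by (rule alt_mapsD(2))

lemma Alt_sign_closed: "f \<in> carrier (Alt n) \<Longrightarrow> add_pow (Alt n) ((-1::int) ^ k) f \<in> carrier (Alt n)"
proof -
  interpret Alt: module R "Alt n" by (rule Alt_module)
  assume "f \<in> carrier (Alt n)"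
  then show ?thesis by (cases "even k") (simp_all add: Alt.M.add_pow_one Alt.M.add_pow_neg_one)
qed

lemma Alt_uminus_closed: "f \<in> carrier (Alt n) \<Longrightarrow> \<ominus>\<^bsub>Alt n\<^esub> f \<in> carrier (Alt n)"
proof -
  interpret Alt: module R "Alt n" by (rule Alt_module)
  show "f \<in> carrier (Alt n) \<Longrightarrow> \<ominus>\<^bsub>Alt n\<^esub> f \<in> carrier (Alt n)" by simp
qed

lemma CUP_leibniz:
  assumes f: "f \<in> carrier (Alt m)" and k: "k \<in> carrier (Alt n)"
  shows "CE (m + n) (CUP m n f k) = CUP (Suc m) n (CE m f) k \<oplus>\<^bsub>Alt (Suc (m + n))\<^esub>
    add_pow (Alt (Suc (m + n))) ((-1::int) ^ m) (CUP m (Suc n) f (CE n k))"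
proof (rule Alt_eqI[OF CE_extensional extensional_Alt_ops(2)])
  note rf = represents_Alt[OF f] and rk = represents_Alt[OF k]
  note af = alt_form_lift_fun[OF f] and ak = alt_form_lift_fun[OF k]
  show "represents A B (Suc (m + n)) (CE (m + n) (CUP m n f k)) (calc.D (lcalc.W m (lift_fun A B f) (lift_fun A B k)))"
    by (rule represents_CE[OF lcalc.alt_form_wedge[OF af ak] represents_CUP[OF rf rk]])
  have c: "CUP m (Suc n) f (CE n k) \<in> carrier (Alt (Suc (m + n)))"
    using CUP_closed[OF f CE_closed[OF k]] by simp
  have "represents A B (Suc (m + n)) (CUP m (Suc n) f (CE n k)) (lcalc.W m (lift_fun A B f) (calc.D (lift_fun A B k)))"
    using represents_CUP[OF rf represents_CE[OF ak rk]] by simp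
  note 2 = represents_alt_sign[OF this c, of m]
  have 1: "represents A B (Suc (m + n)) (CUP (Suc m) n (CE m f) k) (lcalc.W (Suc m) (calc.D (lift_fun A B f)) (lift_fun A B k))"
    using represents_CUP[OF represents_CE[OF af rf] rk] by simp
  show "represents A B (Suc (m + n)) (CUP (Suc m) n (CE m f) k \<oplus>\<^bsub>Alt (Suc (m + n))\<^esub>
      add_pow (Alt (Suc (m + n))) ((-1::int) ^ m) (CUP m (Suc n) f (CE n k)))
    (\<lambda>us. lcalc.W (Suc m) (calc.D (lift_fun A B f)) (lift_fun A B k) us +
      alt_sign m (lcalc.W m (lift_fun A B f) (calc.D (lift_fun A B k)) us))"
    by (rule represents_add[OF 1 2])
qed (rule lcalc.D_wedge)

lemma CUP_antisym:
  assumes f: "f \<in> carrier (Alt m)" and k: "k \<in> carrier (Alt n)"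
  shows "CUP m n f k = \<ominus>\<^bsub>Alt (m + n)\<^esub> (add_pow (Alt (m + n)) ((-1::int) ^ (m * n)) (CUP n m k f))"
proof -
  note rf = represents_Alt[OF f] and rk = represents_Alt[OF k]
  have c: "CUP n m k f \<in> carrier (Alt (m + n))"
    using CUP_closed[OF k f] by (simp add: add.commute)
  have r: "represents A B (m + n) (CUP n m k f) (lcalc.W n (lift_fun A B k) (lift_fun A B f))"
    using represents_CUP[OF rk rf] by (simp add: add.commute)
  show ?thesis
    by (rule Alt_eqI[OF CUP_extensional Alt_extensional[OF Alt_uminus_closed[OF Alt_sign_closed[OF c]]]
        represents_CUP[OF rf rk] represents_uminus[OF represents_alt_sign[OF r c] Alt_sign_closed[OF c]]])
      (rule lcalc.wedge_antisym)
qed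

lemma CUP_jacobi:
  assumes f: "f \<in> carrier (Alt i)" and k: "k \<in> carrier (Alt j)" and l: "l \<in> carrier (Alt n)"
  shows "CUP i (j + n) f (CUP j n k l) = CUP (i + j) n (CUP i j f k) l \<oplus>\<^bsub>Alt (i + j + n)\<^esub>
    add_pow (Alt (i + j + n)) ((-1::int) ^ (i * j)) (CUP j (i + n) k (CUP i n f l))"
proof -
  note rf = represents_Alt[OF f] and rk = represents_Alt[OF k] and rl = represents_Alt[OF l]
  let ?F = "lift_fun A B f" and ?K = "lift_fun A B k" and ?L = "lift_fun A B l"
  have c: "CUP j (i + n) k (CUP i n f l) \<in> carrier (Alt (i + j + n))"
    using CUP_closed[OF k CUP_closed[OF f l]] by (simp add: ac_simps)
  have e: "CUP i (j + n) f (CUP j n k l) \<in> extensional (tuples A (i + j + n))"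
    using CUP_extensional[of i "j + n"] by (simp add: ac_simps)
  have 1: "represents A B (i + j + n) (CUP i (j + n) f (CUP j n k l)) (lcalc.W i ?F (lcalc.W j ?K ?L))"
    using represents_CUP[OF rf represents_CUP[OF rk rl]] by (simp add: ac_simps)
  have 2: "represents A B (i + j + n) (CUP j (i + n) k (CUP i n f l)) (lcalc.W j ?K (lcalc.W i ?F ?L))"
    using represents_CUP[OF rk represents_CUP[OF rf rl]] by (simp add: ac_simps)
  show ?thesis
    by (rule Alt_eqI[OF e extensional_Alt_ops(2) 1 represents_add[OF
          represents_CUP[OF represents_CUP[OF rf rk] rl] represents_alt_sign[OF 2 c]]])
      (rule lcalc.wedge_jacobi)
qed

lemma dg_lie_Alt: "dg_lie R (alt_maps R A B) CE CUP"
proof (rule dg_lie.intro)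
  show "module R (Alt n)" for n by (rule Alt_module)
  show "linear_map R (Alt n) (Alt (Suc n)) (CE n)" for n by (rule CE_linear)
  show "CE (Suc n) (CE n f) = \<zero>\<^bsub>Alt (Suc (Suc n))\<^esub>" if "f \<in> carrier (Alt n)" for f n
    by (rule CE_CE[OF that])
  show "bilinear_map R (Alt m) (Alt n) (Alt (m + n)) (CUP m n)" for m n by (rule CUP_bilinear)
  fix f i assume f: "f \<in> carrier (Alt i)"
  note rf = represents_Alt[OF f]
  show "CUP i i f f = \<zero>\<^bsub>Alt (i + i)\<^esub>" if "even i"
    by (rule Alt_eqI[OF CUP_extensional extensional_Alt_ops(1) represents_CUP[OF rf rf] represents_zero])
      (rule lcalc.wedge_even_self[OF that])
  show "CUP i (i + i) f (CUP i i f f) = \<zero>\<^bsub>Alt (i + (i + i))\<^esub>" if "odd i"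
    by (rule Alt_eqI[OF CUP_extensional extensional_Alt_ops(1) represents_CUP[OF rf represents_CUP[OF rf rf]] represents_zero])
      (rule lcalc.wedge_odd_self[OF that])
qed (rule CUP_leibniz CUP_antisym CUP_jacobi; assumption)+

end

section \<open>Transport of differential and cup product along restriction, conjugation and
  transfer\<close>

text \<open>One statement for three uses: \<phi> is restriction or a conjugation on L, and S is the
  graph of restriction, the graph of a conjugation, or the relation m = t(m'). In the last case the
  third condition on S is the module identity a t(u) = t(r(a) u).\<close>

lemma ce_diff_rel:
  assumes "lie_module R A br B act" "lie_module R' A' br' B' act'"
    and f: "f \<in> carrier (alt_maps R A B n)" and f': "f' \<in> carrier (alt_maps R' A' B' n)"
    and \<phi>: "\<And>x. x \<in> carrier A \<Longrightarrow> \<phi> x \<in> carrier A'"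
      "\<And>x y. x \<in> carrier A \<Longrightarrow> y \<in> carrier A \<Longrightarrow> \<phi> (br x y) = br' (\<phi> x) (\<phi> y)"
    and S: "S \<zero>\<^bsub>B\<^esub> \<zero>\<^bsub>B'\<^esub>"
      "\<And>m m' n n'. m \<in> carrier B \<Longrightarrow> n \<in> carrier B \<Longrightarrow> m' \<in> carrier B' \<Longrightarrow> n' \<in> carrier B' \<Longrightarrow>
        S m m' \<Longrightarrow> S n n' \<Longrightarrow> S (m \<ominus>\<^bsub>B\<^esub> n) (m' \<ominus>\<^bsub>B'\<^esub> n')"
      "\<And>x m m'. x \<in> carrier A \<Longrightarrow> m \<in> carrier B \<Longrightarrow> m' \<in> carrier B' \<Longrightarrow> S m m' \<Longrightarrow> S (act x m) (act' (\<phi> x) m')"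
    and rel: "\<And>xs. xs \<in> tuples A n \<Longrightarrow> S (f xs) (f' (map \<phi> xs))"
    and xs: "xs \<in> tuples A (Suc n)"
  shows "S (ce_diff A br B act n f xs) (ce_diff A' br' B' act' n f' (map \<phi> xs))"
proof -
  interpret X: lie_module R A br B act by (rule assms(1))
  interpret Y: lie_module R' A' br' B' act' by (rule assms(2))
  let ?RA = "\<lambda>u u'. \<phi> (prj A u) = prj A' u'" and ?RB = "\<lambda>v v'. S (prj B v) (prj B' v')"
  have maps: "map (prj A') us' = map \<phi> (map (prj A) us)" if "list_all2 ?RA us us'" for us us'
    using that by (induction rule: list_all2_induct) auto
  note pX = lift2_bilinear(1)[OF X.module_A X.module_A X.module_A X.br_bilinear]
    lift2_bilinear(1)[OF X.module_A X.module_B X.module_B X.act_bilinear]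
  note pY = lift2_bilinear(1)[OF Y.module_A Y.module_A Y.module_A Y.br_bilinear]
    lift2_bilinear(1)[OF Y.module_A Y.module_B Y.module_B Y.act_bilinear]
  note rX = X.represents_Alt[OF f] and rY = Y.represents_Alt[OF f']
  note cX = abelian_group.prj_closed[OF X.agA] and cY = abelian_group.prj_closed[OF Y.agA]
  let ?us = "map (emb A) xs" and ?us' = "map (emb A') (map \<phi> xs)"
  have xs': "map \<phi> xs \<in> tuples A' (Suc n)" using xs \<phi>(1) by (auto simp: tuples_def)
  have "?RB (X.calc.D (lift_fun A B f) ?us) (Y.calc.D (lift_fun A' B' f') ?us')"
  proof (rule ce_rel[where RA = ?RA])
    show "list_all2 ?RA ?us ?us'"
      using tuples_nth[OF xs] tuples_nth[OF xs'] tuples_length[OF xs]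
      by (auto simp: list_all2_conv_all_nth abelian_group.prj_emb[OF X.agA] abelian_group.prj_emb[OF Y.agA])
    show "S (prj B (lift_fun A B f ys)) (prj B' (lift_fun A' B' f' ys'))"
      if "list_all2 ?RA ys ys'" "Suc (length ys) = length ?us" for ys ys'
    proof -
      have l: "length ys = n" "length ys' = n"
        using that xs list_all2_lengthD[OF that(1)] by (auto simp: tuples_def)
      have "map (prj A) ys \<in> tuples A n" using tuples_prj[OF X.agA, of ys] l by simp
      then show ?thesis
        using rel[of "map (prj A) ys"] rX rY l maps[OF that(1)] by (simp add: represents_def)
    qed
    show "S (prj B 0) (prj B' 0)" by (simp add: X.B.M.prj_zero Y.B.M.prj_zero S)
    show "S (prj B (u - v)) (prj B' (u' - v'))" if "?RB u u'" "?RB v v'" for u v u' v'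
      using S(2) that by (simp add: X.B.M.prj_diff Y.B.M.prj_diff)
    show "?RA (lift2 A A A br x y) (lift2 A' A' A' br' x' y')" if "?RA x x'" "?RA y y'" for x y x' y'
      using that \<phi>(2)[OF cX cX] by (simp add: pX pY)
    show "?RB (lift2 A B B act x m) (lift2 A' B' B' act' x' m')" if "?RA x x'" "?RB m m'" for x m x' m'
      using S(3)[OF cX[of x] X.B.M.prj_closed Y.B.M.prj_closed that(2)] that(1) by (simp add: pX pY)
  qed
  moreover have "prj B (X.calc.D (lift_fun A B f) ?us) = ce_diff A br B act n f xs"
    by (rule represents_apply[OF X.represents_CE[OF X.alt_form_lift_fun[OF f] rX] X.agA xs])
  moreover have "prj B' (Y.calc.D (lift_fun A' B' f') ?us') = ce_diff A' br' B' act' n f' (map \<phi> xs)"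
    by (rule represents_apply[OF Y.represents_CE[OF Y.alt_form_lift_fun[OF f'] rY] Y.agA xs'])
  ultimately show ?thesis by simp
qed

text \<open>T, U and S become restriction throughout, conjugation throughout, or transfer for one
  factor and the product with restriction for the other; in the last case the third condition on S
  is a Frobenius identity in M.\<close>

lemma cup_rel:
  assumes "lie_coefficients R A br B act brB" "lie_coefficients R' A' br' B' act' brB'"
    and f: "f \<in> carrier (alt_maps R A B m)" and f': "f' \<in> carrier (alt_maps R' A' B' m)"
    and k: "k \<in> carrier (alt_maps R A B n)" and k': "k' \<in> carrier (alt_maps R' A' B' n)"
    and \<phi>: "\<And>x. x \<in> carrier A \<Longrightarrow> \<phi> x \<in> carrier A'"
    and S: "S \<zero>\<^bsub>B\<^esub> \<zero>\<^bsub>B'\<^esub>"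
      "\<And>m m' n n'. m \<in> carrier B \<Longrightarrow> n \<in> carrier B \<Longrightarrow> m' \<in> carrier B' \<Longrightarrow> n' \<in> carrier B' \<Longrightarrow>
        S m m' \<Longrightarrow> S n n' \<Longrightarrow> S (m \<ominus>\<^bsub>B\<^esub> n) (m' \<ominus>\<^bsub>B'\<^esub> n')"
      "\<And>m m' n n'. m \<in> carrier B \<Longrightarrow> n \<in> carrier B \<Longrightarrow> m' \<in> carrier B' \<Longrightarrow> n' \<in> carrier B' \<Longrightarrow>
        T m m' \<Longrightarrow> U n n' \<Longrightarrow> S (brB m n) (brB' m' n')"
    and rel: "\<And>xs. xs \<in> tuples A m \<Longrightarrow> T (f xs) (f' (map \<phi> xs))"
      "\<And>xs. xs \<in> tuples A n \<Longrightarrow> U (k xs) (k' (map \<phi> xs))"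
    and xs: "xs \<in> tuples A (m + n)"
  shows "S (cup A B brB m n f k xs) (cup A' B' brB' m n f' k' (map \<phi> xs))"
proof -
  interpret X: lie_coefficients R A br B act brB by (rule assms(1))
  interpret Y: lie_coefficients R' A' br' B' act' brB' by (rule assms(2))
  let ?RA = "\<lambda>u u'. \<phi> (prj A u) = prj A' u'" and ?R = "\<lambda>S v v'. S (prj B v) (prj B' v')"
  have maps: "map (prj A') us' = map \<phi> (map (prj A) us)" if "list_all2 ?RA us us'" for us us'
    using that by (induction rule: list_all2_induct) auto
  note pX = lift2_bilinear(1)[OF X.module_B X.module_B X.module_B lie_algebra.br_bilinear[OF X.lie_B]]
  note pY = lift2_bilinear(1)[OF Y.module_B Y.module_B Y.module_B lie_algebra.br_bilinear[OF Y.lie_B]]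
  note rX = X.represents_Alt[OF f] X.represents_Alt[OF k] and rY = Y.represents_Alt[OF f'] Y.represents_Alt[OF k']
  let ?us = "map (emb A) xs" and ?us' = "map (emb A') (map \<phi> xs)"
  have xs': "map \<phi> xs \<in> tuples A' (m + n)" using xs \<phi>(1) by (auto simp: tuples_def)
  have t: "map (prj A) ys \<in> tuples A (length ys)" for ys
    by (rule tuples_prj[OF X.agA])
  have "?R S (X.lcalc.W m (lift_fun A B f) (lift_fun A B k) ?us) (Y.lcalc.W m (lift_fun A' B' f') (lift_fun A' B' k') ?us')"
  proof (rule wedge_rel[where RA = ?RA and ?R1.0 = "?R T" and ?R2.0 = "?R U" and RB = "?R S"])
    show "list_all2 ?RA ?us ?us'"
      using tuples_nth[OF xs] tuples_nth[OF xs'] tuples_length[OF xs]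
      by (auto simp: list_all2_conv_all_nth abelian_group.prj_emb[OF X.agA] abelian_group.prj_emb[OF Y.agA])
    show "?R T (lift_fun A B f ys) (lift_fun A' B' f' ys')"
      if "list_all2 ?RA ys ys'" "length ys = m" for ys ys'
      using rel(1)[of "map (prj A) ys"] rX rY that list_all2_lengthD[OF that(1)] maps[OF that(1)] t[of ys]
      by (simp add: represents_def)
    show "?R U (lift_fun A B k ys) (lift_fun A' B' k' ys')"
      if "list_all2 ?RA ys ys'" "m + length ys = length ?us" for ys ys'
      using rel(2)[of "map (prj A) ys"] rX rY that list_all2_lengthD[OF that(1)] maps[OF that(1)] t[of ys] tuples_length[OF xs]
      by (simp add: represents_def)
    show "?R S 0 0" by (simp add: X.B.M.prj_zero Y.B.M.prj_zero S)
    show "?R S (u - v) (u' - v')" if "?R S u u'" "?R S v v'" for u v u' v'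
      using S(2) that by (simp add: X.B.M.prj_diff Y.B.M.prj_diff)
    show "?R S (lift2 B B B brB u v) (lift2 B' B' B' brB' u' v')" if "?R T u u'" "?R U v v'" for u v u' v'
      using S(3) that by (simp add: pX pY)
  qed
  moreover have "prj B (X.lcalc.W m (lift_fun A B f) (lift_fun A B k) ?us) = cup A B brB m n f k xs"
    by (rule represents_apply[OF X.represents_CUP[OF rX] X.agA xs])
  moreover have "prj B' (Y.lcalc.W m (lift_fun A' B' f') (lift_fun A' B' k') ?us') = cup A' B' brB' m n f' k' (map \<phi> xs)"
    by (rule represents_apply[OF Y.represents_CUP[OF rY] Y.agA xs'])
  ultimately show ?thesis by simp
qed

text \<open>\<open>alt_form_update\<close> brought back to carriers, in preparation for the transfer
  condition, which speaks of arbitrary positions.\<close>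

lemma (in lie_module) Alt_update:
  assumes "f \<in> carrier (Alt n)" "xs \<in> tuples A n" "i < n" "y \<in> carrier A"
  shows "f (xs[i := y]) = add_pow B ((-1::int) ^ i) (f (y # nths xs (- {i})))"
proof -
  let ?us = "map (emb A) xs"
  have l: "length ?us = n" using assms(2) by (simp add: tuples_length)
  have r: "prj B (lift_fun A B f zs) = f (map (prj A) zs)" if "length zs = n" for zs
    using represents_Alt[OF assms(1)] that by (simp add: represents_def)
  note mp = map_prj_emb[OF agA assms(2)]
  have "f (xs[i := y]) = prj B (lift_fun A B f (?us[i := emb A y]))"
    by (subst r) (use l mp assms(4) in \<open>simp_all add: map_update abelian_group.prj_emb[OF agA] del: map_map\<close>)
  also have "\<dots> = prj B (alt_sign i (lift_fun A B f (emb A y # nths ?us (- {i}))))"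
    using calc.alt_form_update[of ?us "lift_fun A B f" i] alt_form_lift_fun[OF assms(1)] l assms(3) by simp
  also have "\<dots> = add_pow B ((-1::int) ^ i) (f (y # nths (map (prj A) ?us) (- {i})))"
    unfolding B.M.prj_alt_sign
    by (subst r) (use l assms(3,4) in \<open>auto simp: length_nths_remove nths_map abelian_group.prj_emb[OF agA]\<close>)
  finally show ?thesis unfolding mp .
qed

section \<open>Cochains over a Green functor\<close>

locale green_coefficients = prime_cyclic_group G p g + L: lie_green_functor R G L +
    M: lie_green_functor R G M + LM?: green_module R G L M act_Cp act_e
  for R :: "('r, 'n) ring_scheme" and G :: "('g, 'q) monoid_scheme" and p :: nat and g :: 'g
    and L :: "('r, 'g, 'lc, 'le, 'z) green_scheme"
    and M :: "('r, 'g, 'mc, 'me, 'w) green_scheme"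
    and act_Cp :: "'lc \<Rightarrow> 'mc \<Rightarrow> 'mc" and act_e :: "'le \<Rightarrow> 'me \<Rightarrow> 'me" +
  assumes derivations_Cp: "acts_by_derivations (at_Cp L) (at_Cp M) (br_Cp M) act_Cp"
    and derivations_e: "acts_by_derivations (at_e L) (at_e M) (br_e M) act_e"
begin

sublocale X: lie_coefficients R "at_Cp L" "br_Cp L" "at_Cp M" act_Cp "br_Cp M"
  by (rule lie_coefficients.intro[OF lie_module_Cp lie_coefficients_axioms.intro[OF M.lie_Cp derivations_Cp]])

sublocale Y: lie_coefficients R "at_e L" "br_e L" "at_e M" act_e "br_e M"
  by (rule lie_coefficients.intro[OF lie_module_e lie_coefficients_axioms.intro[OF M.lie_e derivations_e]])

abbreviation CC where "CC \<equiv> C_Cp R G L M"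
abbreviation dC where "dC \<equiv> b_Cp L M act_Cp act_e"
abbreviation cupC where "cupC \<equiv> cup_Cp L M"

lemma res_L: "a \<in> carrier (at_Cp L) \<Longrightarrow> res L a \<in> carrier (at_e L)"
  by (rule linear_mapD(1)[OF L.res_linear])

lemma trf_L: "x \<in> carrier (at_e L) \<Longrightarrow> trf L x \<in> carrier (at_Cp L)"
  by (rule linear_mapD(1)[OF L.trf_linear])

lemma cnj_L: "h \<in> carrier G \<Longrightarrow> x \<in> carrier (at_e L) \<Longrightarrow> cnj L h x \<in> carrier (at_e L)"
  by (rule linear_mapD(1)[OF L.cnj_linear])

lemma trf_M: "x \<in> carrier (at_e M) \<Longrightarrow> trf M x \<in> carrier (at_Cp M)"
  by (rule linear_mapD(1)[OF M.trf_linear])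

lemma cnj_M: "h \<in> carrier G \<Longrightarrow> x \<in> carrier (at_e M) \<Longrightarrow> cnj M h x \<in> carrier (at_e M)"
  by (rule linear_mapD(1)[OF M.cnj_linear])

lemma tuples_res: "as \<in> tuples (at_Cp L) n \<Longrightarrow> map (res L) as \<in> tuples (at_e L) n"
  using res_L by (auto simp: tuples_def)

lemma tuples_cnj: "h \<in> carrier G \<Longrightarrow> xs \<in> tuples (at_e L) n \<Longrightarrow> map (cnj L h) xs \<in> tuples (at_e L) n"
  using cnj_L by (auto simp: tuples_def)

text \<open>The transfer condition of a pair, restricted to the first argument. In this form it is
  tested on lists headed by t(x) and by x, exactly where the recursions of \<open>ce\<close> and
  \<open>wedge\<close> contract.\<close>

definition first_transfer :: "nat \<Rightarrow> ('lc list \<Rightarrow> 'mc) \<Rightarrow> ('le list \<Rightarrow> 'me) \<Rightarrow> bool" where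
  "first_transfer n f f' \<longleftrightarrow> (\<forall>as x. x \<in> carrier (at_e L) \<longrightarrow> Suc (length as) = n \<longrightarrow> as \<in> tuples (at_Cp L) (length as) \<longrightarrow>
     f (trf L x # as) = trf M (f' (x # map (res L) as)))"

definition compatible :: "nat \<Rightarrow> ('lc list \<Rightarrow> 'mc) \<Rightarrow> ('le list \<Rightarrow> 'me) \<Rightarrow> bool" where
  "compatible n f f' \<longleftrightarrow> f \<in> carrier (X.Alt n) \<and> f' \<in> carrier (Y.Alt n) \<and>
     (\<forall>as\<in>tuples (at_Cp L) n. res M (f as) = f' (map (res L) as)) \<and>
     (\<forall>h\<in>carrier G. \<forall>xs\<in>tuples (at_e L) n. cnj M h (f' xs) = f' (map (cnj L h) xs)) \<and>
     (\<forall>as\<in>tuples (at_Cp L) n. \<forall>i<n. \<forall>x\<in>carrier (at_e L).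
        f (as[i := trf L x]) = trf M (f' ((map (res L) as)[i := x])))"

lemma tuples_nths: "xs \<in> tuples A n \<Longrightarrow> i < n \<Longrightarrow> nths xs (- {i}) \<in> tuples A (n - 1)"
  using set_nths_subset[of xs "- {i}"] by (auto simp: tuples_def length_nths_remove)

text \<open>Moving argument i to the front costs (-1)^i for f and for f' alike, and transfer
  commutes with signs.\<close>

lemma transfer_slots:
  assumes f: "f \<in> carrier (X.Alt n)" and f': "f' \<in> carrier (Y.Alt n)" and t: "first_transfer n f f'"
    and as: "as \<in> tuples (at_Cp L) n" and i: "i < n" and x: "x \<in> carrier (at_e L)"
  shows "f (as[i := trf L x]) = trf M (f' ((map (res L) as)[i := x]))"
proof -
  let ?bs = "nths as (- {i})"
  have b: "?bs \<in> tuples (at_Cp L) (n - 1)" by (rule tuples_nths[OF as i])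
  have c: "x # map (res L) ?bs \<in> tuples (at_e L) n"
    using tuples_res[OF b] x i by (auto simp: tuples_Cons intro!: exI[of _ "n - 1"])
  then have c: "f' (x # map (res L) ?bs) \<in> carrier (at_e M)" using Y.alt_mapsD(3)[OF f'] by auto
  have "f (as[i := trf L x]) = add_pow (at_Cp M) ((-1::int) ^ i) (f (trf L x # ?bs))"
    by (rule X.Alt_update[OF f as i trf_L[OF x]])
  also have "f (trf L x # ?bs) = trf M (f' (x # map (res L) ?bs))"
    using t x b i tuples_length[OF b] unfolding first_transfer_def by auto
  also have "add_pow (at_Cp M) ((-1::int) ^ i) (trf M (f' (x # map (res L) ?bs))) =
      trf M (add_pow (at_e M) ((-1::int) ^ i) (f' (x # map (res L) ?bs)))"
    using c trf_M[OF c] linear_map_group_hom(2)[OF M.module_e M.module_Cp M.trf_linear c]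
    by (cases "even i") (simp_all add: X.B.M.add_pow_one Y.B.M.add_pow_one X.B.M.add_pow_neg_one Y.B.M.add_pow_neg_one)
  also have "add_pow (at_e M) ((-1::int) ^ i) (f' (x # map (res L) ?bs)) = f' ((map (res L) as)[i := x])"
    using Y.Alt_update[OF f' tuples_res[OF as] i x] by (simp add: nths_map)
  finally show ?thesis .
qed

lemma compatibleI:
  assumes "f \<in> carrier (X.Alt n)" "f' \<in> carrier (Y.Alt n)"
    "\<And>as. as \<in> tuples (at_Cp L) n \<Longrightarrow> res M (f as) = f' (map (res L) as)"
    "\<And>h xs. h \<in> carrier G \<Longrightarrow> xs \<in> tuples (at_e L) n \<Longrightarrow> cnj M h (f' xs) = f' (map (cnj L h) xs)"
    "first_transfer n f f'"
  shows "compatible n f f'"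
  using assms transfer_slots[OF assms(1,2,5)] by (simp add: compatible_def)

lemma compatibleD:
  assumes "compatible n f f'"
  shows "f \<in> carrier (X.Alt n)" "f' \<in> carrier (Y.Alt n)"
    "as \<in> tuples (at_Cp L) n \<Longrightarrow> res M (f as) = f' (map (res L) as)"
    "h \<in> carrier G \<Longrightarrow> xs \<in> tuples (at_e L) n \<Longrightarrow> cnj M h (f' xs) = f' (map (cnj L h) xs)"
    "as \<in> tuples (at_Cp L) n \<Longrightarrow> i < n \<Longrightarrow> x \<in> carrier (at_e L) \<Longrightarrow>
      f (as[i := trf L x]) = trf M (f' ((map (res L) as)[i := x]))"
    "first_transfer n f f'"
proof -
  show t: "f (as[i := trf L x]) = trf M (f' ((map (res L) as)[i := x]))"
    if "as \<in> tuples (at_Cp L) n" "i < n" "x \<in> carrier (at_e L)" for as i x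
    using assms that by (simp add: compatible_def)
  show "first_transfer n f f'"
    unfolding first_transfer_def
  proof (intro allI impI)
    fix as x assume a: "x \<in> carrier (at_e L)" "Suc (length as) = n" "as \<in> tuples (at_Cp L) (length as)"
    have "trf L x # as \<in> tuples (at_Cp L) n" using a trf_L by (auto simp: tuples_Cons)
    from t[OF this, of 0 x] a show "f (trf L x # as) = trf M (f' (x # map (res L) as))" by auto
  qed
qed (use assms in \<open>simp_all add: compatible_def\<close>)

lemma res_M_hom: "res M \<zero>\<^bsub>at_Cp M\<^esub> = \<zero>\<^bsub>at_e M\<^esub>"
    "a \<in> carrier (at_Cp M) \<Longrightarrow> b \<in> carrier (at_Cp M) \<Longrightarrow> res M (a \<ominus>\<^bsub>at_Cp M\<^esub> b) = res M a \<ominus>\<^bsub>at_e M\<^esub> res M b"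
  by (rule linear_map_group_hom[OF M.module_Cp M.module_e M.res_linear]; assumption?)+

lemma trf_M_hom: "trf M \<zero>\<^bsub>at_e M\<^esub> = \<zero>\<^bsub>at_Cp M\<^esub>"
    "a \<in> carrier (at_e M) \<Longrightarrow> b \<in> carrier (at_e M) \<Longrightarrow> trf M (a \<ominus>\<^bsub>at_e M\<^esub> b) = trf M a \<ominus>\<^bsub>at_Cp M\<^esub> trf M b"
  by (rule linear_map_group_hom[OF M.module_e M.module_Cp M.trf_linear]; assumption?)+

lemma cnj_M_hom: "h \<in> carrier G \<Longrightarrow> cnj M h \<zero>\<^bsub>at_e M\<^esub> = \<zero>\<^bsub>at_e M\<^esub>"
    "h \<in> carrier G \<Longrightarrow> a \<in> carrier (at_e M) \<Longrightarrow> b \<in> carrier (at_e M) \<Longrightarrow>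
      cnj M h (a \<ominus>\<^bsub>at_e M\<^esub> b) = cnj M h a \<ominus>\<^bsub>at_e M\<^esub> cnj M h b"
  by (rule linear_map_group_hom[OF M.module_e M.module_e M.cnj_linear]; assumption)+

text \<open>Stated for two cochains: with f' = f it says that the differential preserves invariance,
  with f' the conjugate of f that it commutes with conjugation.\<close>

lemma ce_diff_conj:
  assumes f: "f \<in> carrier (Y.Alt n)" and f': "f' \<in> carrier (Y.Alt n)" and h: "h \<in> carrier G"
    and e: "\<And>xs. xs \<in> tuples (at_e L) n \<Longrightarrow> cnj M h (f xs) = f' (map (cnj L h) xs)"
    and xs: "xs \<in> tuples (at_e L) (Suc n)"
  shows "cnj M h (Y.CE n f xs) = Y.CE n f' (map (cnj L h) xs)"
  by (rule ce_diff_rel[where S = "\<lambda>m m'. cnj M h m = m'", OF Y.lie_module_axioms Y.lie_module_axioms f f' _ _ _ _ _ e xs])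
    (auto simp: h cnj_L L.cnj_br cnj_M_hom cnj_act)

lemma cup_conj:
  assumes f: "f \<in> carrier (Y.Alt m)" "f' \<in> carrier (Y.Alt m)" and k: "k \<in> carrier (Y.Alt n)" "k' \<in> carrier (Y.Alt n)"
    and h: "h \<in> carrier G"
    and e: "\<And>xs. xs \<in> tuples (at_e L) m \<Longrightarrow> cnj M h (f xs) = f' (map (cnj L h) xs)"
      "\<And>xs. xs \<in> tuples (at_e L) n \<Longrightarrow> cnj M h (k xs) = k' (map (cnj L h) xs)"
    and xs: "xs \<in> tuples (at_e L) (m + n)"
  shows "cnj M h (Y.CUP m n f k xs) = Y.CUP m n f' k' (map (cnj L h) xs)"
  by (rule cup_rel[where S = "\<lambda>m m'. cnj M h m = m'" and T = "\<lambda>m m'. cnj M h m = m'" and U = "\<lambda>m m'. cnj M h m = m'", OF Y.lie_coefficients_axioms Y.lie_coefficients_axioms f k _ _ _ _ e xs])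
    (auto simp: h cnj_L M.cnj_br cnj_M_hom)

lemma cup_res:
  assumes f: "f \<in> carrier (X.Alt m)" "f' \<in> carrier (Y.Alt m)" and k: "k \<in> carrier (X.Alt n)" "k' \<in> carrier (Y.Alt n)"
    and e: "\<And>as. as \<in> tuples (at_Cp L) m \<Longrightarrow> res M (f as) = f' (map (res L) as)"
      "\<And>as. as \<in> tuples (at_Cp L) n \<Longrightarrow> res M (k as) = k' (map (res L) as)"
    and as: "as \<in> tuples (at_Cp L) (m + n)"
  shows "res M (X.CUP m n f k as) = Y.CUP m n f' k' (map (res L) as)"
  by (rule cup_rel[where S = "\<lambda>m m'. res M m = m'" and T = "\<lambda>m m'. res M m = m'" and U = "\<lambda>m m'. res M m = m'", OF X.lie_coefficients_axioms Y.lie_coefficients_axioms f k _ _ _ _ e as])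
    (auto simp: res_L M.res_br res_M_hom)

text \<open>Made for the first component of the transfer of a cochain, which restricts all arguments
  and transfers the value. It is distinct from the transfer condition on pairs, where a single
  argument is a transfer.\<close>

lemma ce_diff_trf:
  assumes f: "f \<in> carrier (X.Alt n)" and f': "f' \<in> carrier (Y.Alt n)"
    and e: "\<And>as. as \<in> tuples (at_Cp L) n \<Longrightarrow> f as = trf M (f' (map (res L) as))"
    and as: "as \<in> tuples (at_Cp L) (Suc n)"
  shows "X.CE n f as = trf M (Y.CE n f' (map (res L) as))"
  by (rule ce_diff_rel[where S = "\<lambda>m m'. m = trf M m'", OF X.lie_module_axioms Y.lie_module_axioms f f' _ _ _ _ _ e as])
    (auto simp: res_L L.res_br trf_M_hom act_trf)

lemma cup_trf_left:
  assumes f: "f \<in> carrier (X.Alt m)" "f' \<in> carrier (Y.Alt m)" and k: "k \<in> carrier (X.Alt n)" "k' \<in> carrier (Y.Alt n)"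
    and e: "\<And>as. as \<in> tuples (at_Cp L) m \<Longrightarrow> f as = trf M (f' (map (res L) as))"
      "\<And>as. as \<in> tuples (at_Cp L) n \<Longrightarrow> res M (k as) = k' (map (res L) as)"
    and as: "as \<in> tuples (at_Cp L) (m + n)"
  shows "X.CUP m n f k as = trf M (Y.CUP m n f' k' (map (res L) as))"
  by (rule cup_rel[where S = "\<lambda>m m'. m = trf M m'" and T = "\<lambda>m m'. m = trf M m'" and U = "\<lambda>m m'. res M m = m'", OF X.lie_coefficients_axioms Y.lie_coefficients_axioms f k _ _ _ _ e as])
    (auto simp: res_L M.frobenius_left trf_M_hom)

lemma cup_trf_right:
  assumes f: "f \<in> carrier (X.Alt m)" "f' \<in> carrier (Y.Alt m)" and k: "k \<in> carrier (X.Alt n)" "k' \<in> carrier (Y.Alt n)"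
    and e: "\<And>as. as \<in> tuples (at_Cp L) m \<Longrightarrow> res M (f as) = f' (map (res L) as)"
      "\<And>as. as \<in> tuples (at_Cp L) n \<Longrightarrow> k as = trf M (k' (map (res L) as))"
    and as: "as \<in> tuples (at_Cp L) (m + n)"
  shows "X.CUP m n f k as = trf M (Y.CUP m n f' k' (map (res L) as))"
  by (rule cup_rel[where S = "\<lambda>m m'. m = trf M m'" and T = "\<lambda>m m'. res M m = m'" and U = "\<lambda>m m'. m = trf M m'", OF X.lie_coefficients_axioms Y.lie_coefficients_axioms f k _ _ _ _ e as])
    (auto simp: res_L M.frobenius_right trf_M_hom)

abbreviation (input) RA where "RA u u' \<equiv> res L (prj (at_Cp L) u) = prj (at_e L) u'"

lemma RA_map: "list_all2 RA us us' \<Longrightarrow> map (prj (at_e L)) us' = map (res L) (map (prj (at_Cp L)) us)"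
  by (induction rule: list_all2_induct) auto

lemma RA_emb:
  assumes "as \<in> tuples (at_Cp L) n"
  shows "list_all2 RA (map (emb (at_Cp L)) as) (map (emb (at_e L)) (map (res L) as))"
  using tuples_nth[OF assms] tuples_length[OF assms] res_L
  by (auto simp: list_all2_conv_all_nth abelian_group.prj_emb[OF X.agA] abelian_group.prj_emb[OF Y.agA])

lemmas lift_simps =
  lift2_bilinear(1)[OF X.module_A X.module_A X.module_A X.br_bilinear]
  lift2_bilinear(1)[OF X.module_A X.module_B X.module_B X.act_bilinear]
  lift2_bilinear(1)[OF X.module_B X.module_B X.module_B lie_algebra.br_bilinear[OF X.lie_B]]
  lift2_bilinear(1)[OF Y.module_A Y.module_A Y.module_A Y.br_bilinear]
  lift2_bilinear(1)[OF Y.module_A Y.module_B Y.module_B Y.act_bilinear]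
  lift2_bilinear(1)[OF Y.module_B Y.module_B Y.module_B lie_algebra.br_bilinear[OF Y.lie_B]]
  abelian_group.prj_emb[OF X.agA] abelian_group.prj_emb[OF Y.agA]

text \<open>Cartan's formula with t(x) above and x below. In the Lie derivative, t(x) m = t(x r(m))
  and [t(x), a] = t([x, r(a)]), after which the transfer condition of f applies in the affected
  argument. In the differential of the contraction, f(t(x),...) and f'(x,...) are related by
  transfer, and the differential preserves this relation.\<close>

lemma first_transfer_ce_diff:
  assumes c: "compatible n f f'"
  shows "first_transfer (Suc n) (X.CE n f) (Y.CE n f')"
  unfolding first_transfer_def
proof (intro allI impI)
  fix as x assume x: "x \<in> carrier (at_e L)" and l: "Suc (length as) = Suc n" and as': "as \<in> tuples (at_Cp L) (length as)"
  note c = compatibleD[OF c]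
  have as: "as \<in> tuples (at_Cp L) n" using l as' by simp
  have tx: "trf L x \<in> carrier (at_Cp L)" by (rule trf_L[OF x])
  let ?F = "lift_fun (at_Cp L) (at_Cp M) f" and ?F' = "lift_fun (at_e L) (at_e M) f'"
  let ?u = "emb (at_Cp L) (trf L x)" and ?u' = "emb (at_e L) x"
  let ?us = "map (emb (at_Cp L)) as" and ?us' = "map (emb (at_e L)) (map (res L) as)"
  let ?RB = "\<lambda>v v'. prj (at_Cp M) v = trf M (prj (at_e M) v')"
  have F: "prj (at_Cp M) (?F us) = f (map (prj (at_Cp L)) us)" if "length us = n" for us
    using X.represents_Alt[OF c(1)] that by (simp add: represents_def)
  have F': "prj (at_e M) (?F' us) = f' (map (prj (at_e L)) us)" if "length us = n" for us
    using Y.represents_Alt[OF c(2)] that by (simp add: represents_def)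
  have t: "map (prj (at_Cp L)) ys \<in> tuples (at_Cp L) (length ys)" for ys
    by (rule tuples_prj[OF X.agA])
  have RB_diff: "?RB (u - v) (u' - v')" if "?RB u u'" "?RB v v'" for u v u' v'
    using that by (simp add: X.B.M.prj_diff Y.B.M.prj_diff trf_M_hom)
  have 1: "?RB (X.calc.LD ?u ?F ?us) (Y.calc.LD ?u' ?F' ?us')"
  proof (rule lie_der_rel[where RA = RA and RB = ?RB])
    show "list_all2 RA ?us ?us'" by (rule RA_emb[OF as])
  next
    fix ys ys' assume r: "list_all2 RA ys ys'" and "length ys = length ?us"
    then have ly: "length ys = n" "length ys' = n" using tuples_length[OF as] list_all2_lengthD[OF r] by auto
    let ?bs = "map (prj (at_Cp L)) ys"
    have b: "?bs \<in> tuples (at_Cp L) n" using t[of ys] ly by simp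
    have fb: "f ?bs \<in> carrier (at_Cp M)" using X.alt_mapsD(3)[OF c(1)] b by auto
    show "?RB (lift2 (at_Cp L) (at_Cp M) (at_Cp M) act_Cp ?u (?F ys)) (lift2 (at_e L) (at_e M) (at_e M) act_e ?u' (?F' ys'))"
      using trf_act[OF x fb] c(3)[OF b] by (simp add: lift_simps F F' ly x tx RA_map[OF r] del: map_map)
    fix i assume "i < length ys"
    then have i: "i < n" using ly by simp
    have bi: "?bs ! i \<in> carrier (at_Cp L)" by (rule tuples_nth[OF b i])
    have yi: "prj (at_e L) (ys' ! i) = res L (?bs ! i)"
      using list_all2_nthD[OF r] i ly by simp
    \<comment> \<open>Frobenius reciprocity in L turns the bracket in position i into a transferred
      element, so the transfer condition in that position, \<open>c(5)\<close>, becomes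
      applicable.\<close>
    have 1: "prj (at_Cp M) (?F (ys[i := lift2 (at_Cp L) (at_Cp L) (at_Cp L) (br_Cp L) ?u (ys ! i)])) =
        f (?bs[i := trf L (br_e L x (res L (?bs ! i)))])"
      using i ly by (subst F) (auto simp: map_update lift_simps tx L.frobenius_left x bi[simplified] abelian_group.prj_closed[OF X.agA])
    have 2: "prj (at_e M) (?F' (ys'[i := lift2 (at_e L) (at_e L) (at_e L) (br_e L) ?u' (ys' ! i)])) =
        f' ((map (res L) ?bs)[i := br_e L x (res L (?bs ! i))])"
      using ly by (subst F') (simp_all add: map_update lift_simps x yi RA_map[OF r] del: map_map)
    have "br_e L x (res L (?bs ! i)) \<in> carrier (at_e L)"
      using bilinear_mapD(1)[OF Y.br_bilinear x res_L[OF bi]] .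
    from c(5)[OF b i this] show "?RB (?F (ys[i := lift2 (at_Cp L) (at_Cp L) (at_Cp L) (br_Cp L) ?u (ys ! i)]))
        (?F' (ys'[i := lift2 (at_e L) (at_e L) (at_e L) (br_e L) ?u' (ys' ! i)]))"
      unfolding 1 2 .
  qed (rule RB_diff)
  have 2: "?RB (X.calc.D (\<lambda>zs. ?F (?u # zs)) ?us) (Y.calc.D (\<lambda>zs. ?F' (?u' # zs)) ?us')"
  proof (rule ce_rel[where RA = RA and RB = ?RB])
    show "list_all2 RA ?us ?us'" by (rule RA_emb[OF as])
    show "?RB (?F (?u # ys)) (?F' (?u' # ys'))" if r: "list_all2 RA ys ys'" and "Suc (length ys) = length ?us" for ys ys'
    proof -
      have ly: "Suc (length ys) = n" "Suc (length ys') = n" using that(2) tuples_length[OF as] list_all2_lengthD[OF r] by auto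
      show ?thesis
        using c(6)[unfolded first_transfer_def, rule_format, OF x, of "map (prj (at_Cp L)) ys"] t[of ys] ly
        by (simp add: F F' lift_simps tx x RA_map[OF r] del: map_map)
    qed
    show "?RB (lift2 (at_Cp L) (at_Cp M) (at_Cp M) act_Cp u v) (lift2 (at_e L) (at_e M) (at_e M) act_e u' v')"
      if "RA u u'" "?RB v v'" for u v u' v'
      using that act_trf[OF abelian_group.prj_closed[OF X.agA] Y.B.M.prj_closed, of u v'] by (simp add: lift_simps)
    show "RA (lift2 (at_Cp L) (at_Cp L) (at_Cp L) (br_Cp L) u v) (lift2 (at_e L) (at_e L) (at_e L) (br_e L) u' v')"
      if "RA u u'" "RA v v'" for u v u' v'
      using that L.res_br[OF abelian_group.prj_closed[OF X.agA] abelian_group.prj_closed[OF X.agA], of u v] by (simp add: lift_simps)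
    show "?RB 0 0" by (simp add: X.B.M.prj_zero Y.B.M.prj_zero trf_M_hom)
  qed (rule RB_diff)
  have xs: "trf L x # as \<in> tuples (at_Cp L) (Suc n)" "x # map (res L) as \<in> tuples (at_e L) (Suc n)"
    using as tx x tuples_res[OF as] by (auto simp: tuples_Cons)
  have "prj (at_Cp M) (X.calc.D ?F (?u # ?us)) = X.CE n f (trf L x # as)"
    using represents_apply[OF X.represents_CE[OF X.alt_form_lift_fun X.represents_Alt, OF c(1) c(1)] X.agA xs(1)] by (simp del: ce.simps)
  moreover have "prj (at_e M) (Y.calc.D ?F' (?u' # ?us')) = Y.CE n f' (x # map (res L) as)"
    using represents_apply[OF Y.represents_CE[OF Y.alt_form_lift_fun Y.represents_Alt, OF c(2) c(2)] Y.agA xs(2)] by (simp del: ce.simps)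
  ultimately show "X.CE n f (trf L x # as) = trf M (Y.CE n f' (x # map (res L) as))"
    using RB_diff[OF 1 2] by simp
qed

lemma compatible_ce_diff:
  assumes "compatible n f f'"
  shows "compatible (Suc n) (X.CE n f) (Y.CE n f')"
proof (rule compatibleI)
  note c = compatibleD[OF assms]
  show "X.CE n f \<in> carrier (X.Alt (Suc n))" "Y.CE n f' \<in> carrier (Y.Alt (Suc n))"
    by (rule X.CE_closed[OF c(1)] Y.CE_closed[OF c(2)])+
  show "res M (X.CE n f as) = Y.CE n f' (map (res L) as)" if "as \<in> tuples (at_Cp L) (Suc n)" for as
    by (rule ce_diff_rel[where S = "\<lambda>m m'. res M m = m'", OF X.lie_module_axioms Y.lie_module_axioms c(1,2) _ _ _ _ _ c(3) that])
      (auto simp: res_L L.res_br res_M_hom res_act)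
  show "cnj M h (Y.CE n f' xs) = Y.CE n f' (map (cnj L h) xs)" if "h \<in> carrier G" "xs \<in> tuples (at_e L) (Suc n)" for h xs
    by (rule ce_diff_conj[OF c(2,2) that(1) c(4)[OF that(1)] that(2)])
qed (rule first_transfer_ce_diff[OF assms])

text \<open>Contraction distributes t(x) over the two factors. The factor that receives it is
  related to its counterpart by transfer, the other one by restriction, and the two Frobenius
  identities in M turn each term into the transfer of the corresponding term at e.\<close>

lemma first_transfer_cup:
  assumes cf: "compatible m f f'" and ck: "compatible n k k'"
  shows "first_transfer (m + n) (X.CUP m n f k) (Y.CUP m n f' k')"
  unfolding first_transfer_def
proof (intro allI impI)
  fix as x assume x: "x \<in> carrier (at_e L)" and l: "Suc (length as) = m + n" and as: "as \<in> tuples (at_Cp L) (length as)"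
  note cf = compatibleD[OF cf] and ck = compatibleD[OF ck]
  have tx: "trf L x \<in> carrier (at_Cp L)" by (rule trf_L[OF x])
  let ?F = "lift_fun (at_Cp L) (at_Cp M) f" and ?F' = "lift_fun (at_e L) (at_e M) f'"
  let ?K = "lift_fun (at_Cp L) (at_Cp M) k" and ?K' = "lift_fun (at_e L) (at_e M) k'"
  let ?u = "emb (at_Cp L) (trf L x)" and ?u' = "emb (at_e L) x"
  let ?us = "map (emb (at_Cp L)) as" and ?us' = "map (emb (at_e L)) (map (res L) as)"
  let ?RB = "\<lambda>v v'. prj (at_Cp M) v = trf M (prj (at_e M) v')"
  let ?RR = "\<lambda>v v'. res M (prj (at_Cp M) v) = prj (at_e M) v'"
  have F: "prj (at_Cp M) (?F us) = f (map (prj (at_Cp L)) us)" if "length us = m" for us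
    using X.represents_Alt[OF cf(1)] that by (simp add: represents_def)
  have F': "prj (at_e M) (?F' us) = f' (map (prj (at_e L)) us)" if "length us = m" for us
    using Y.represents_Alt[OF cf(2)] that by (simp add: represents_def)
  have K: "prj (at_Cp M) (?K us) = k (map (prj (at_Cp L)) us)" if "length us = n" for us
    using X.represents_Alt[OF ck(1)] that by (simp add: represents_def)
  have K': "prj (at_e M) (?K' us) = k' (map (prj (at_e L)) us)" if "length us = n" for us
    using Y.represents_Alt[OF ck(2)] that by (simp add: represents_def)
  have t: "map (prj (at_Cp L)) ys \<in> tuples (at_Cp L) (length ys)" for ys
    by (rule tuples_prj[OF X.agA])
  have RB_0: "?RB 0 0" by (simp add: X.B.M.prj_zero Y.B.M.prj_zero trf_M_hom)
  have RB_diff: "?RB (u - v) (u' - v')" if "?RB u u'" "?RB v v'" for u v u' v'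
    using that by (simp add: X.B.M.prj_diff Y.B.M.prj_diff trf_M_hom)
  have RB_add: "?RB (u + v) (u' + v')" if "?RB u u'" "?RB v v'" for u v u' v'
    using RB_diff[OF that(1) RB_diff[OF RB_0 that(2)]] by simp
  have RB_sign: "?RB (alt_sign j u) (alt_sign j u')" if "?RB u u'" for u u' j
    using RB_diff[OF RB_0 that] that by (simp add: alt_sign_def)
  have 1: "?RB (X.lcalc.W (m - 1) (\<lambda>zs. ?F (?u # zs)) ?K ?us) (Y.lcalc.W (m - 1) (\<lambda>zs. ?F' (?u' # zs)) ?K' ?us')"
    if m: "m \<noteq> 0"
  proof (rule wedge_rel[where RA = RA and RB = ?RB and ?R1.0 = ?RB and ?R2.0 = ?RR, OF RA_emb[OF as] _ _ _ RB_0 RB_diff])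
    show "?RB (?F (?u # ys)) (?F' (?u' # ys'))" if r: "list_all2 RA ys ys'" and "length ys = m - 1" for ys ys'
    proof -
      have ly: "Suc (length ys) = m" "Suc (length ys') = m" using that(2) m list_all2_lengthD[OF r] by auto
      show ?thesis
        using cf(6)[unfolded first_transfer_def, rule_format, OF x, of "map (prj (at_Cp L)) ys"] t[of ys] ly
        by (simp add: F F' lift_simps tx x RA_map[OF r] del: map_map)
    qed
    show "?RR (?K ys) (?K' ys')" if r: "list_all2 RA ys ys'" and "m - 1 + length ys = length ?us" for ys ys'
    proof -
      have "length ys = n" "length ys' = n" using that(2) l m list_all2_lengthD[OF r] by auto
      then show ?thesis
        using ck(3) t[of ys] by (simp add: K K' RA_map[OF r] del: map_map)
    qed
    show "?RB (lift2 (at_Cp M) (at_Cp M) (at_Cp M) (br_Cp M) u v) (lift2 (at_e M) (at_e M) (at_e M) (br_e M) u' v')"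
      if "?RB u u'" "?RR v v'" for u u' v v'
      using that by (simp add: lift_simps M.frobenius_left)
  qed
  have 2: "?RB (X.lcalc.W m ?F (\<lambda>zs. ?K (?u # zs)) ?us) (Y.lcalc.W m ?F' (\<lambda>zs. ?K' (?u' # zs)) ?us')"
  proof (rule wedge_rel[where RA = RA and RB = ?RB and ?R1.0 = ?RR and ?R2.0 = ?RB, OF RA_emb[OF as] _ _ _ RB_0 RB_diff])
    show "?RB (?K (?u # ys)) (?K' (?u' # ys'))" if r: "list_all2 RA ys ys'" and "m + length ys = length ?us" for ys ys'
    proof -
      have ly: "Suc (length ys) = n" "Suc (length ys') = n" using that(2) l list_all2_lengthD[OF r] by auto
      show ?thesis
        using ck(6)[unfolded first_transfer_def, rule_format, OF x, of "map (prj (at_Cp L)) ys"] t[of ys] ly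
        by (simp add: K K' lift_simps tx x RA_map[OF r] del: map_map)
    qed
    show "?RR (?F ys) (?F' ys')" if r: "list_all2 RA ys ys'" and "length ys = m" for ys ys'
    proof -
      have "length ys = m" "length ys' = m" using that(2) list_all2_lengthD[OF r] by auto
      then show ?thesis
        using cf(3) t[of ys] by (simp add: F F' RA_map[OF r] del: map_map)
    qed
    show "?RB (lift2 (at_Cp M) (at_Cp M) (at_Cp M) (br_Cp M) u v) (lift2 (at_e M) (at_e M) (at_e M) (br_e M) u' v')"
      if "?RR u u'" "?RB v v'" for u u' v v'
    proof -
      have "br_Cp M (prj (at_Cp M) u) (trf M (prj (at_e M) v')) = trf M (br_e M (res M (prj (at_Cp M) u)) (prj (at_e M) v'))"
        by (rule M.frobenius_right) auto
      then show ?thesis using that by (simp add: lift_simps)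
    qed
  qed
  have r: "?RB (X.lcalc.W m ?F ?K (?u # ?us)) (Y.lcalc.W m ?F' ?K' (?u' # ?us'))"
    using 1 RB_sign[OF 2, of m] RB_add[OF _ RB_sign[OF 2, of m]] by (cases "m = 0") auto
  have xs: "trf L x # as \<in> tuples (at_Cp L) (m + n)" "x # map (res L) as \<in> tuples (at_e L) (m + n)"
    using as tx x tuples_res[OF as] by (auto simp: tuples_Cons l[symmetric])
  have "prj (at_Cp M) (X.lcalc.W m ?F ?K (?u # ?us)) = X.CUP m n f k (trf L x # as)"
    using represents_apply[OF X.represents_CUP[OF X.represents_Alt X.represents_Alt, OF cf(1) ck(1)] X.agA xs(1)] by (simp del: wedge.simps)
  moreover have "prj (at_e M) (Y.lcalc.W m ?F' ?K' (?u' # ?us')) = Y.CUP m n f' k' (x # map (res L) as)"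
    using represents_apply[OF Y.represents_CUP[OF Y.represents_Alt Y.represents_Alt, OF cf(2) ck(2)] Y.agA xs(2)] by (simp del: wedge.simps)
  ultimately show "X.CUP m n f k (trf L x # as) = trf M (Y.CUP m n f' k' (x # map (res L) as))"
    using r by simp
qed

lemma compatible_cup:
  assumes "compatible m f f'" "compatible n k k'"
  shows "compatible (m + n) (X.CUP m n f k) (Y.CUP m n f' k')"
proof (rule compatibleI)
  note cf = compatibleD[OF assms(1)] and ck = compatibleD[OF assms(2)]
  show "X.CUP m n f k \<in> carrier (X.Alt (m + n))" "Y.CUP m n f' k' \<in> carrier (Y.Alt (m + n))"
    by (rule X.CUP_closed[OF cf(1) ck(1)] Y.CUP_closed[OF cf(2) ck(2)])+
  show "res M (X.CUP m n f k as) = Y.CUP m n f' k' (map (res L) as)" if "as \<in> tuples (at_Cp L) (m + n)" for as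
    by (rule cup_res[OF cf(1,2) ck(1,2) cf(3) ck(3) that])
  show "cnj M h (Y.CUP m n f' k' xs) = Y.CUP m n f' k' (map (cnj L h) xs)"
    if "h \<in> carrier G" "xs \<in> tuples (at_e L) (m + n)" for h xs
    by (rule cup_conj[OF cf(2,2) ck(2,2) that(1) cf(4)[OF that(1)] ck(4)[OF that(1)] that(2)])
qed (rule first_transfer_cup[OF assms])

end

lemma (in abelian_group) add_pow_sign_closed: "x \<in> carrier G \<Longrightarrow> add_pow G ((-1::int) ^ k) x \<in> carrier G"
  by (cases "even k") (simp_all add: add_pow_one add_pow_neg_one)

text \<open>Used with c_h^{-1} on the arguments and c_h on the values for conjugation, and with r on
  the arguments and t on the values for the first component of the transfer.\<close>

lemma alt_maps_compose:
  assumes f: "f \<in> carrier (alt_maps R A B n)" and \<phi>: "linear_map R A' A \<phi>" and \<psi>: "linear_map R B B' \<psi>"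
    and m: "module R A'" "module R B" "module R B'"
  shows "(\<lambda>xs\<in>tuples A' n. \<psi> (f (map \<phi> xs))) \<in> carrier (alt_maps R A' B' n)"
proof -
  interpret A': module R A' by (rule m(1))
  let ?h = "\<lambda>xs\<in>tuples A' n. \<psi> (f (map \<phi> xs))"
  have f: "f \<in> tuples A n \<rightarrow> carrier B" "multilinear R A B n f" "alternating A B n f"
    using f by (auto simp: alt_maps_def)
  have t: "map \<phi> xs \<in> tuples A n" if "xs \<in> tuples A' n" for xs
    using that linear_mapD(1)[OF \<phi>] by (auto simp: tuples_def)
  have "?h \<in> tuples A' n \<rightarrow>\<^sub>E carrier B'"
    using linear_mapD(1)[OF \<psi>] f(1) t by auto
  moreover have "multilinear R A' B' n ?h"
    unfolding multilinear_def
  proof (intro ballI allI impI)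
    fix xs i assume xs: "xs \<in> tuples A' n" and i: "i < n"
    note l = linear_map_compose[OF \<phi> linear_map_compose[OF f(2)[unfolded multilinear_def, rule_format, OF t[OF xs] i] \<psi>]]
    have e: "?h (xs[i := y]) = \<psi> (f ((map \<phi> xs)[i := \<phi> y]))" if "y \<in> carrier A'" for y
      using tuples_update[OF xs that] by (simp add: map_update)
    show "linear_map R A' B' (\<lambda>y. ?h (xs[i := y]))"
      by (rule linear_mapI) (simp_all add: e linear_mapD[OF l] del: restrict_apply)
  qed
  moreover have "alternating A' B' n ?h"
    unfolding alternating_def
  proof (intro ballI allI impI)
    fix xs i j assume xs: "xs \<in> tuples A' n" and ij: "i < j \<and> j < n \<and> xs ! i = xs ! j"
    then have "map \<phi> xs ! i = map \<phi> xs ! j" by (simp add: tuples_length)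
    then have "f (map \<phi> xs) = \<zero>\<^bsub>B\<^esub>"
      using f(3)[unfolded alternating_def, rule_format, OF t[OF xs], of i j] ij by simp
    then show "?h xs = \<zero>\<^bsub>B'\<^esub>" using xs linear_map_group_hom(1)[OF m(2,3) \<psi>] by simp
  qed
  ultimately show ?thesis by (simp add: alt_maps_def)
qed

lemma (in lie_module) Alt_ops_apply:
  assumes "xs \<in> tuples A n"
  shows "\<zero>\<^bsub>Alt n\<^esub> xs = \<zero>\<^bsub>B\<^esub>" "(f \<oplus>\<^bsub>Alt n\<^esub> f') xs = f xs \<oplus>\<^bsub>B\<^esub> f' xs" "(s \<odot>\<^bsub>Alt n\<^esub> f) xs = s \<odot>\<^bsub>B\<^esub> f xs"
  using assms by (auto simp: alt_maps_def)

lemma (in lie_module) Alt_sum_apply: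
  assumes "finite S" "\<And>i. i \<in> S \<Longrightarrow> F i \<in> carrier (Alt n)" "xs \<in> tuples A n"
  shows "(\<Oplus>\<^bsub>Alt n\<^esub>i\<in>S. F i) xs = (\<Oplus>\<^bsub>B\<^esub>i\<in>S. F i xs)"
proof -
  interpret Alt: module R "Alt n" by (rule Alt_module)
  have v: "f xs \<in> carrier B" if "f \<in> carrier (Alt n)" for f
    using alt_mapsD(3)[OF that] assms(3) by auto
  show ?thesis
    using assms(1,2)
    by (induction S rule: finite_induct) (auto simp: Pi_def Alt_ops_apply[OF assms(3)] v)
qed

lemma (in lie_module) Alt_ext:
  "f \<in> carrier (Alt n) \<Longrightarrow> f' \<in> carrier (Alt n) \<Longrightarrow> (\<And>xs. xs \<in> tuples A n \<Longrightarrow> f xs = f' xs) \<Longrightarrow> f = f'"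
  by (rule extensionalityI[OF alt_mapsD(2) alt_mapsD(2)])

section \<open>The complex of compatible pairs at C_p\<close>

context green_coefficients begin

lemma CC_carrier: "carrier (CC n) = {(f, f'). compatible n f f'}"
  by (simp add: C_Cp_def compatible_def Let_def)

lemma CC_carrier': "carrier (CC n) = {(f, f'). f \<in> carrier (X.Alt n) \<and> f' \<in> carrier (Y.Alt n) \<and> compatible n f f'}"
  by (auto simp: CC_carrier compatible_def)

lemma CC_ops:
  "\<zero>\<^bsub>CC n\<^esub> = (\<zero>\<^bsub>X.Alt n\<^esub>, \<zero>\<^bsub>Y.Alt n\<^esub>)"
  "(f, f') \<oplus>\<^bsub>CC n\<^esub> (k, k') = (f \<oplus>\<^bsub>X.Alt n\<^esub> k, f' \<oplus>\<^bsub>Y.Alt n\<^esub> k')"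
  "s \<odot>\<^bsub>CC n\<^esub> (f, f') = (s \<odot>\<^bsub>X.Alt n\<^esub> f, s \<odot>\<^bsub>Y.Alt n\<^esub> f')"
  by (simp_all add: C_Cp_def Let_def)

lemma dC_apply: "dC n (f, f') = (X.CE n f, Y.CE n f')"
  by (simp add: b_Cp_def)

lemma cupC_apply: "cupC m n (f, f') (k, k') = (X.CUP m n f k, Y.CUP m n f' k')"
  by (simp add: cup_Cp_def)

lemma first_transfer_tuples:
  assumes "x \<in> carrier (at_e L)" "Suc (length as) = n" "as \<in> tuples (at_Cp L) (length as)"
  shows "trf L x # as \<in> tuples (at_Cp L) n" "x # map (res L) as \<in> tuples (at_e L) n"
  using assms tuples_res[OF assms(3)] trf_L by (auto simp: tuples_Cons)

lemma compatible_zero: "compatible n \<zero>\<^bsub>X.Alt n\<^esub> \<zero>\<^bsub>Y.Alt n\<^esub>"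
proof -
  interpret XA: module R "X.Alt n" by (rule X.Alt_module)
  interpret YA: module R "Y.Alt n" by (rule Y.Alt_module)
  show ?thesis
    by (rule compatibleI) (auto simp: X.Alt_ops_apply Y.Alt_ops_apply res_M_hom cnj_M_hom trf_M_hom
      first_transfer_def first_transfer_tuples tuples_res tuples_cnj)
qed

lemma compatible_add:
  assumes "compatible n f f'" "compatible n k k'"
  shows "compatible n (f \<oplus>\<^bsub>X.Alt n\<^esub> k) (f' \<oplus>\<^bsub>Y.Alt n\<^esub> k')"
proof -
  interpret XA: module R "X.Alt n" by (rule X.Alt_module)
  interpret YA: module R "Y.Alt n" by (rule Y.Alt_module)
  note cf = compatibleD[OF assms(1)] and ck = compatibleD[OF assms(2)]
  have v: "f as \<in> carrier (at_Cp M)" "k as \<in> carrier (at_Cp M)" if "as \<in> tuples (at_Cp L) n" for as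
    using X.alt_mapsD(3)[OF cf(1)] X.alt_mapsD(3)[OF ck(1)] that by auto
  have v': "f' as \<in> carrier (at_e M)" "k' as \<in> carrier (at_e M)" if "as \<in> tuples (at_e L) n" for as
    using Y.alt_mapsD(3)[OF cf(2)] Y.alt_mapsD(3)[OF ck(2)] that by auto
  show ?thesis
  proof (rule compatibleI)
    show "first_transfer n (f \<oplus>\<^bsub>X.Alt n\<^esub> k) (f' \<oplus>\<^bsub>Y.Alt n\<^esub> k')"
      using cf(6) ck(6) unfolding first_transfer_def
      by (simp add: first_transfer_tuples X.Alt_ops_apply Y.Alt_ops_apply v' linear_mapD(2)[OF M.trf_linear])
  qed (auto simp: cf(1,2) ck(1,2) X.Alt_ops_apply Y.Alt_ops_apply tuples_res tuples_cnj v v'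
      linear_mapD(2)[OF M.res_linear] linear_mapD(2)[OF M.cnj_linear] cf(3,4) ck(3,4))
qed

lemma compatible_smult:
  assumes "compatible n f f'" and s: "s \<in> carrier R"
  shows "compatible n (s \<odot>\<^bsub>X.Alt n\<^esub> f) (s \<odot>\<^bsub>Y.Alt n\<^esub> f')"
proof -
  interpret XA: module R "X.Alt n" by (rule X.Alt_module)
  interpret YA: module R "Y.Alt n" by (rule Y.Alt_module)
  note cf = compatibleD[OF assms(1)]
  have v: "f as \<in> carrier (at_Cp M)" if "as \<in> tuples (at_Cp L) n" for as
    using X.alt_mapsD(3)[OF cf(1)] that by auto
  have v': "f' as \<in> carrier (at_e M)" if "as \<in> tuples (at_e L) n" for as
    using Y.alt_mapsD(3)[OF cf(2)] that by auto
  show ?thesis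
  proof (rule compatibleI)
    show "first_transfer n (s \<odot>\<^bsub>X.Alt n\<^esub> f) (s \<odot>\<^bsub>Y.Alt n\<^esub> f')"
      using cf(6) unfolding first_transfer_def
      by (simp add: first_transfer_tuples X.Alt_ops_apply Y.Alt_ops_apply v' linear_mapD(3)[OF M.trf_linear] s)
  qed (auto simp: cf(1,2) s X.Alt_ops_apply Y.Alt_ops_apply tuples_res tuples_cnj v v'
      linear_mapD(3)[OF M.res_linear] linear_mapD(3)[OF M.cnj_linear] cf(3,4))
qed

lemma CC_module: "module R (CC n)"
proof -
  interpret XA: module R "X.Alt n" by (rule X.Alt_module)
  interpret YA: module R "Y.Alt n" by (rule Y.Alt_module)
  note [simp] = CC_carrier' CC_ops compatible_zero compatible_add compatible_smult
  show ?thesis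
  proof (rule moduleI)
    show "cring R" by (rule X.R.is_cring)
    show "abelian_group (CC n)"
    proof (rule abelian_groupI)
      fix u assume "u \<in> carrier (CC n)"
      then obtain f f' where u: "u = (f, f')" "compatible n f f'" by auto
      show "\<exists>v\<in>carrier (CC n). v \<oplus>\<^bsub>CC n\<^esub> u = \<zero>\<^bsub>CC n\<^esub>"
      proof
        show "(\<ominus>\<^bsub>R\<^esub> \<one>\<^bsub>R\<^esub>) \<odot>\<^bsub>CC n\<^esub> u \<in> carrier (CC n)"
          using compatible_smult[OF u(2), of "\<ominus>\<^bsub>R\<^esub> \<one>\<^bsub>R\<^esub>"] compatibleD(1,2)[OF u(2)] by (simp add: u(1))
        show "(\<ominus>\<^bsub>R\<^esub> \<one>\<^bsub>R\<^esub>) \<odot>\<^bsub>CC n\<^esub> u \<oplus>\<^bsub>CC n\<^esub> u = \<zero>\<^bsub>CC n\<^esub>"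
          using u(1) compatibleD(1,2)[OF u(2)]
          by (simp add: XA.smult_l_minus YA.smult_l_minus XA.M.l_neg YA.M.l_neg)
      qed
    qed (auto simp: XA.M.a_ac YA.M.a_ac)
  qed (auto simp: XA.smult_l_distr YA.smult_l_distr XA.smult_r_distr YA.smult_r_distr
      XA.smult_assoc1 YA.smult_assoc1)
qed

text \<open>Additive inverses are given by a description over the carrier of pairs, hence not
  componentwise by definition; multiplication by -1 is, and the two agree.\<close>

lemma CC_uminus:
  assumes "compatible n f f'"
  shows "\<ominus>\<^bsub>CC n\<^esub> (f, f') = (\<ominus>\<^bsub>X.Alt n\<^esub> f, \<ominus>\<^bsub>Y.Alt n\<^esub> f')"
proof -
  interpret XA: module R "X.Alt n" by (rule X.Alt_module)
  interpret YA: module R "Y.Alt n" by (rule Y.Alt_module)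
  interpret C: module R "CC n" by (rule CC_module)
  have "\<ominus>\<^bsub>CC n\<^esub> (f, f') = (\<ominus>\<^bsub>R\<^esub> \<one>\<^bsub>R\<^esub>) \<odot>\<^bsub>CC n\<^esub> (f, f')"
    using assms by (subst C.smult_l_minus) (auto simp: CC_carrier)
  then show ?thesis
    using compatibleD(1,2)[OF assms] by (simp add: CC_ops XA.smult_l_minus YA.smult_l_minus)
qed

lemma CC_sign:
  assumes "compatible n f f'"
  shows "add_pow (CC n) ((-1::int) ^ k) (f, f') = (add_pow (X.Alt n) ((-1::int) ^ k) f, add_pow (Y.Alt n) ((-1::int) ^ k) f')"
proof -
  interpret XA: module R "X.Alt n" by (rule X.Alt_module)
  interpret YA: module R "Y.Alt n" by (rule Y.Alt_module)
  interpret C: module R "CC n" by (rule CC_module)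
  have "(f, f') \<in> carrier (CC n)" using assms by (simp add: CC_carrier)
  then show ?thesis
    using compatibleD(1,2)[OF assms] CC_uminus[OF assms]
    by (cases "even k") (simp_all add: C.M.add_pow_one XA.M.add_pow_one YA.M.add_pow_one
      C.M.add_pow_neg_one XA.M.add_pow_neg_one YA.M.add_pow_neg_one)
qed

sublocale E: dg_lie R "alt_maps R (at_e L) (at_e M)" Y.CE Y.CUP
  by (rule Y.dg_lie_Alt)

text \<open>Each component satisfies the identities already, so the work lies in supplying
  compatibility of the pairs: it gives closure, and under it signs and inverses are computed
  componentwise.\<close>

lemma dg_lie_CC: "dg_lie R CC dC cupC"
proof -
  interpret D: dg_lie R "alt_maps R (at_Cp L) (at_Cp M)" X.CE X.CUP by (rule X.dg_lie_Alt)
  note b = bilinear_mapD[OF D.P_bilinear] bilinear_mapD[OF E.P_bilinear]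
  note ccl = compatible_ce_diff compatible_cup compatible_add compatible_smult
  show ?thesis
  proof (rule dg_lie.intro)
    show "module R (CC n)" for n by (rule CC_module)
    show "linear_map R (CC n) (CC (Suc n)) (dC n)" for n
    proof (rule linear_mapI)
      fix u assume "u \<in> carrier (CC n)"
      then obtain f f' where u: "u = (f, f')" "compatible n f f'" by (auto simp: CC_carrier)
      note cu = compatibleD(1,2)[OF u(2)]
      show "dC n u \<in> carrier (CC (Suc n))" using u by (simp add: CC_carrier dC_apply compatible_ce_diff)
      show "dC n (s \<odot>\<^bsub>CC n\<^esub> u) = s \<odot>\<^bsub>CC (Suc n)\<^esub> dC n u" if "s \<in> carrier R" for s
        using cu that by (simp add: u CC_ops dC_apply linear_mapD(3)[OF D.d_linear] linear_mapD(3)[OF E.d_linear])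
      fix v assume "v \<in> carrier (CC n)"
      then obtain k k' where v: "v = (k, k')" "compatible n k k'" by (auto simp: CC_carrier)
      note cv = compatibleD(1,2)[OF v(2)]
      show "dC n (u \<oplus>\<^bsub>CC n\<^esub> v) = dC n u \<oplus>\<^bsub>CC (Suc n)\<^esub> dC n v"
        using cu cv by (simp add: u v CC_ops dC_apply linear_mapD(2)[OF D.d_linear] linear_mapD(2)[OF E.d_linear])
    qed
    show "dC (Suc n) (dC n f) = \<zero>\<^bsub>CC (Suc (Suc n))\<^esub>" if "f \<in> carrier (CC n)" for f n
      using that by (auto simp: CC_carrier' CC_ops dC_apply D.d_d E.d_d)
    show "bilinear_map R (CC m) (CC n) (CC (m + n)) (cupC m n)" for m n
      unfolding bilinear_map_def
      by (intro conjI ballI linear_mapI)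
        (auto simp: CC_carrier' CC_ops cupC_apply compatible_cup b)
    show "dC (m + n) (cupC m n f k) = cupC (Suc m) n (dC m f) k \<oplus>\<^bsub>CC (Suc (m + n))\<^esub>
        add_pow (CC (Suc (m + n))) ((-1::int) ^ m) (cupC m (Suc n) f (dC n k))"
      if fk: "f \<in> carrier (CC m)" "k \<in> carrier (CC n)" for f m k n
    proof -
      obtain f1 f2 k1 k2 where e: "f = (f1, f2)" "k = (k1, k2)" and c: "compatible m f1 f2" "compatible n k1 k2"
        using fk by (auto simp: CC_carrier)
      have "compatible (Suc (m + n)) (X.CUP m (Suc n) f1 (X.CE n k1)) (Y.CUP m (Suc n) f2 (Y.CE n k2))"
        using compatible_cup[OF c(1) compatible_ce_diff[OF c(2)]] by simp
      then show ?thesis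
        using D.P_leibniz[OF compatibleD(1)[OF c(1)] compatibleD(1)[OF c(2)]]
          E.P_leibniz[OF compatibleD(2)[OF c(1)] compatibleD(2)[OF c(2)]]
        by (simp add: e dC_apply cupC_apply CC_ops CC_sign)
    qed
    show "cupC m n f k = \<ominus>\<^bsub>CC (m + n)\<^esub> (add_pow (CC (m + n)) ((-1::int) ^ (m * n)) (cupC n m k f))"
      if fk: "f \<in> carrier (CC m)" "k \<in> carrier (CC n)" for f m k n
    proof -
      interpret C: module R "CC (m + n)" by (rule CC_module)
      obtain f1 f2 k1 k2 where e: "f = (f1, f2)" "k = (k1, k2)" and c: "compatible m f1 f2" "compatible n k1 k2"
        using fk by (auto simp: CC_carrier)
      have c': "compatible (m + n) (X.CUP n m k1 f1) (Y.CUP n m k2 f2)"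
        using compatible_cup[OF c(2,1)] by (simp add: add.commute)
      then have "(X.CUP n m k1 f1, Y.CUP n m k2 f2) \<in> carrier (CC (m + n))" by (simp add: CC_carrier)
      then have "add_pow (CC (m + n)) ((-1::int) ^ (m * n)) (X.CUP n m k1 f1, Y.CUP n m k2 f2) \<in> carrier (CC (m + n))"
        by (rule C.M.add_pow_sign_closed)
      then have "compatible (m + n) (add_pow (X.Alt (m + n)) ((-1::int) ^ (m * n)) (X.CUP n m k1 f1))
          (add_pow (Y.Alt (m + n)) ((-1::int) ^ (m * n)) (Y.CUP n m k2 f2))"
        by (simp add: CC_sign[OF c'] CC_carrier)
      then show ?thesis
        using D.P_antisym[OF compatibleD(1)[OF c(1)] compatibleD(1)[OF c(2)]]
          E.P_antisym[OF compatibleD(2)[OF c(1)] compatibleD(2)[OF c(2)]]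
        by (simp add: e cupC_apply CC_sign[OF c'] CC_uminus)
    qed
    show "cupC i (j + n) f (cupC j n k l) = cupC (i + j) n (cupC i j f k) l \<oplus>\<^bsub>CC (i + j + n)\<^esub>
        add_pow (CC (i + j + n)) ((-1::int) ^ (i * j)) (cupC j (i + n) k (cupC i n f l))"
      if fk: "f \<in> carrier (CC i)" "k \<in> carrier (CC j)" "l \<in> carrier (CC n)" for f i k j l n
    proof -
      obtain f1 f2 k1 k2 l1 l2 where e: "f = (f1, f2)" "k = (k1, k2)" "l = (l1, l2)"
        and c: "compatible i f1 f2" "compatible j k1 k2" "compatible n l1 l2"
        using fk by (auto simp: CC_carrier)
      have "compatible (i + j + n) (X.CUP j (i + n) k1 (X.CUP i n f1 l1)) (Y.CUP j (i + n) k2 (Y.CUP i n f2 l2))"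
        using compatible_cup[OF c(2) compatible_cup[OF c(1,3)]] by (simp add: ac_simps)
      then show ?thesis
        using D.P_jacobi[OF compatibleD(1)[OF c(1)] compatibleD(1)[OF c(2)] compatibleD(1)[OF c(3)]]
          E.P_jacobi[OF compatibleD(2)[OF c(1)] compatibleD(2)[OF c(2)] compatibleD(2)[OF c(3)]]
        by (simp add: e cupC_apply CC_ops CC_sign)
    qed
    show "cupC i i f f = \<zero>\<^bsub>CC (i + i)\<^esub>" if "even i" "f \<in> carrier (CC i)" for i f
      using that by (auto simp: CC_carrier' CC_ops cupC_apply D.P_even E.P_even)
    show "cupC i (i + i) f (cupC i i f f) = \<zero>\<^bsub>CC (i + (i + i))\<^esub>" if "odd i" "f \<in> carrier (CC i)" for i f
      using that by (auto simp: CC_carrier' CC_ops cupC_apply D.P_odd E.P_odd)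
  qed
qed

sublocale C: dg_lie R CC dC cupC
  by (rule dg_lie_CC)

section \<open>Conjugation and transfer of cochains\<close>

abbreviation conj where "conj \<equiv> conjugate_cochain G L M"
abbreviation T where "T \<equiv> transfer_cochain p g L M"

lemma conj_apply: "xs \<in> tuples (at_e L) n \<Longrightarrow> conj n h f xs = cnj M h (f (map (cnj L (inv\<^bsub>G\<^esub> h)) xs))"
  by (simp add: conjugate_cochain_def)

lemma conj_closed: "h \<in> carrier G \<Longrightarrow> f \<in> carrier (Y.Alt n) \<Longrightarrow> conj n h f \<in> carrier (Y.Alt n)"
  unfolding conjugate_cochain_def
  by (rule alt_maps_compose[OF _ L.cnj_linear M.cnj_linear L.module_e M.module_e M.module_e]) auto

lemma cnj_L_inv: "h \<in> carrier G \<Longrightarrow> x \<in> carrier (at_e L) \<Longrightarrow> cnj L (inv\<^bsub>G\<^esub> h) (cnj L h x) = x"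
  by (simp flip: L.cnj_mult add: L.cnj_one)

lemma map_cnj_L_inv: "h \<in> carrier G \<Longrightarrow> xs \<in> tuples (at_e L) n \<Longrightarrow> map (cnj L (inv\<^bsub>G\<^esub> h)) (map (cnj L h) xs) = xs"
  using cnj_L_inv by (auto simp: tuples_def intro!: map_idI)

lemma map_cnj_L_mult: "h \<in> carrier G \<Longrightarrow> k \<in> carrier G \<Longrightarrow> xs \<in> tuples (at_e L) n \<Longrightarrow>
    map (cnj L h) (map (cnj L k) xs) = map (cnj L (h \<otimes>\<^bsub>G\<^esub> k)) xs"
  using L.cnj_mult by (auto simp: tuples_def)

lemma Y_value: "f \<in> carrier (Y.Alt n) \<Longrightarrow> xs \<in> tuples (at_e L) n \<Longrightarrow> f xs \<in> carrier (at_e M)"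
  using Y.alt_mapsD(3) by auto

lemma conj_linear:
  assumes h: "h \<in> carrier G"
  shows "linear_map R (Y.Alt n) (Y.Alt n) (conj n h)"
proof (rule linear_mapI)
  interpret YA: module R "Y.Alt n" by (rule Y.Alt_module)
  fix f assume f: "f \<in> carrier (Y.Alt n)"
  show "conj n h f \<in> carrier (Y.Alt n)" by (rule conj_closed[OF h f])
  show "conj n h (f \<oplus>\<^bsub>Y.Alt n\<^esub> f') = conj n h f \<oplus>\<^bsub>Y.Alt n\<^esub> conj n h f'" if f': "f' \<in> carrier (Y.Alt n)" for f'
    by (rule Y.Alt_ext[of _ n]) (auto simp: h f f' conj_closed conj_apply Y.Alt_ops_apply tuples_cnj
      linear_mapD[OF M.cnj_linear] Y_value[OF f] Y_value[OF f'])
  show "conj n h (s \<odot>\<^bsub>Y.Alt n\<^esub> f) = s \<odot>\<^bsub>Y.Alt n\<^esub> conj n h f" if s: "s \<in> carrier R" for s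
    by (rule Y.Alt_ext[of _ n]) (auto simp: h f s conj_closed conj_apply Y.Alt_ops_apply tuples_cnj
      linear_mapD[OF M.cnj_linear] Y_value[OF f])
qed

lemma conj_one: "f \<in> carrier (Y.Alt n) \<Longrightarrow> conj n \<one>\<^bsub>G\<^esub> f = f"
proof (rule Y.Alt_ext[of _ n])
  fix xs assume f: "f \<in> carrier (Y.Alt n)" and xs: "xs \<in> tuples (at_e L) n"
  have "map (cnj L \<one>\<^bsub>G\<^esub>) xs = xs" using xs L.cnj_one by (auto simp: tuples_def intro!: map_idI)
  then show "conj n \<one>\<^bsub>G\<^esub> f xs = f xs" using xs by (simp add: conj_apply M.cnj_one Y_value[OF f])
qed (auto intro: conj_closed)

lemma conj_mult:
  assumes "h \<in> carrier G" "k \<in> carrier G" "f \<in> carrier (Y.Alt n)"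
  shows "conj n (h \<otimes>\<^bsub>G\<^esub> k) f = conj n h (conj n k f)"
proof (rule Y.Alt_ext[of _ n])
  fix xs assume xs: "xs \<in> tuples (at_e L) n"
  show "conj n (h \<otimes>\<^bsub>G\<^esub> k) f xs = conj n h (conj n k f) xs"
    using assms xs by (simp add: conj_apply tuples_cnj map_cnj_L_mult inv_mult_group M.cnj_mult Y_value del: map_map)
qed (auto intro!: conj_closed assms)

lemma conj_equivariant: "h \<in> carrier G \<Longrightarrow> xs \<in> tuples (at_e L) n \<Longrightarrow> cnj M h (f xs) = conj n h f (map (cnj L h) xs)"
  by (simp add: conj_apply tuples_cnj map_cnj_L_inv del: map_map)

text \<open>Trades the inverse in the definition of conjugation for the equivariance c_h f(x) =
  f'(c_h x), the shape in which \<open>ce_diff_conj\<close> and \<open>cup_conj\<close>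
  apply.\<close>

lemma conj_eqI:
  assumes "h \<in> carrier G" "f \<in> carrier (Y.Alt n)" "f' \<in> carrier (Y.Alt n)"
    "\<And>xs. xs \<in> tuples (at_e L) n \<Longrightarrow> cnj M h (f xs) = f' (map (cnj L h) xs)"
  shows "conj n h f = f'"
proof (rule Y.Alt_ext[of _ n])
  fix xs assume xs: "xs \<in> tuples (at_e L) n"
  have "map (cnj L h) (map (cnj L (inv\<^bsub>G\<^esub> h)) xs) = xs"
    using map_cnj_L_inv[of "inv\<^bsub>G\<^esub> h" xs n] assms(1) xs by simp
  then show "conj n h f xs = f' xs"
    using assms(4)[of "map (cnj L (inv\<^bsub>G\<^esub> h)) xs"] assms(1) xs by (simp add: conj_apply tuples_cnj del: map_map)
qed (use assms in \<open>auto intro: conj_closed\<close>)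

lemma conj_ce_diff:
  assumes "h \<in> carrier G" "f \<in> carrier (Y.Alt n)"
  shows "conj (Suc n) h (Y.CE n f) = Y.CE n (conj n h f)"
  by (rule conj_eqI[OF assms(1) Y.CE_closed[OF assms(2)] Y.CE_closed[OF conj_closed[OF assms]]])
    (rule ce_diff_conj[OF assms(2) conj_closed[OF assms] assms(1) conj_equivariant[OF assms(1)]])

lemma conj_cup:
  assumes "h \<in> carrier G" "f \<in> carrier (Y.Alt m)" "k \<in> carrier (Y.Alt n)"
  shows "conj (m + n) h (Y.CUP m n f k) = Y.CUP m n (conj m h f) (conj n h k)"
  by (rule conj_eqI[OF assms(1) Y.CUP_closed[OF assms(2,3)] Y.CUP_closed[OF conj_closed[OF assms(1,2)] conj_closed[OF assms(1,3)]]])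
    (rule cup_conj[OF assms(2) conj_closed[OF assms(1,2)] assms(3) conj_closed[OF assms(1,3)] assms(1)
      conj_equivariant[OF assms(1)] conj_equivariant[OF assms(1)]])

lemma conj_fixed: "compatible n f f' \<Longrightarrow> h \<in> carrier G \<Longrightarrow> conj n h f' = f'"
  by (rule conj_eqI) (auto intro: compatibleD)

text \<open>As g generates, its order is that of the group, so its first p powers run through the
  group exactly once.\<close>

lemma finite_G: "finite (carrier G)" and generator_pow: "g [^]\<^bsub>G\<^esub> p = \<one>\<^bsub>G\<^esub>"
  and bij_pow: "bij_betw (\<lambda>i. g [^]\<^bsub>G\<^esub> i) {..<p} (carrier G)"
proof -
  have p: "0 < p" using prime by (rule prime_gt_0_nat)
  show fin: "finite (carrier G)" using order p by (metis order_gt_0_iff_finite)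
  have og: "ord g = p" using generate_pow_card[OF generator(1)] generator(2) order by (simp add: order_def)
  show "g [^]\<^bsub>G\<^esub> p = \<one>\<^bsub>G\<^esub>" using pow_ord_eq_1[OF generator(1)] og by simp
  have e: "{0..ord g - 1} = {..<p}" using p og by auto
  have inj: "inj_on (\<lambda>i. g [^]\<^bsub>G\<^esub> i) {..<p}" using ord_inj[OF generator(1)] unfolding e .
  have "(\<lambda>i. g [^]\<^bsub>G\<^esub> i) ` {..<p} = carrier G"
    by (rule card_subset_eq[OF fin]) (use generator(1) card_image[OF inj] order in \<open>auto simp: order_def\<close>)
  then show "bij_betw (\<lambda>i. g [^]\<^bsub>G\<^esub> i) {..<p} (carrier G)" using inj by (simp add: bij_betw_def)
qed

text \<open>The norm of f for the action of the group on cochains. Summing over the group instead of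
  over powers of g makes invariance under translation available.\<close>

definition conj_sum :: "nat \<Rightarrow> ('le list \<Rightarrow> 'me) \<Rightarrow> 'le list \<Rightarrow> 'me" where
  "conj_sum n f = (\<Oplus>\<^bsub>Y.Alt n\<^esub>h\<in>carrier G. conj n h f)"

lemma conj_sum_closed: "f \<in> carrier (Y.Alt n) \<Longrightarrow> conj_sum n f \<in> carrier (Y.Alt n)"
proof -
  interpret YA: module R "Y.Alt n" by (rule Y.Alt_module)
  show "f \<in> carrier (Y.Alt n) \<Longrightarrow> conj_sum n f \<in> carrier (Y.Alt n)"
    unfolding conj_sum_def by (rule YA.M.finsum_closed) (auto intro: conj_closed)
qed

lemma conj_sum_apply:
  assumes "f \<in> carrier (Y.Alt n)" "xs \<in> tuples (at_e L) n"
  shows "conj_sum n f xs = (\<Oplus>\<^bsub>at_e M\<^esub>h\<in>carrier G. conj n h f xs)"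
  unfolding conj_sum_def using assms finite_G by (intro Y.Alt_sum_apply) (auto intro: conj_closed)

lemma cnj_power:
  "u \<in> carrier (at_e M) \<Longrightarrow> (cnj M g ^^ i) u = cnj M (g [^]\<^bsub>G\<^esub> i) u"
  "x \<in> carrier (at_e L) \<Longrightarrow> (cnj L g ^^ i) x = cnj L (g [^]\<^bsub>G\<^esub> i) x"
proof -
  have g: "g [^]\<^bsub>G\<^esub> Suc i = g \<otimes>\<^bsub>G\<^esub> g [^]\<^bsub>G\<^esub> i" for i
    using generator(1) by (rule nat_pow_Suc2)
  show "u \<in> carrier (at_e M) \<Longrightarrow> (cnj M g ^^ i) u = cnj M (g [^]\<^bsub>G\<^esub> i) u"
    by (induction i) (simp_all only: funpow.simps id_apply comp_apply nat_pow_0 M.cnj_one M.cnj_mult generator(1) nat_pow_closed g)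
  show "x \<in> carrier (at_e L) \<Longrightarrow> (cnj L g ^^ i) x = cnj L (g [^]\<^bsub>G\<^esub> i) x"
    by (induction i) (simp_all only: funpow.simps id_apply comp_apply nat_pow_0 L.cnj_one L.cnj_mult generator(1) nat_pow_closed g)
qed

lemma T_eq:
  assumes f: "f \<in> carrier (Y.Alt n)"
  shows "T n f = ((\<lambda>as\<in>tuples (at_Cp L) n. trf M (f (map (res L) as))), conj_sum n f)"
proof -
  have "(\<lambda>xs\<in>tuples (at_e L) n. \<Oplus>\<^bsub>at_e M\<^esub>i\<in>{..<p}. (cnj M g ^^ i) (f (map (cnj L g ^^ (p - i)) xs))) = conj_sum n f"
  proof (rule extensionalityI[of _ "tuples (at_e L) n"])
    show "conj_sum n f \<in> extensional (tuples (at_e L) n)" by (rule Y.alt_mapsD(2)[OF conj_sum_closed[OF f]])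
    fix xs assume xs: "xs \<in> tuples (at_e L) n"
    have "conj_sum n f xs = (\<Oplus>\<^bsub>at_e M\<^esub>h\<in>(\<lambda>i. g [^]\<^bsub>G\<^esub> i) ` {..<p}. conj n h f xs)"
      unfolding conj_sum_apply[OF f xs] using bij_pow by (simp add: bij_betw_def)
    also have "\<dots> = (\<Oplus>\<^bsub>at_e M\<^esub>i\<in>{..<p}. conj n (g [^]\<^bsub>G\<^esub> i) f xs)"
      by (rule Y.B.M.finsum_reindex) (use bij_pow conj_closed[OF _ f] Y_value xs in \<open>auto simp: bij_betw_def\<close>)
    also have "\<dots> = (\<Oplus>\<^bsub>at_e M\<^esub>i\<in>{..<p}. (cnj M g ^^ i) (f (map (cnj L g ^^ (p - i)) xs)))"
    proof (rule Y.B.M.finsum_cong')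
      \<comment> \<open>The exponent p - i gives the inverse of the i-th power of g; for i = 0 it is
        p, which is correct because g^p = 1.\<close>
      fix i assume i: "i \<in> {..<p}"
      have gi: "g [^]\<^bsub>G\<^esub> i \<in> carrier G" "g [^]\<^bsub>G\<^esub> (p - i) \<in> carrier G" using generator(1) by auto
      have "g [^]\<^bsub>G\<^esub> (p - i) \<otimes>\<^bsub>G\<^esub> g [^]\<^bsub>G\<^esub> i = \<one>\<^bsub>G\<^esub>"
        using i generator(1) by (simp add: nat_pow_mult generator_pow)
      then have "inv\<^bsub>G\<^esub> (g [^]\<^bsub>G\<^esub> i) = g [^]\<^bsub>G\<^esub> (p - i)" by (rule inv_equality[OF _ gi])
      moreover have m: "map (cnj L g ^^ (p - i)) xs = map (cnj L (g [^]\<^bsub>G\<^esub> (p - i))) xs"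
        using xs cnj_power(2) by (auto simp: tuples_def)
      moreover have "f (map (cnj L (g [^]\<^bsub>G\<^esub> (p - i))) xs) \<in> carrier (at_e M)"
        by (rule Y_value[OF f tuples_cnj[OF gi(2) xs]])
      ultimately show "conj n (g [^]\<^bsub>G\<^esub> i) f xs = (cnj M g ^^ i) (f (map (cnj L g ^^ (p - i)) xs))"
        using xs by (simp only: m conj_apply cnj_power(1))
    next
      show "(\<lambda>i. (cnj M g ^^ i) (f (map (cnj L g ^^ (p - i)) xs))) \<in> {..<p} \<rightarrow> carrier (at_e M)"
      proof
        fix i
        have gi: "g [^]\<^bsub>G\<^esub> i \<in> carrier G" "g [^]\<^bsub>G\<^esub> (p - i) \<in> carrier G" using generator(1) by auto
        have m: "map (cnj L g ^^ (p - i)) xs = map (cnj L (g [^]\<^bsub>G\<^esub> (p - i))) xs"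
          using xs cnj_power(2) by (auto simp: tuples_def)
        have "f (map (cnj L (g [^]\<^bsub>G\<^esub> (p - i))) xs) \<in> carrier (at_e M)"
          by (rule Y_value[OF f tuples_cnj[OF gi(2) xs]])
        then show "(cnj M g ^^ i) (f (map (cnj L g ^^ (p - i)) xs)) \<in> carrier (at_e M)"
          by (simp add: m cnj_power(1) cnj_M gi)
      qed
    qed simp
    finally show "(\<lambda>xs\<in>tuples (at_e L) n. \<Oplus>\<^bsub>at_e M\<^esub>i\<in>{..<p}. (cnj M g ^^ i) (f (map (cnj L g ^^ (p - i)) xs))) xs = conj_sum n f xs"
      using xs by simp
  qed simp
  then show ?thesis by (simp add: transfer_cochain_def)
qed

lemma sum_G_left:
  assumes "k \<in> carrier G" "F \<in> carrier G \<rightarrow> carrier (at_e M)"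
  shows "(\<Oplus>\<^bsub>at_e M\<^esub>h\<in>carrier G. F (k \<otimes>\<^bsub>G\<^esub> h)) = (\<Oplus>\<^bsub>at_e M\<^esub>h\<in>carrier G. F h)"
proof -
  have "(\<lambda>h. k \<otimes>\<^bsub>G\<^esub> h) ` carrier G = carrier G" by (rule surj_const_mult[OF assms(1)])
  moreover have "inj_on (\<lambda>h. k \<otimes>\<^bsub>G\<^esub> h) (carrier G)" by (rule inj_on_cmult) (rule assms(1))
  ultimately show ?thesis using Y.B.M.finsum_reindex[of F "\<lambda>h. k \<otimes>\<^bsub>G\<^esub> h" "carrier G"] assms(2) by simp
qed


lemma sum_G_right:
  assumes "k \<in> carrier G" "F \<in> carrier G \<rightarrow> carrier N" "abelian_group N"
  shows "(\<Oplus>\<^bsub>N\<^esub>h\<in>carrier G. F (h \<otimes>\<^bsub>G\<^esub> k)) = (\<Oplus>\<^bsub>N\<^esub>h\<in>carrier G. F h)"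
proof -
  interpret N: abelian_group N by (rule assms(3))
  have "(\<lambda>h. h \<otimes>\<^bsub>G\<^esub> k) ` carrier G = carrier G"
  proof
    show "carrier G \<subseteq> (\<lambda>h. h \<otimes>\<^bsub>G\<^esub> k) ` carrier G"
    proof
      fix h assume "h \<in> carrier G"
      then show "h \<in> (\<lambda>h. h \<otimes>\<^bsub>G\<^esub> k) ` carrier G"
        using assms(1) by (intro image_eqI[of _ _ "h \<otimes>\<^bsub>G\<^esub> inv\<^bsub>G\<^esub> k"]) (auto simp: m_assoc)
    qed
  qed (use assms(1) in auto)
  then show ?thesis using N.finsum_reindex[of F "\<lambda>h. h \<otimes>\<^bsub>G\<^esub> k" "carrier G"] assms inj_on_multc by simp
qed

lemma sum_G_inv:
  assumes "F \<in> carrier G \<rightarrow> carrier N" "abelian_group N"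
  shows "(\<Oplus>\<^bsub>N\<^esub>h\<in>carrier G. F (inv\<^bsub>G\<^esub> h)) = (\<Oplus>\<^bsub>N\<^esub>h\<in>carrier G. F h)"
proof -
  interpret N: abelian_group N by (rule assms(2))
  have "(\<lambda>h. inv\<^bsub>G\<^esub> h) ` carrier G = carrier G" by (force intro: image_eqI[of _ _ "inv\<^bsub>G\<^esub> _"])
  moreover have "inj_on (\<lambda>h. inv\<^bsub>G\<^esub> h) (carrier G)" by (metis inj_onI inv_inv)
  ultimately show ?thesis using N.finsum_reindex[of F "\<lambda>h. inv\<^bsub>G\<^esub> h" "carrier G"] assms by simp
qed

text \<open>For restriction, r t is the sum of all conjugations and restricted arguments are fixed
  by them. For equivariance, left translation permutes the group. For transfer, r(t(x)) is the sum
  of the conjugates of x, f is linear in that argument, and t absorbs conjugations.\<close>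

lemma compatible_T:
  assumes f: "f \<in> carrier (Y.Alt n)"
  shows "compatible n (\<lambda>as\<in>tuples (at_Cp L) n. trf M (f (map (res L) as))) (conj_sum n f)" (is "compatible n ?\<mu> _")
proof (rule compatibleI)
  show "?\<mu> \<in> carrier (X.Alt n)"
    by (rule alt_maps_compose[OF f L.res_linear M.trf_linear L.module_Cp M.module_e M.module_Cp])
  show "conj_sum n f \<in> carrier (Y.Alt n)" by (rule conj_sum_closed[OF f])
  have v: "conj n h f xs \<in> carrier (at_e M)" if "h \<in> carrier G" "xs \<in> tuples (at_e L) n" for h xs
    using Y_value[OF conj_closed[OF that(1) f] that(2)] .
  have w: "f (map (cnj L h) xs) \<in> carrier (at_e M)" if "h \<in> carrier G" "xs \<in> tuples (at_e L) n" for h xs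
    using Y_value[OF f tuples_cnj[OF that]] .
  show "res M (?\<mu> as) = conj_sum n f (map (res L) as)" if as: "as \<in> tuples (at_Cp L) n" for as
  proof -
    have e: "map (cnj L (inv\<^bsub>G\<^esub> h)) (map (res L) as) = map (res L) as" if "h \<in> carrier G" for h
      using as L.cnj_res that by (auto simp: tuples_def)
    have fv: "f (map (res L) as) \<in> carrier (at_e M)" by (rule Y_value[OF f tuples_res[OF as]])
    have "res M (?\<mu> as) = (\<Oplus>\<^bsub>at_e M\<^esub>h\<in>carrier G. cnj M h (f (map (res L) as)))"
      using as by (simp add: M.res_trf[OF fv])
    also have "\<dots> = (\<Oplus>\<^bsub>at_e M\<^esub>h\<in>carrier G. conj n h f (map (res L) as))"
      by (rule Y.B.M.finsum_cong') (use v tuples_res[OF as] e in \<open>auto simp: conj_apply simp del: map_map\<close>)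
    finally show ?thesis by (simp add: conj_sum_apply[OF f tuples_res[OF as]])
  qed
  show "cnj M k (conj_sum n f xs) = conj_sum n f (map (cnj L k) xs)"
    if k: "k \<in> carrier G" and xs: "xs \<in> tuples (at_e L) n" for k xs
  proof -
    let ?ys = "map (cnj L k) xs"
    have ys: "?ys \<in> tuples (at_e L) n" by (rule tuples_cnj[OF k xs])
    have "conj_sum n f ?ys = (\<Oplus>\<^bsub>at_e M\<^esub>h\<in>carrier G. conj n (k \<otimes>\<^bsub>G\<^esub> h) f ?ys)"
      unfolding conj_sum_apply[OF f ys] using v ys by (intro sum_G_left[OF k, symmetric]) auto
    also have "\<dots> = (\<Oplus>\<^bsub>at_e M\<^esub>h\<in>carrier G. cnj M k (conj n h f xs))"
    proof (rule Y.B.M.finsum_cong')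
      fix h assume h: "h \<in> carrier G"
      show "conj n (k \<otimes>\<^bsub>G\<^esub> h) f ?ys = cnj M k (conj n h f xs)"
        unfolding conj_mult[OF k h f] by (rule conj_equivariant[OF k xs, symmetric])
    qed (use cnj_M[OF k] v xs in auto)
    also have "\<dots> = cnj M k (conj_sum n f xs)"
      unfolding conj_sum_apply[OF f xs]
      by (rule linear_map_group_hom(4)[OF M.module_e M.module_e M.cnj_linear[OF k] finite_G, symmetric])
        (use v xs in auto)
    finally show ?thesis by simp
  qed
  show "first_transfer n ?\<mu> (conj_sum n f)"
    unfolding first_transfer_def
  proof (intro allI impI)
    fix as x assume x: "x \<in> carrier (at_e L)" and l: "Suc (length as) = n" and as: "as \<in> tuples (at_Cp L) (length as)"
    note t = first_transfer_tuples[OF x l as]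
    let ?bs = "map (res L) as"
    have lin: "linear_map R (at_e L) (at_e M) (\<lambda>y. f (y # ?bs))"
      using Y.alt_mapsD(4)[OF f, unfolded multilinear_def, rule_format, OF t(2), of 0] l by auto
    note linM = linear_map_compose[OF lin M.trf_linear]
    have c: "cnj L h x \<in> carrier (at_e L)" if "h \<in> carrier G" for h using cnj_L[OF that x] .
    have "?\<mu> (trf L x # as) = trf M (f ((\<Oplus>\<^bsub>at_e L\<^esub>h\<in>carrier G. cnj L h x) # ?bs))"
      using t(1) by (simp add: L.res_trf[OF x])
    also have "\<dots> = (\<Oplus>\<^bsub>at_Cp M\<^esub>h\<in>carrier G. trf M (f (cnj L h x # ?bs)))"
      by (rule linear_map_group_hom(4)[OF L.module_e M.module_Cp linM finite_G]) (use c in auto)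
    \<comment> \<open>Passing to inverses produces the argument c_h^{-1} x of the conjugate cochain;
      the other arguments are restricted, hence unchanged, and t absorbs the outer c_h.\<close>
    also have "\<dots> = (\<Oplus>\<^bsub>at_Cp M\<^esub>h\<in>carrier G. trf M (f (cnj L (inv\<^bsub>G\<^esub> h) x # ?bs)))"
      by (rule sum_G_inv[symmetric]) (use linear_mapD(1)[OF linM] c X.agB in auto)
    also have "\<dots> = (\<Oplus>\<^bsub>at_Cp M\<^esub>h\<in>carrier G. trf M (conj n h f (x # ?bs)))"
    proof (rule X.B.M.finsum_cong')
      fix h assume h: "h \<in> carrier G"
      have "map (cnj L (inv\<^bsub>G\<^esub> h)) ?bs = ?bs"
        using as L.cnj_res h by (auto simp: tuples_def)
      then show "trf M (f (cnj L (inv\<^bsub>G\<^esub> h) x # ?bs)) = trf M (conj n h f (x # ?bs))"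
        using w[OF inv_closed[OF h] t(2)] t(2) h by (simp add: conj_apply M.trf_cnj del: map_map)
    qed (use v t(2) trf_M in auto)
    also have "\<dots> = trf M (conj_sum n f (x # ?bs))"
      unfolding conj_sum_apply[OF f t(2)]
      by (rule linear_map_group_hom(4)[OF M.module_e M.module_Cp M.trf_linear finite_G, symmetric])
        (use v t(2) in auto)
    finally show "?\<mu> (trf L x # as) = trf M (conj_sum n f (x # ?bs))" .
  qed
qed

lemma T_closed: "f \<in> carrier (Y.Alt n) \<Longrightarrow> T n f \<in> carrier (CC n)"
  by (simp add: T_eq CC_carrier compatible_T)

lemma conj_sum_linear: "linear_map R (Y.Alt n) (Y.Alt n) (conj_sum n)"
  unfolding conj_sum_def[abs_def] by (rule linear_map_sum[OF Y.Alt_module conj_linear finite_G])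

lemma T_linear: "linear_map R (Y.Alt n) (CC n) (T n)"
proof (rule linear_mapI)
  interpret YA: module R "Y.Alt n" by (rule Y.Alt_module)
  fix f assume f: "f \<in> carrier (Y.Alt n)"
  show "T n f \<in> carrier (CC n)" by (rule T_closed[OF f])
  note c = compatibleD(1)[OF compatible_T]
  {
    fix f' assume f': "f' \<in> carrier (Y.Alt n)"
    note ff' = YA.M.a_closed[OF f f']
    have "(\<lambda>as\<in>tuples (at_Cp L) n. trf M ((f \<oplus>\<^bsub>Y.Alt n\<^esub> f') (map (res L) as))) =
        (\<lambda>as\<in>tuples (at_Cp L) n. trf M (f (map (res L) as))) \<oplus>\<^bsub>X.Alt n\<^esub> (\<lambda>as\<in>tuples (at_Cp L) n. trf M (f' (map (res L) as)))"
      by (rule X.Alt_ext[OF c[OF ff'] X.Alt_add_closed[OF c[OF f] c[OF f']]])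
        (simp add: X.Alt_ops_apply Y.Alt_ops_apply tuples_res Y_value[OF f] Y_value[OF f'] linear_mapD(2)[OF M.trf_linear])
    then show "T n (f \<oplus>\<^bsub>Y.Alt n\<^esub> f') = T n f \<oplus>\<^bsub>CC n\<^esub> T n f'"
      by (simp add: T_eq f f' ff' CC_ops linear_mapD(2)[OF conj_sum_linear])
  }
  fix s assume s: "s \<in> carrier R"
  note sf = YA.smult_closed[OF s f]
  have "(\<lambda>as\<in>tuples (at_Cp L) n. trf M ((s \<odot>\<^bsub>Y.Alt n\<^esub> f) (map (res L) as))) =
      s \<odot>\<^bsub>X.Alt n\<^esub> (\<lambda>as\<in>tuples (at_Cp L) n. trf M (f (map (res L) as)))"
    by (rule X.Alt_ext[OF c[OF sf] X.Alt_smult_closed[OF c[OF f] s]])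
      (simp add: X.Alt_ops_apply Y.Alt_ops_apply tuples_res Y_value[OF f] s linear_mapD(3)[OF M.trf_linear])
  then show "T n (s \<odot>\<^bsub>Y.Alt n\<^esub> f) = s \<odot>\<^bsub>CC n\<^esub> T n f"
    by (simp add: T_eq f s sf CC_ops linear_mapD(3)[OF conj_sum_linear])
qed

lemma T_ce_diff:
  assumes f: "f \<in> carrier (Y.Alt n)"
  shows "dC n (T n f) = T (Suc n) (Y.CE n f)"
proof -
  note c = compatibleD(1)[OF compatible_T]
  have 1: "X.CE n (\<lambda>as\<in>tuples (at_Cp L) n. trf M (f (map (res L) as))) =
      (\<lambda>as\<in>tuples (at_Cp L) (Suc n). trf M (Y.CE n f (map (res L) as)))"
    by (rule X.Alt_ext[OF X.CE_closed[OF c[OF f]] c[OF Y.CE_closed[OF f]]])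
      (simp add: ce_diff_trf[OF c[OF f] f])
  have "Y.CE n (conj_sum n f) = (\<Oplus>\<^bsub>Y.Alt (Suc n)\<^esub>h\<in>carrier G. Y.CE n (conj n h f))"
    unfolding conj_sum_def
    by (rule linear_map_group_hom(4)[OF Y.Alt_module Y.Alt_module Y.CE_linear finite_G]) (auto simp: conj_closed f)
  also have "\<dots> = conj_sum (Suc n) (Y.CE n f)"
  proof -
    interpret YA: module R "Y.Alt (Suc n)" by (rule Y.Alt_module)
    show ?thesis
      unfolding conj_sum_def
      by (rule YA.M.finsum_cong') (auto simp: conj_ce_diff f conj_closed Y.CE_closed)
  qed
  finally show ?thesis using 1 by (simp add: T_eq f Y.CE_closed dC_apply)
qed

lemma T_conj:
  assumes f: "f \<in> carrier (Y.Alt n)" and h: "h \<in> carrier G"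
  shows "T n (conj n h f) = T n f"
proof -
  interpret YA: module R "Y.Alt n" by (rule Y.Alt_module)
  note c = compatibleD(1)[OF compatible_T]
  have 1: "(\<lambda>as\<in>tuples (at_Cp L) n. trf M (conj n h f (map (res L) as))) = (\<lambda>as\<in>tuples (at_Cp L) n. trf M (f (map (res L) as)))"
  proof (rule restrict_ext)
    fix as assume as: "as \<in> tuples (at_Cp L) n"
    have "map (cnj L (inv\<^bsub>G\<^esub> h)) (map (res L) as) = map (res L) as"
      using as L.cnj_res h by (auto simp: tuples_def)
    then show "trf M (conj n h f (map (res L) as)) = trf M (f (map (res L) as))"
      using tuples_res[OF as] by (simp add: conj_apply M.trf_cnj h Y_value[OF f] del: map_map)
  qed
  have "conj_sum n (conj n h f) = (\<Oplus>\<^bsub>Y.Alt n\<^esub>k\<in>carrier G. conj n (k \<otimes>\<^bsub>G\<^esub> h) f)"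
    unfolding conj_sum_def by (rule YA.M.finsum_cong') (auto simp: conj_mult h f conj_closed)
  also have "\<dots> = conj_sum n f"
    unfolding conj_sum_def by (rule sum_G_right[OF h _ YA.M.abelian_group_axioms]) (auto simp: conj_closed f)
  finally show ?thesis using 1 by (simp add: T_eq f h conj_closed)
qed

text \<open>At C_p this is \<open>cup_trf_left\<close> and \<open>cup_trf_right\<close>. At e the
  cochain \<open>snd u\<close> is fixed by conjugation, so each conjugate of f multiplied by it is
  the conjugate of the product, and bilinearity pulls the sum over the group out.\<close>

lemma T_frobenius:
  assumes f: "f \<in> carrier (Y.Alt m)" and u: "u \<in> carrier (CC n)"
  shows "cupC m n (T m f) u = T (m + n) (Y.CUP m n f (snd u))"
    "cupC n m u (T m f) = T (n + m) (Y.CUP n m (snd u) f)"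
proof -
  obtain k k' where e: "u = (k, k')" and c: "compatible n k k'" using u by (auto simp: CC_carrier)
  note ck = compatibleD[OF c] and cf = compatibleD[OF compatible_T[OF f]]
  note cp = compatibleD(1)[OF compatible_T]
  have fe: "(\<lambda>as\<in>tuples (at_Cp L) m. trf M (f (map (res L) as))) as = trf M (f (map (res L) as))"
    if "as \<in> tuples (at_Cp L) m" for as using that by simp
  interpret YA: module R "Y.Alt (m + n)" by (rule Y.Alt_module)
  interpret YB: module R "Y.Alt (n + m)" by (rule Y.Alt_module)
  note C1 = Y.CUP_closed[OF f ck(2)] and C2 = Y.CUP_closed[OF ck(2) f]
  have 1: "X.CUP m n (\<lambda>as\<in>tuples (at_Cp L) m. trf M (f (map (res L) as))) k =
      (\<lambda>as\<in>tuples (at_Cp L) (m + n). trf M (Y.CUP m n f k' (map (res L) as)))"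
    by (rule X.Alt_ext[OF X.CUP_closed[OF cf(1) ck(1)] cp[OF C1]])
      (simp add: cup_trf_left[OF cf(1) f ck(1,2) fe ck(3)])
  have 2: "X.CUP n m k (\<lambda>as\<in>tuples (at_Cp L) m. trf M (f (map (res L) as))) =
      (\<lambda>as\<in>tuples (at_Cp L) (n + m). trf M (Y.CUP n m k' f (map (res L) as)))"
    by (rule X.Alt_ext[OF X.CUP_closed[OF ck(1) cf(1)] cp[OF C2]])
      (simp add: cup_trf_right[OF ck(1,2) cf(1) f ck(3) fe])
  have "Y.CUP m n (conj_sum m f) k' = (\<Oplus>\<^bsub>Y.Alt (m + n)\<^esub>h\<in>carrier G. Y.CUP m n (conj m h f) k')"
    unfolding conj_sum_def
    by (rule linear_map_group_hom(4)[OF Y.Alt_module Y.Alt_module _ finite_G])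
      (use Y.CUP_bilinear ck(2) in \<open>auto simp: conj_closed f bilinear_map_def\<close>)
  also have "\<dots> = conj_sum (m + n) (Y.CUP m n f k')"
    unfolding conj_sum_def
    by (rule YA.M.finsum_cong') (auto simp: conj_cup conj_fixed[OF c] conj_closed f ck(2) C1 Y.CUP_closed)
  finally have 3: "Y.CUP m n (conj_sum m f) k' = conj_sum (m + n) (Y.CUP m n f k')" .
  have "Y.CUP n m k' (conj_sum m f) = (\<Oplus>\<^bsub>Y.Alt (n + m)\<^esub>h\<in>carrier G. Y.CUP n m k' (conj m h f))"
    unfolding conj_sum_def
    by (rule linear_map_group_hom(4)[OF Y.Alt_module Y.Alt_module _ finite_G])
      (use Y.CUP_bilinear ck(2) in \<open>auto simp: conj_closed f bilinear_map_def\<close>)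
  also have "\<dots> = conj_sum (n + m) (Y.CUP n m k' f)"
    unfolding conj_sum_def
    by (rule YB.M.finsum_cong') (auto simp: conj_cup conj_fixed[OF c] conj_closed f ck(2) C2 Y.CUP_closed)
  finally have 4: "Y.CUP n m k' (conj_sum m f) = conj_sum (n + m) (Y.CUP n m k' f)" .
  show "cupC m n (T m f) u = T (m + n) (Y.CUP m n f (snd u))"
    using 1 3 by (simp add: e T_eq f C1 cupC_apply)
  show "cupC n m u (T m f) = T (n + m) (Y.CUP n m (snd u) f)"
    using 2 4 by (simp add: e T_eq f C2 cupC_apply)
qed

text \<open>The Mackey relation between r t and the sum of conjugations, already on
  cochains.\<close>

lemma snd_T: "f \<in> carrier (Y.Alt n) \<Longrightarrow> snd (T n f) = (\<Oplus>\<^bsub>Y.Alt n\<^esub>h\<in>carrier G. conj n h f)"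
  by (simp add: T_eq conj_sum_def)

lemma snd_linear: "linear_map R (CC n) (Y.Alt n) snd"
  by (rule linear_mapI) (auto simp: CC_carrier CC_ops dest: compatibleD(2))

end

section \<open>Direct sums\<close>

locale module_family =
  fixes R :: "('r, 'n) ring_scheme" and A :: "nat \<Rightarrow> ('r, 'a) module"
  assumes module_A: "module R (A n)"
begin

lemma agroup: "abelian_group (A n)"
  by (rule abelian_group_of_module[OF module_A])

abbreviation DS where "DS \<equiv> direct_sum A"

lemma DS_ops [simp]: "\<zero>\<^bsub>DS\<^esub> n = \<zero>\<^bsub>A n\<^esub>" "(u \<oplus>\<^bsub>DS\<^esub> v) n = u n \<oplus>\<^bsub>A n\<^esub> v n" "(s \<odot>\<^bsub>DS\<^esub> u) n = s \<odot>\<^bsub>A n\<^esub> u n"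
  by (simp_all add: direct_sum_def)

lemma DS_carrier: "u \<in> carrier DS \<longleftrightarrow> (\<forall>n. u n \<in> carrier (A n)) \<and> finite {n. u n \<noteq> \<zero>\<^bsub>A n\<^esub>}"
  by (simp add: direct_sum_def)

lemma DS_value: "u \<in> carrier DS \<Longrightarrow> u n \<in> carrier (A n)"
  by (simp add: DS_carrier)

lemma zero_in: "\<zero>\<^bsub>A k\<^esub> \<in> carrier (A k)"
  by (rule abelian_groupE(2)[OF agroup])

lemma DS_module: "module R DS"
proof -
  note ax = abelian_groupE[OF agroup]
  note sm = module.smult_closed[OF module_A] module.smult_r_null[OF module_A]
  have a: "u \<oplus>\<^bsub>DS\<^esub> v \<in> carrier DS" if "u \<in> carrier DS" "v \<in> carrier DS" for u v
  proof -
    have "{n. u n \<oplus>\<^bsub>A n\<^esub> v n \<noteq> \<zero>\<^bsub>A n\<^esub>} \<subseteq> {n. u n \<noteq> \<zero>\<^bsub>A n\<^esub>} \<union> {n. v n \<noteq> \<zero>\<^bsub>A n\<^esub>}"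
      using ax(5)[OF zero_in] by auto
    then show ?thesis
      using that finite_subset ax(1) by (fastforce simp: DS_carrier)
  qed
  have s: "s \<odot>\<^bsub>DS\<^esub> u \<in> carrier DS" if "s \<in> carrier R" "u \<in> carrier DS" for s u
  proof -
    have "{n. s \<odot>\<^bsub>A n\<^esub> u n \<noteq> \<zero>\<^bsub>A n\<^esub>} \<subseteq> {n. u n \<noteq> \<zero>\<^bsub>A n\<^esub>}"
      using that(1) sm(2) by auto
    then show ?thesis
      using that finite_subset sm(1) by (fastforce simp: DS_carrier)
  qed
  interpret A0: module R "A 0" by (rule module_A)
  have neg: "(\<ominus>\<^bsub>R\<^esub> \<one>\<^bsub>R\<^esub>) \<odot>\<^bsub>A n\<^esub> x \<oplus>\<^bsub>A n\<^esub> x = \<zero>\<^bsub>A n\<^esub>" if "x \<in> carrier (A n)" for n x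
  proof -
    interpret An: module R "A n" by (rule module_A)
    show ?thesis using that by (simp add: An.smult_l_minus An.M.l_neg)
  qed
  show ?thesis
  proof (rule moduleI)
    show "abelian_group DS"
    proof (rule abelian_groupI)
      show "\<exists>v\<in>carrier DS. v \<oplus>\<^bsub>DS\<^esub> u = \<zero>\<^bsub>DS\<^esub>" if "u \<in> carrier DS" for u
        by (rule bexI[of _ "(\<ominus>\<^bsub>R\<^esub> \<one>\<^bsub>R\<^esub>) \<odot>\<^bsub>DS\<^esub> u"]) (auto intro!: ext s simp: that neg DS_value)
      show "\<zero>\<^bsub>DS\<^esub> \<in> carrier DS" by (simp add: DS_carrier zero_in)
    qed (auto intro!: ext a simp: ax(3,5) DS_value ax(4))
  qed (auto intro!: ext s A0.R.is_cring simp: DS_value module.smult_l_distr[OF module_A] module.smult_r_distr[OF module_A]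
      module.smult_assoc1[OF module_A] module.smult_one[OF module_A])
qed

lemma linear_map_DS:
  assumes "\<And>u. u \<in> carrier N \<Longrightarrow> f u \<in> carrier DS" "\<And>k. linear_map R N (A k) (\<lambda>u. f u k)"
  shows "linear_map R N DS f"
  by (rule linear_mapI) (auto intro!: ext assms(1) simp: linear_mapD(2,3)[OF assms(2)])

lemma DS_component: "linear_map R DS (A k) (\<lambda>u. u k)"
  by (rule linear_mapI) (simp_all add: DS_value)

lemma DS_uminus: "u \<in> carrier DS \<Longrightarrow> (\<ominus>\<^bsub>DS\<^esub> u) n = \<ominus>\<^bsub>A n\<^esub> u n"
  by (rule linear_map_group_hom(2)[OF DS_module module_A DS_component])

lemma DS_sum:
  assumes "finite S" "\<And>i. i \<in> S \<Longrightarrow> F i \<in> carrier DS"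
  shows "(\<Oplus>\<^bsub>DS\<^esub>i\<in>S. F i) n = (\<Oplus>\<^bsub>A n\<^esub>i\<in>S. F i n)"
  by (rule linear_map_group_hom(4)[OF DS_module module_A DS_component]) (use assms in auto)

definition single :: "nat \<Rightarrow> 'a \<Rightarrow> nat \<Rightarrow> 'a" where
  "single n a k = (if k = n then a else \<zero>\<^bsub>A k\<^esub>)"

lemma grading_iff: "u \<in> direct_sum_grading A n \<longleftrightarrow> (\<exists>a\<in>carrier (A n). u = single n a)"
proof
  assume "u \<in> direct_sum_grading A n"
  then show "\<exists>a\<in>carrier (A n). u = single n a"
    by (intro bexI[of _ "u n"]) (auto simp: direct_sum_grading_def single_def fun_eq_iff DS_value)
next
  assume "\<exists>a\<in>carrier (A n). u = single n a"
  then obtain a where a: "a \<in> carrier (A n)" and u: "u = single n a" by blast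
  have "{k. u k \<noteq> \<zero>\<^bsub>A k\<^esub>} \<subseteq> {n}" by (auto simp: u single_def)
  then have "finite {k. u k \<noteq> \<zero>\<^bsub>A k\<^esub>}" using finite_subset by blast
  then show "u \<in> direct_sum_grading A n"
    using a zero_in by (auto simp: direct_sum_grading_def DS_carrier u single_def)
qed

lemma grading_subset: "u \<in> direct_sum_grading A n \<Longrightarrow> u \<in> carrier DS"
  by (simp add: direct_sum_grading_def)

lemma grading_submodule: "submodule (direct_sum_grading A n) R DS"
proof -
  interpret D: module R DS by (rule DS_module)
  have z: "\<ominus>\<^bsub>A k\<^esub> \<zero>\<^bsub>A k\<^esub> = \<zero>\<^bsub>A k\<^esub>" "\<zero>\<^bsub>A k\<^esub> \<oplus>\<^bsub>A k\<^esub> \<zero>\<^bsub>A k\<^esub> = \<zero>\<^bsub>A k\<^esub>" "s \<in> carrier R \<Longrightarrow> s \<odot>\<^bsub>A k\<^esub> \<zero>\<^bsub>A k\<^esub> = \<zero>\<^bsub>A k\<^esub>" for k s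
  proof -
    interpret Ak: module R "A k" by (rule module_A)
    show "\<ominus>\<^bsub>A k\<^esub> \<zero>\<^bsub>A k\<^esub> = \<zero>\<^bsub>A k\<^esub>" "\<zero>\<^bsub>A k\<^esub> \<oplus>\<^bsub>A k\<^esub> \<zero>\<^bsub>A k\<^esub> = \<zero>\<^bsub>A k\<^esub>" "s \<in> carrier R \<Longrightarrow> s \<odot>\<^bsub>A k\<^esub> \<zero>\<^bsub>A k\<^esub> = \<zero>\<^bsub>A k\<^esub>" by simp_all
  qed
  show ?thesis
    by (rule D.submoduleI) (auto simp: direct_sum_grading_def DS_uminus z)
qed

text \<open>The summand of degree n is supported at n, so evaluating the sum at k leaves the value
  of summand k there. This determines every summand, and \<open>single n (a n)\<close> provides
  them.\<close>

lemma grading_direct_sum: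
  assumes a: "a \<in> carrier DS"
  shows "\<exists>!u. (\<forall>n. u n \<in> direct_sum_grading A n) \<and> finite {n. u n \<noteq> \<zero>\<^bsub>DS\<^esub>} \<and>
           a = (\<Oplus>\<^bsub>DS\<^esub>n\<in>{n. u n \<noteq> \<zero>\<^bsub>DS\<^esub>}. u n)"
proof -
  have eval: "(\<Oplus>\<^bsub>DS\<^esub>n\<in>{n. u n \<noteq> \<zero>\<^bsub>DS\<^esub>}. u n) k = u k k"
    if g: "\<And>n. u n \<in> direct_sum_grading A n" and fin: "finite {n. u n \<noteq> \<zero>\<^bsub>DS\<^esub>}" for u k
  proof -
    interpret Ak: module R "A k" by (rule module_A)
    let ?S = "{n. u n \<noteq> \<zero>\<^bsub>DS\<^esub>}"
    have off: "u n k = \<zero>\<^bsub>A k\<^esub>" if "n \<noteq> k" for n using g[of n] that by (auto simp: direct_sum_grading_def)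
    have v: "u n k \<in> carrier (A k)" for n using g[of n] by (auto simp: direct_sum_grading_def DS_value)
    have "(\<Oplus>\<^bsub>DS\<^esub>n\<in>?S. u n) k = (\<Oplus>\<^bsub>A k\<^esub>n\<in>?S. u n k)"
      by (rule DS_sum[OF fin]) (use g grading_subset in auto)
    also have "\<dots> = u k k"
    proof (cases "k \<in> ?S")
      case True
      have "(\<Oplus>\<^bsub>A k\<^esub>n\<in>?S. u n k) = (\<Oplus>\<^bsub>A k\<^esub>n\<in>?S. if k = n then u n k else \<zero>\<^bsub>A k\<^esub>)"
        by (rule Ak.M.finsum_cong') (auto simp: off v)
      also have "\<dots> = u k k" using True fin v by (intro Ak.M.finsum_singleton) auto
      finally show ?thesis .
    next
      case False
      then have "u k = \<zero>\<^bsub>DS\<^esub>" by simp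
      moreover have "(\<Oplus>\<^bsub>A k\<^esub>n\<in>?S. u n k) = \<zero>\<^bsub>A k\<^esub>"
      proof (rule Ak.M.add.finprod_one_eqI)
        fix n assume "n \<in> ?S"
        with False have "n \<noteq> k" by blast
        then show "u n k = \<zero>\<^bsub>A k\<^esub>" by (rule off)
      qed
      ultimately show ?thesis by simp
    qed
    finally show ?thesis .
  qed
  define u where "u n = single n (a n)" for n
  have ug: "u n \<in> direct_sum_grading A n" for n using a by (auto simp: grading_iff u_def DS_value)
  have "{n. u n \<noteq> \<zero>\<^bsub>DS\<^esub>} \<subseteq> {n. a n \<noteq> \<zero>\<^bsub>A n\<^esub>}" by (auto simp: u_def single_def fun_eq_iff)
  then have uf: "finite {n. u n \<noteq> \<zero>\<^bsub>DS\<^esub>}" using a finite_subset by (auto simp: DS_carrier)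
  show ?thesis
  proof (rule ex1I[of _ u])
    show "(\<forall>n. u n \<in> direct_sum_grading A n) \<and> finite {n. u n \<noteq> \<zero>\<^bsub>DS\<^esub>} \<and> a = (\<Oplus>\<^bsub>DS\<^esub>n\<in>{n. u n \<noteq> \<zero>\<^bsub>DS\<^esub>}. u n)"
    proof (intro conjI allI ext)
      show "a k = (\<Oplus>\<^bsub>DS\<^esub>n\<in>{n. u n \<noteq> \<zero>\<^bsub>DS\<^esub>}. u n) k" for k
        unfolding eval[OF ug uf] by (simp add: u_def single_def)
    qed (use ug uf in auto)
    fix v assume v: "(\<forall>n. v n \<in> direct_sum_grading A n) \<and> finite {n. v n \<noteq> \<zero>\<^bsub>DS\<^esub>} \<and> a = (\<Oplus>\<^bsub>DS\<^esub>n\<in>{n. v n \<noteq> \<zero>\<^bsub>DS\<^esub>}. v n)"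
    then have "a k = v k k" for k using eval[of v k] by simp
    then show "v = u"
      using v by (auto simp: fun_eq_iff u_def single_def direct_sum_grading_def)
  qed
qed

lemma single_zero: "single n \<zero>\<^bsub>A n\<^esub> = \<zero>\<^bsub>DS\<^esub>"
  by (auto simp: single_def fun_eq_iff)

lemma single_closed: "a \<in> carrier (A n) \<Longrightarrow> single n a \<in> carrier DS"
  using grading_iff grading_subset by blast

lemma single_add:
  assumes "a \<in> carrier (A n)" "b \<in> carrier (A n)"
  shows "single n a \<oplus>\<^bsub>DS\<^esub> single n b = single n (a \<oplus>\<^bsub>A n\<^esub> b)"
  using abelian_groupE(5)[OF agroup zero_in] by (auto simp: single_def fun_eq_iff)

lemma single_uminus:
  assumes "a \<in> carrier (A n)"
  shows "\<ominus>\<^bsub>DS\<^esub> single n a = single n (\<ominus>\<^bsub>A n\<^esub> a)"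
proof
  fix k
  interpret Ak: module R "A k" by (rule module_A)
  show "(\<ominus>\<^bsub>DS\<^esub> single n a) k = single n (\<ominus>\<^bsub>A n\<^esub> a) k"
    by (simp add: DS_uminus single_closed[OF assms]) (simp add: single_def)
qed

lemma single_sign:
  assumes "a \<in> carrier (A n)"
  shows "add_pow DS ((-1::int) ^ j) (single n a) = single n (add_pow (A n) ((-1::int) ^ j) a)"
proof -
  interpret An: module R "A n" by (rule module_A)
  interpret D: module R DS by (rule DS_module)
  show ?thesis
    using assms by (cases "even j") (simp_all add: D.M.add_pow_one D.M.add_pow_neg_one An.M.add_pow_one An.M.add_pow_neg_one
      single_closed single_uminus)
qed

end

text \<open>What remains of \<open>dg_lie\<close> after passing to cohomology. The identities in
  \<open>graded_lie_algebra\<close> concern homogeneous elements, so identities for the components Q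
  i j suffice for the direct sum.\<close>

locale graded_lie_family = module_family R A
  for R :: "('r, 'n) ring_scheme" and A :: "nat \<Rightarrow> ('r, 'a) module" +
  fixes Q :: "nat \<Rightarrow> nat \<Rightarrow> 'a \<Rightarrow> 'a \<Rightarrow> 'a"
  assumes Q_bilinear: "bilinear_map R (A m) (A n) (A (m + n)) (Q m n)"
    and Q_antisym: "\<lbrakk>f \<in> carrier (A m); k \<in> carrier (A n)\<rbrakk> \<Longrightarrow>
      Q m n f k = \<ominus>\<^bsub>A (m + n)\<^esub> (add_pow (A (m + n)) ((-1::int) ^ (m * n)) (Q n m k f))"
    and Q_jacobi: "\<lbrakk>f \<in> carrier (A i); k \<in> carrier (A j); l \<in> carrier (A n)\<rbrakk> \<Longrightarrow>
      Q i (j + n) f (Q j n k l) = Q (i + j) n (Q i j f k) l \<oplus>\<^bsub>A (i + j + n)\<^esub>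
        add_pow (A (i + j + n)) ((-1::int) ^ (i * j)) (Q j (i + n) k (Q i n f l))"
    and Q_even: "\<lbrakk>even i; f \<in> carrier (A i)\<rbrakk> \<Longrightarrow> Q i i f f = \<zero>\<^bsub>A (i + i)\<^esub>"
    and Q_odd: "\<lbrakk>odd i; f \<in> carrier (A i)\<rbrakk> \<Longrightarrow> Q i (i + i) f (Q i i f f) = \<zero>\<^bsub>A (i + (i + i))\<^esub>"
begin

definition product :: "(nat \<Rightarrow> 'a) \<Rightarrow> (nat \<Rightarrow> 'a) \<Rightarrow> nat \<Rightarrow> 'a" where
  "product u v k = (\<Oplus>\<^bsub>A k\<^esub>i\<in>{..k}. Q i (k - i) (u i) (v (k - i)))"

lemma Q_closed: "a \<in> carrier (A i) \<Longrightarrow> b \<in> carrier (A j) \<Longrightarrow> Q i j a b \<in> carrier (A (i + j))"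
  by (rule bilinear_mapD(1)[OF Q_bilinear])

lemma Q_term: "i \<le> k \<Longrightarrow> u \<in> carrier DS \<Longrightarrow> v \<in> carrier DS \<Longrightarrow> Q i (k - i) (u i) (v (k - i)) \<in> carrier (A k)"
  using Q_closed[of "u i" i "v (k - i)" "k - i"] by (simp add: DS_value)

lemma Q_zero: "a \<in> carrier (A i) \<Longrightarrow> Q i j a \<zero>\<^bsub>A j\<^esub> = \<zero>\<^bsub>A (i + j)\<^esub>" "b \<in> carrier (A j) \<Longrightarrow> Q i j \<zero>\<^bsub>A i\<^esub> b = \<zero>\<^bsub>A (i + j)\<^esub>"
proof -
  show "a \<in> carrier (A i) \<Longrightarrow> Q i j a \<zero>\<^bsub>A j\<^esub> = \<zero>\<^bsub>A (i + j)\<^esub>"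
    by (rule linear_map_group_hom(1)[OF module_A module_A]) (use Q_bilinear in \<open>auto simp: bilinear_map_def\<close>)
  show "b \<in> carrier (A j) \<Longrightarrow> Q i j \<zero>\<^bsub>A i\<^esub> b = \<zero>\<^bsub>A (i + j)\<^esub>"
    by (rule linear_map_group_hom(1)[OF module_A module_A, where f = "\<lambda>x. Q i j x b"]) (use Q_bilinear in \<open>auto simp: bilinear_map_def\<close>)
qed

lemma product_value: "u \<in> carrier DS \<Longrightarrow> v \<in> carrier DS \<Longrightarrow> product u v k \<in> carrier (A k)"
proof -
  interpret Ak: module R "A k" by (rule module_A)
  show "u \<in> carrier DS \<Longrightarrow> v \<in> carrier DS \<Longrightarrow> product u v k \<in> carrier (A k)"
    unfolding product_def by (rule Ak.M.finsum_closed) (auto simp: Q_term)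
qed

text \<open>The support of a product lies in the set of sums of the two finite supports.\<close>

lemma product_closed:
  assumes u: "u \<in> carrier DS" and v: "v \<in> carrier DS"
  shows "product u v \<in> carrier DS"
proof -
  let ?U = "{n. u n \<noteq> \<zero>\<^bsub>A n\<^esub>}" and ?V = "{n. v n \<noteq> \<zero>\<^bsub>A n\<^esub>}"
  have "product u v k = \<zero>\<^bsub>A k\<^esub>" if k: "k \<notin> (\<lambda>(i, j). i + j) ` (?U \<times> ?V)" for k
  proof -
    interpret Ak: module R "A k" by (rule module_A)
    have "Q i (k - i) (u i) (v (k - i)) = \<zero>\<^bsub>A k\<^esub>" if "i \<le> k" for i
    proof -
      have "i \<notin> ?U \<or> k - i \<notin> ?V" using k that by force
      then show ?thesis
        using Q_zero(1)[OF DS_value[OF u], of i "k - i"] Q_zero(2)[OF DS_value[OF v], of i "k - i"] that by auto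
    qed
    then show ?thesis unfolding product_def by (intro Ak.M.add.finprod_one_eqI) auto
  qed
  then have "{k. product u v k \<noteq> \<zero>\<^bsub>A k\<^esub>} \<subseteq> (\<lambda>(i, j). i + j) ` (?U \<times> ?V)" by blast
  moreover have "finite ((\<lambda>(i, j). i + j) ` (?U \<times> ?V))" using u v by (simp add: DS_carrier)
  ultimately show ?thesis
    using finite_subset product_value[OF u v] by (auto simp: DS_carrier)
qed

lemma product_bilinear: "bilinear_map R DS DS DS product"
proof -
  have "linear_map R DS (A k) (\<lambda>v. product u v k)" if u: "u \<in> carrier DS" for u k
    unfolding product_def
  proof (rule linear_map_sum[OF module_A])
    fix i assume "i \<in> {..k}"
    then have "linear_map R (A (k - i)) (A k) (Q i (k - i) (u i))"
      using Q_bilinear[of i "k - i"] DS_value[OF u] by (simp add: bilinear_map_def)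
    then show "linear_map R DS (A k) (\<lambda>v. Q i (k - i) (u i) (v (k - i)))"
      by (rule linear_map_compose[OF DS_component])
  qed simp
  moreover have "linear_map R DS (A k) (\<lambda>u. product u v k)" if v: "v \<in> carrier DS" for v k
    unfolding product_def
  proof (rule linear_map_sum[OF module_A])
    fix i assume "i \<in> {..k}"
    then have "linear_map R (A i) (A k) (\<lambda>x. Q i (k - i) x (v (k - i)))"
      using Q_bilinear[of i "k - i"] DS_value[OF v] by (simp add: bilinear_map_def)
    then show "linear_map R DS (A k) (\<lambda>u. Q i (k - i) (u i) (v (k - i)))"
      by (rule linear_map_compose[OF DS_component])
  qed simp
  ultimately show ?thesis
    unfolding bilinear_map_def by (auto intro: linear_map_DS product_closed)
qed

lemma product_single:
  assumes a: "a \<in> carrier (A m)" and b: "b \<in> carrier (A n)"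
  shows "product (single m a) (single n b) = single (m + n) (Q m n a b)"
proof
  fix k
  interpret Ak: module R "A k" by (rule module_A)
  have t: "Q i (k - i) (single m a i) (single n b (k - i)) = (if m = i \<and> k = m + n then Q m n a b else \<zero>\<^bsub>A k\<^esub>)" if "i \<le> k" for i
  proof (cases "m = i \<and> k = m + n")
    case True
    then show ?thesis by (auto simp: single_def)
  next
    case False
    then have "m \<noteq> i \<or> n \<noteq> k - i" using that by auto
    then have "single m a i = \<zero>\<^bsub>A i\<^esub> \<or> single n b (k - i) = \<zero>\<^bsub>A (k - i)\<^esub>" by (auto simp: single_def)
    then have "Q i (k - i) (single m a i) (single n b (k - i)) = \<zero>\<^bsub>A (i + (k - i))\<^esub>"
      using Q_zero DS_value[OF single_closed[OF a]] DS_value[OF single_closed[OF b]] by metis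
    then show ?thesis using False that by auto
  qed
  show "product (single m a) (single n b) k = single (m + n) (Q m n a b) k"
  proof (cases "k = m + n")
    case True
    have q: "Q m n a b \<in> carrier (A k)" using Q_closed[OF a b] True by simp
    have "product (single m a) (single n b) k = (\<Oplus>\<^bsub>A k\<^esub>i\<in>{..k}. if m = i then Q m n a b else \<zero>\<^bsub>A k\<^esub>)"
      unfolding product_def by (rule Ak.M.finsum_cong') (use t True q zero_in in auto)
    also have "\<dots> = Q m n a b" using True q by (intro Ak.M.finsum_singleton) auto
    finally show ?thesis using True by (simp add: single_def)
  next
    case False
    have "product (single m a) (single n b) k = \<zero>\<^bsub>A k\<^esub>"
      unfolding product_def by (rule Ak.M.add.finprod_one_eqI) (use t False in auto)
    then show ?thesis using False by (simp add: single_def)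
  qed
qed

lemma graded_lie_direct_sum: "graded_lie_algebra R DS (direct_sum_grading A) product"
proof -
  interpret D: module R DS by (rule DS_module)
  have sign_closed: "add_pow (A n) ((-1::int) ^ k) a \<in> carrier (A n)" if "a \<in> carrier (A n)" for a n k
    by (rule abelian_group.add_pow_sign_closed[OF agroup that])
  show ?thesis
  proof (rule graded_lie_algebra.intro[OF DS_module graded_lie_algebra_axioms.intro])
    show "submodule (direct_sum_grading A n) R DS" for n by (rule grading_submodule)
    show "\<exists>!u. (\<forall>n. u n \<in> direct_sum_grading A n) \<and> finite {n. u n \<noteq> \<zero>\<^bsub>DS\<^esub>} \<and>
           a = (\<Oplus>\<^bsub>DS\<^esub>n\<in>{n. u n \<noteq> \<zero>\<^bsub>DS\<^esub>}. u n)" if "a \<in> carrier DS" for a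
      by (rule grading_direct_sum[OF that])
    show "bilinear_map R DS DS DS product" by (rule product_bilinear)
    show "product x y \<in> direct_sum_grading A (i + j)" if "x \<in> direct_sum_grading A i" "y \<in> direct_sum_grading A j" for x i y j
      using that by (auto simp: grading_iff product_single Q_closed)
    show "product x y = \<ominus>\<^bsub>DS\<^esub> (add_pow DS ((-1::int) ^ (i * j)) (product y x))"
      if xy: "x \<in> direct_sum_grading A i" "y \<in> direct_sum_grading A j" for x i y j
    proof -
      obtain a b where "a \<in> carrier (A i)" "b \<in> carrier (A j)" "x = single i a" "y = single j b"
        using xy by (auto simp: grading_iff)
      moreover from this have "Q j i b a \<in> carrier (A (i + j))" using Q_closed[of b j a i] by (simp add: add.commute)
      ultimately show ?thesis
        using Q_antisym[of a i b j]
        by (simp add: product_single add.commute[of j i] single_sign single_uminus sign_closed)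
    qed
    show "product x (product y z) = product (product x y) z \<oplus>\<^bsub>DS\<^esub> add_pow DS ((-1::int) ^ (i * j)) (product y (product x z))"
      if xyz: "x \<in> direct_sum_grading A i" "y \<in> direct_sum_grading A j" "z \<in> direct_sum_grading A k" for x i y j z k
    proof -
      obtain a b c where abc: "a \<in> carrier (A i)" "b \<in> carrier (A j)" "c \<in> carrier (A k)"
        and xyz: "x = single i a" "y = single j b" "z = single k c"
        using xyz by (auto simp: grading_iff)
      have e: "j + (i + k) = i + j + k" "i + (j + k) = i + j + k" by simp_all
      have q: "Q j (i + k) b (Q i k a c) \<in> carrier (A (i + j + k))"
        using Q_closed[OF abc(2) Q_closed[OF abc(1,3)]] unfolding e .
      have q': "Q (i + j) k (Q i j a b) c \<in> carrier (A (i + j + k))"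
        by (rule Q_closed[OF Q_closed[OF abc(1,2)] abc(3)])
      show ?thesis
        using Q_jacobi[OF abc] abc
        by (simp add: xyz product_single Q_closed e single_sign[OF q] single_add[OF q' sign_closed[OF q]])
    qed
    show "product x x = \<zero>\<^bsub>DS\<^esub>" if "even i" "x \<in> direct_sum_grading A i" for i x
      using that by (auto simp: grading_iff product_single Q_even single_zero)
    show "product x (product x x) = \<zero>\<^bsub>DS\<^esub>" if "odd i" "x \<in> direct_sum_grading A i" for i x
      using that Q_odd single_zero by (auto simp: grading_iff product_single Q_closed)
  qed
qed

end

section \<open>Cohomology\<close>

text \<open>The inductive graph of a fold evaluates the step function only at members of the set, so
  a change elsewhere has no effect.\<close>

lemma foldSetD_cong:
  assumes "(A, z) \<in> foldSetD D f e" "\<And>x y. x \<in> A \<Longrightarrow> f x y = f' x y"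
  shows "(A, z) \<in> foldSetD D f' e"
  using assms
proof (induction A z rule: foldSetD.induct)
  case (insertI x A y)
  then have "(A, y) \<in> foldSetD D f' e" "f x y = f' x y" by auto
  then show ?case using foldSetD.insertI[of x A f' y D e] insertI.hyps by simp
qed (rule foldSetD.emptyI)

text \<open>Unlike \<open>abelian_monoid.finsum_cong'\<close>, this needs no closure assumption, so that
  it applies to families of sets that are not known to be cohomology classes.\<close>

lemma finsum_cong_always:
  assumes "\<And>i. i \<in> A \<Longrightarrow> f i = f' i"
  shows "finsum N f A = finsum N f' A"
proof -
  have "(A, z) \<in> foldSetD D (\<lambda>x y. f x \<oplus>\<^bsub>N\<^esub> y) e \<longleftrightarrow> (A, z) \<in> foldSetD D (\<lambda>x y. f' x \<oplus>\<^bsub>N\<^esub> y) e" for z D e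
    using assms by (auto intro: foldSetD_cong)
  then show ?thesis by (simp add: finsum_def finprod_def foldD_def comp_def)
qed

locale cochain_complex =
  fixes R :: "('r, 'n) ring_scheme" and C :: "nat \<Rightarrow> ('r, 'c) module" and d :: "nat \<Rightarrow> 'c \<Rightarrow> 'c"
  assumes module_C: "module R (C n)"
    and d_linear: "linear_map R (C n) (C (Suc n)) (d n)"
    and d_d: "f \<in> carrier (C n) \<Longrightarrow> d (Suc n) (d n f) = \<zero>\<^bsub>C (Suc (Suc n))\<^esub>"
begin

abbreviation Z where "Z \<equiv> cocycles C d"
abbreviation B where "B \<equiv> coboundaries C d"
abbreviation H where "H \<equiv> cohomology C d"
abbreviation cls where "cls \<equiv> cohomology_class C d"

lemma cgroup: "abelian_group (C n)"
  by (rule abelian_group_of_module[OF module_C])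

lemma ZD: "f \<in> Z n \<Longrightarrow> f \<in> carrier (C n)" "f \<in> Z n \<Longrightarrow> d n f = \<zero>\<^bsub>C (Suc n)\<^esub>"
  by (simp_all add: cocycles_def)

lemma ZI: "f \<in> carrier (C n) \<Longrightarrow> d n f = \<zero>\<^bsub>C (Suc n)\<^esub> \<Longrightarrow> f \<in> Z n"
  by (simp add: cocycles_def)

lemma Z_closed:
  "\<zero>\<^bsub>C n\<^esub> \<in> Z n"
  "f \<in> Z n \<Longrightarrow> k \<in> Z n \<Longrightarrow> f \<oplus>\<^bsub>C n\<^esub> k \<in> Z n"
  "s \<in> carrier R \<Longrightarrow> f \<in> Z n \<Longrightarrow> s \<odot>\<^bsub>C n\<^esub> f \<in> Z n"
  "f \<in> Z n \<Longrightarrow> \<ominus>\<^bsub>C n\<^esub> f \<in> Z n"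
proof -
  interpret Cn: module R "C n" by (rule module_C)
  interpret Cs: module R "C (Suc n)" by (rule module_C)
  note h = linear_map_group_hom[OF module_C module_C d_linear] linear_mapD[OF d_linear]
  show "\<zero>\<^bsub>C n\<^esub> \<in> Z n" by (rule ZI) (auto simp: h)
  show "f \<in> Z n \<Longrightarrow> k \<in> Z n \<Longrightarrow> f \<oplus>\<^bsub>C n\<^esub> k \<in> Z n" by (rule ZI) (auto simp: h ZD)
  show "s \<in> carrier R \<Longrightarrow> f \<in> Z n \<Longrightarrow> s \<odot>\<^bsub>C n\<^esub> f \<in> Z n" by (rule ZI) (auto simp: h ZD)
  show "f \<in> Z n \<Longrightarrow> \<ominus>\<^bsub>C n\<^esub> f \<in> Z n" by (rule ZI) (auto simp: h ZD)
qed

lemma B_cases: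
  assumes "b \<in> B n"
  obtains "n = 0" "b = \<zero>\<^bsub>C 0\<^esub>" | m a where "n = Suc m" "a \<in> carrier (C m)" "b = d m a"
  using assms by (cases n) (auto simp: coboundaries_def)

lemma d_in_B: "a \<in> carrier (C n) \<Longrightarrow> d n a \<in> B (Suc n)"
  by (simp add: coboundaries_def)

lemma B_closed:
  "\<zero>\<^bsub>C n\<^esub> \<in> B n"
  "a \<in> B n \<Longrightarrow> b \<in> B n \<Longrightarrow> a \<oplus>\<^bsub>C n\<^esub> b \<in> B n"
  "s \<in> carrier R \<Longrightarrow> b \<in> B n \<Longrightarrow> s \<odot>\<^bsub>C n\<^esub> b \<in> B n"
  "b \<in> B n \<Longrightarrow> \<ominus>\<^bsub>C n\<^esub> b \<in> B n"
proof -
  interpret Cn: module R "C n" by (rule module_C)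
  show "\<zero>\<^bsub>C n\<^esub> \<in> B n"
  proof (cases n)
    case (Suc m)
    interpret Cm: module R "C m" by (rule module_C)
    show ?thesis
      using d_in_B[of "\<zero>\<^bsub>C m\<^esub>" m] linear_map_group_hom(1)[OF module_C module_C d_linear, of m] Suc by simp
  qed (simp add: coboundaries_def)
  {
    assume a: "a \<in> B n" and b: "b \<in> B n"
    show "a \<oplus>\<^bsub>C n\<^esub> b \<in> B n"
    proof (cases n)
      case 0
      then show ?thesis using a b Cn.M.zero_closed Cn.M.l_zero[OF Cn.M.zero_closed] by (simp add: coboundaries_def)
    next
      case (Suc m)
      interpret Cm: module R "C m" by (rule module_C)
      from a b Suc obtain x y where "x \<in> carrier (C m)" "y \<in> carrier (C m)" "a = d m x" "b = d m y"
        by (auto simp: coboundaries_def)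
      then show ?thesis
        using d_in_B[of "x \<oplus>\<^bsub>C m\<^esub> y" m] Suc by (simp add: linear_mapD(2)[OF d_linear])
    qed
  }
  {
    assume b: "b \<in> B n"
    show s: "s \<odot>\<^bsub>C n\<^esub> b \<in> B n" if s: "s \<in> carrier R" for s
    proof (cases n)
      case 0
      then show ?thesis using b s Cn.smult_r_null by (simp add: coboundaries_def)
    next
      case (Suc m)
      interpret Cm: module R "C m" by (rule module_C)
      from b Suc obtain x where "x \<in> carrier (C m)" "b = d m x" by (auto simp: coboundaries_def)
      then show ?thesis
        using d_in_B[of "s \<odot>\<^bsub>C m\<^esub> x" m] Suc s by (simp add: linear_mapD(3)[OF d_linear])
    qed
    have "b \<in> carrier (C n)"
      by (rule B_cases[OF b]) (auto simp: linear_mapD(1)[OF d_linear] abelian_groupE(2)[OF cgroup])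
    then show "\<ominus>\<^bsub>C n\<^esub> b \<in> B n" using s[of "\<ominus>\<^bsub>R\<^esub> \<one>\<^bsub>R\<^esub>"] by (simp add: Cn.smult_l_minus)
  }
qed

lemma B_subset: "b \<in> B n \<Longrightarrow> b \<in> Z n"
proof (erule B_cases)
  assume "n = 0" "b = \<zero>\<^bsub>C 0\<^esub>"
  then show "b \<in> Z n" using Z_closed(1)[of 0] by simp
next
  fix m a assume "n = Suc m" "a \<in> carrier (C m)" "b = d m a"
  then show "b \<in> Z n" by (auto intro: ZI simp: linear_mapD(1)[OF d_linear] d_d)
qed

lemma BC: "b \<in> B n \<Longrightarrow> b \<in> carrier (C n)"
  by (rule ZD(1)[OF B_subset])

lemma cls_image: "cls n f = (\<lambda>b. b \<oplus>\<^bsub>C n\<^esub> f) ` B n"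
  by (auto simp: cohomology_class_def a_r_coset_def r_coset_def)

lemma cls_self: "f \<in> carrier (C n) \<Longrightarrow> f \<in> cls n f"
  using B_closed(1) abelian_groupE(5)[OF cgroup] by (force simp: cls_image)

lemma cls_memD: "k \<in> cls n f \<Longrightarrow> f \<in> carrier (C n) \<Longrightarrow> \<exists>b\<in>B n. k = b \<oplus>\<^bsub>C n\<^esub> f"
  by (auto simp: cls_image)

lemma cls_mem_Z: "k \<in> cls n f \<Longrightarrow> f \<in> Z n \<Longrightarrow> k \<in> Z n"
  by (auto simp: cls_image intro: Z_closed B_subset)

lemma cls_eqI:
  assumes f: "f \<in> carrier (C n)" and b: "b \<in> B n"
  shows "cls n (b \<oplus>\<^bsub>C n\<^esub> f) = cls n f"
proof -
  interpret Cn: module R "C n" by (rule module_C)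
  note c = BC
  show ?thesis
    unfolding cls_image
  proof (intro equalityI subsetI; elim imageE; hypsubst)
    fix a assume a: "a \<in> B n"
    have "a \<oplus>\<^bsub>C n\<^esub> (b \<oplus>\<^bsub>C n\<^esub> f) = (a \<oplus>\<^bsub>C n\<^esub> b) \<oplus>\<^bsub>C n\<^esub> f"
      using a b f c by (simp add: Cn.M.a_assoc)
    then show "a \<oplus>\<^bsub>C n\<^esub> (b \<oplus>\<^bsub>C n\<^esub> f) \<in> (\<lambda>b. b \<oplus>\<^bsub>C n\<^esub> f) ` B n"
      using B_closed(2)[OF a b] by blast
    have "a \<oplus>\<^bsub>C n\<^esub> f = (a \<oplus>\<^bsub>C n\<^esub> \<ominus>\<^bsub>C n\<^esub> b) \<oplus>\<^bsub>C n\<^esub> (b \<oplus>\<^bsub>C n\<^esub> f)"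
      using a b f c by (simp add: Cn.M.a_assoc Cn.M.r_neg1)
    then show "a \<oplus>\<^bsub>C n\<^esub> f \<in> (\<lambda>k. k \<oplus>\<^bsub>C n\<^esub> (b \<oplus>\<^bsub>C n\<^esub> f)) ` B n"
      using B_closed(2)[OF a B_closed(4)[OF b]] by blast
  qed
qed

lemma H_carrier: "carrier (H n) = cls n ` Z n"
  by (auto simp: cohomology_def quotient_module_def A_RCOSETS_def RCOSETS_def cohomology_class_def
    a_r_coset_def r_coset_def)

lemma H_cases:
  assumes "S \<in> carrier (H n)"
  obtains f where "f \<in> Z n" "S = cls n f"
  using assms by (auto simp: H_carrier)

lemma cls_in_H: "f \<in> Z n \<Longrightarrow> cls n f \<in> carrier (H n)"
  by (simp add: H_carrier)

lemma H_zero: "\<zero>\<^bsub>H n\<^esub> = cls n \<zero>\<^bsub>C n\<^esub>"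
proof -
  interpret Cn: module R "C n" by (rule module_C)
  have "cls n \<zero>\<^bsub>C n\<^esub> = B n" using BC by (force simp: cls_image)
  then show ?thesis by (simp add: cohomology_def quotient_module_def)
qed

lemma H_add:
  assumes f: "f \<in> carrier (C n)" and k: "k \<in> carrier (C n)"
  shows "cls n f \<oplus>\<^bsub>H n\<^esub> cls n k = cls n (f \<oplus>\<^bsub>C n\<^esub> k)"
proof -
  interpret Cn: module R "C n" by (rule module_C)
  have "cls n f \<oplus>\<^bsub>H n\<^esub> cls n k = {x \<oplus>\<^bsub>C n\<^esub> y | x y. x \<in> cls n f \<and> y \<in> cls n k}"
    by (auto simp: cohomology_def quotient_module_def set_add_def set_mult_def)
  also have "\<dots> = cls n (f \<oplus>\<^bsub>C n\<^esub> k)"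
  proof (intro equalityI subsetI)
    fix z assume "z \<in> {x \<oplus>\<^bsub>C n\<^esub> y | x y. x \<in> cls n f \<and> y \<in> cls n k}"
    then obtain a b where ab: "a \<in> B n" "b \<in> B n" and z: "z = (a \<oplus>\<^bsub>C n\<^esub> f) \<oplus>\<^bsub>C n\<^esub> (b \<oplus>\<^bsub>C n\<^esub> k)"
      by (auto simp: cls_image)
    have "z = (a \<oplus>\<^bsub>C n\<^esub> b) \<oplus>\<^bsub>C n\<^esub> (f \<oplus>\<^bsub>C n\<^esub> k)"
      using f k BC[OF ab(1)] BC[OF ab(2)] by (simp add: z Cn.M.a_ac)
    then show "z \<in> cls n (f \<oplus>\<^bsub>C n\<^esub> k)" using B_closed(2)[OF ab] by (auto simp: cls_image)
  next
    fix z assume "z \<in> cls n (f \<oplus>\<^bsub>C n\<^esub> k)"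
    then obtain a where a: "a \<in> B n" and z: "z = a \<oplus>\<^bsub>C n\<^esub> (f \<oplus>\<^bsub>C n\<^esub> k)" by (auto simp: cls_image)
    have "z = (a \<oplus>\<^bsub>C n\<^esub> f) \<oplus>\<^bsub>C n\<^esub> k" using f k BC[OF a] by (simp add: z Cn.M.a_assoc)
    then show "z \<in> {x \<oplus>\<^bsub>C n\<^esub> y | x y. x \<in> cls n f \<and> y \<in> cls n k}"
      using cls_self[OF k] a by (auto simp: cls_image)
  qed
  finally show ?thesis .
qed

text \<open>A class contains its representative, hence is nonempty, and the union of a constant
  family is its value. Scalar multiplication, induced maps and products, all unions over
  representatives, are evaluated through this.\<close>

lemma UN_cls:
  assumes f: "f \<in> carrier (C n)" and c: "\<And>k. k \<in> cls n f \<Longrightarrow> F k = S"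
  shows "(\<Union>k\<in>cls n f. F k) = S"
  using cls_self[OF f] c by auto

lemma H_smult:
  assumes f: "f \<in> carrier (C n)" and s: "s \<in> carrier R"
  shows "s \<odot>\<^bsub>H n\<^esub> cls n f = cls n (s \<odot>\<^bsub>C n\<^esub> f)"
proof -
  interpret Cn: module R "C n" by (rule module_C)
  have "s \<odot>\<^bsub>H n\<^esub> cls n f = (\<Union>x\<in>cls n f. cls n (s \<odot>\<^bsub>C n\<^esub> x))"
    by (simp add: cohomology_def quotient_module_def cohomology_class_def a_r_coset_def r_coset_def)
  also have "\<dots> = cls n (s \<odot>\<^bsub>C n\<^esub> f)"
  proof (rule UN_cls[OF f])
    fix k assume "k \<in> cls n f"
    then obtain b where b: "b \<in> B n" "k = b \<oplus>\<^bsub>C n\<^esub> f" using cls_memD f by blast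
    then show "cls n (s \<odot>\<^bsub>C n\<^esub> k) = cls n (s \<odot>\<^bsub>C n\<^esub> f)"
      using cls_eqI[OF _ B_closed(3)[OF s b(1)], of "s \<odot>\<^bsub>C n\<^esub> f"] f s BC[OF b(1)] by (simp add: Cn.smult_r_distr)
  qed
  finally show ?thesis .
qed

lemma H_module: "module R (H n)"
proof -
  interpret Cn: module R "C n" by (rule module_C)
  have zc: "f \<in> carrier (C n)" if "f \<in> Z n" for f by (rule ZD(1)[OF that])
  show ?thesis
  proof (rule moduleI)
    show "cring R" by (rule Cn.R.is_cring)
    show "abelian_group (H n)"
    proof (rule abelian_groupI)
      fix S assume "S \<in> carrier (H n)"
      then obtain f where f: "f \<in> Z n" "S = cls n f" by (rule H_cases)
      show "\<exists>T\<in>carrier (H n). T \<oplus>\<^bsub>H n\<^esub> S = \<zero>\<^bsub>H n\<^esub>"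
        by (rule bexI[of _ "cls n (\<ominus>\<^bsub>C n\<^esub> f)"])
          (use f zc[OF f(1)] in \<open>simp_all add: H_add H_zero Cn.M.l_neg cls_in_H Z_closed\<close>)
    qed (auto elim!: H_cases simp: H_add H_zero cls_in_H Z_closed zc Cn.M.a_assoc Cn.M.a_comm Cn.M.a_lcomm)
  qed (auto elim!: H_cases simp: H_add H_smult cls_in_H Z_closed zc Cn.smult_l_distr Cn.smult_r_distr Cn.smult_assoc1)
qed

lemma H_uminus:
  assumes f: "f \<in> Z n" shows "\<ominus>\<^bsub>H n\<^esub> cls n f = cls n (\<ominus>\<^bsub>C n\<^esub> f)"
proof -
  interpret Cn: module R "C n" by (rule module_C)
  interpret Hn: module R "H n" by (rule H_module)
  show ?thesis
    by (rule Hn.M.minus_equality)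
      (use ZD(1)[OF f] f in \<open>simp_all add: H_add H_zero Cn.M.l_neg cls_in_H Z_closed\<close>)
qed

lemma H_sign:
  assumes f: "f \<in> Z n"
  shows "add_pow (H n) ((-1::int) ^ k) (cls n f) = cls n (add_pow (C n) ((-1::int) ^ k) f)"
proof -
  interpret Cn: module R "C n" by (rule module_C)
  interpret Hn: module R "H n" by (rule H_module)
  show ?thesis
    using ZD(1)[OF f] cls_in_H[OF f] by (cases "even k") (simp_all add: Cn.M.add_pow_one Cn.M.add_pow_neg_one
      Hn.M.add_pow_one Hn.M.add_pow_neg_one H_uminus f)
qed

lemma Z_sign:
  assumes f: "f \<in> Z n"
  shows "add_pow (C n) ((-1::int) ^ k) f \<in> Z n"
proof -
  interpret Cn: module R "C n" by (rule module_C)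
  show ?thesis
    using ZD(1)[OF f] f by (cases "even k") (simp_all add: Cn.M.add_pow_one Cn.M.add_pow_neg_one Z_closed)
qed

lemma H_sum:
  assumes "finite S" "\<And>i. i \<in> S \<Longrightarrow> F i \<in> Z n"
  shows "(\<Oplus>\<^bsub>H n\<^esub>i\<in>S. cls n (F i)) = cls n (\<Oplus>\<^bsub>C n\<^esub>i\<in>S. F i) \<and> (\<Oplus>\<^bsub>C n\<^esub>i\<in>S. F i) \<in> Z n"
proof -
  interpret Cn: module R "C n" by (rule module_C)
  interpret Hn: module R "H n" by (rule H_module)
  show ?thesis
    using assms
    by (induction S rule: finite_induct) (auto simp: H_zero Pi_def cls_in_H ZD H_add Z_closed)
qed

sublocale HF: module_family R H
  by (rule module_family.intro) (rule H_module)

end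

lemma (in dg_lie) cochain_complex: "cochain_complex R C d"
  by (rule cochain_complex.intro) (rule module_C d_linear d_d; assumption?)+

section \<open>Chain maps and the maps they induce\<close>

locale chain_map = X: cochain_complex R C d + Y: cochain_complex R C' d'
  for R :: "('r, 'n) ring_scheme" and C :: "nat \<Rightarrow> ('r, 'c) module" and d :: "nat \<Rightarrow> 'c \<Rightarrow> 'c"
    and C' :: "nat \<Rightarrow> ('r, 'e) module" and d' :: "nat \<Rightarrow> 'e \<Rightarrow> 'e" +
  fixes \<phi> :: "nat \<Rightarrow> 'c \<Rightarrow> 'e"
  assumes linear: "linear_map R (C n) (C' n) (\<phi> n)"
    and commutes: "f \<in> carrier (C n) \<Longrightarrow> d' n (\<phi> n f) = \<phi> (Suc n) (d n f)"
begin

lemma maps_Z: "f \<in> X.Z n \<Longrightarrow> \<phi> n f \<in> Y.Z n"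
  using linear_map_group_hom(1)[OF X.module_C Y.module_C linear]
  by (intro Y.ZI) (auto simp: X.ZD commutes linear_mapD(1)[OF linear])

lemma maps_B: "b \<in> X.B n \<Longrightarrow> \<phi> n b \<in> Y.B n"
proof (erule X.B_cases)
  assume "n = 0" "b = \<zero>\<^bsub>C 0\<^esub>"
  then show ?thesis using linear_map_group_hom(1)[OF X.module_C Y.module_C linear] Y.B_closed(1) by simp
next
  fix m a assume a: "n = Suc m" "a \<in> carrier (C m)" "b = d m a"
  then have "\<phi> n b = d' m (\<phi> m a)" by (simp add: commutes)
  then show ?thesis using a Y.d_in_B[OF linear_mapD(1)[OF linear a(2)]] by simp
qed

lemma induced_cls:
  assumes f: "f \<in> X.Z n"
  shows "induced_map C' d' n (\<phi> n) (X.cls n f) = Y.cls n (\<phi> n f)"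
  unfolding induced_map_def
proof (rule X.UN_cls[OF X.ZD(1)[OF f]])
  fix k assume "k \<in> X.cls n f"
  then obtain b where b: "b \<in> X.B n" "k = b \<oplus>\<^bsub>C n\<^esub> f" using X.cls_memD X.ZD(1)[OF f] by blast
  then show "Y.cls n (\<phi> n k) = Y.cls n (\<phi> n f)"
    using Y.cls_eqI[OF Y.ZD(1)[OF maps_Z[OF f]] maps_B[OF b(1)]] X.BC[OF b(1)] X.ZD(1)[OF f]
    by (simp add: linear_mapD(2)[OF linear])
qed

lemma induced_linear: "linear_map R (X.H n) (Y.H n) (induced_map C' d' n (\<phi> n))"
  by (rule linear_mapI) (auto elim!: X.H_cases simp: induced_cls maps_Z Y.cls_in_H X.H_add X.H_smult X.Z_closed
    X.ZD Y.ZD Y.H_add Y.H_smult linear_mapD(2,3)[OF linear])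

lemma induced_direct_sum_linear:
  "linear_map R (direct_sum X.H) (direct_sum Y.H) (\<lambda>u n. induced_map C' d' n (\<phi> n) (u n))"
proof (rule Y.HF.linear_map_DS)
  show "linear_map R (direct_sum X.H) (Y.H n) (\<lambda>u. induced_map C' d' n (\<phi> n) (u n))" for n
    by (rule linear_map_compose[OF X.HF.DS_component induced_linear])
  fix u assume u: "u \<in> carrier (direct_sum X.H)"
  have "{n. induced_map C' d' n (\<phi> n) (u n) \<noteq> \<zero>\<^bsub>Y.H n\<^esub>} \<subseteq> {n. u n \<noteq> \<zero>\<^bsub>X.H n\<^esub>}"
    using linear_map_group_hom(1)[OF X.H_module Y.H_module induced_linear] by auto
  then show "(\<lambda>n. induced_map C' d' n (\<phi> n) (u n)) \<in> carrier (direct_sum Y.H)"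
    using u linear_mapD(1)[OF induced_linear] finite_subset by (fastforce simp: X.HF.DS_carrier Y.HF.DS_carrier)
qed

lemma induced_graded: "(\<lambda>u n. induced_map C' d' n (\<phi> n) (u n)) \<in> direct_sum_grading X.H n \<rightarrow> direct_sum_grading Y.H n"
proof
  fix u assume u: "u \<in> direct_sum_grading X.H n"
  then have "(\<lambda>n. induced_map C' d' n (\<phi> n) (u n)) \<in> carrier (direct_sum Y.H)"
    by (intro linear_mapD(1)[OF induced_direct_sum_linear] X.HF.grading_subset)
  then show "(\<lambda>n. induced_map C' d' n (\<phi> n) (u n)) \<in> direct_sum_grading Y.H n"
    using u linear_map_group_hom(1)[OF X.H_module Y.H_module induced_linear] by (auto simp: direct_sum_grading_def)
qed

end

section \<open>The product of cohomology classes\<close>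

context dg_lie begin

sublocale K: cochain_complex R C d
  by (rule cochain_complex)

definition class_product :: "nat \<Rightarrow> nat \<Rightarrow> 'c set \<Rightarrow> 'c set \<Rightarrow> 'c set" where
  "class_product i j S S' = (\<Union>f\<in>S. \<Union>f'\<in>S'. K.cls (i + j) (P i j f f'))"

lemmas P_simps = bilinear_mapD[OF P_bilinear]

lemma P_zero: "f \<in> carrier (C m) \<Longrightarrow> P m n f \<zero>\<^bsub>C n\<^esub> = \<zero>\<^bsub>C (m + n)\<^esub>" "k \<in> carrier (C n) \<Longrightarrow> P m n \<zero>\<^bsub>C m\<^esub> k = \<zero>\<^bsub>C (m + n)\<^esub>"
proof -
  show "f \<in> carrier (C m) \<Longrightarrow> P m n f \<zero>\<^bsub>C n\<^esub> = \<zero>\<^bsub>C (m + n)\<^esub>"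
    by (rule linear_map_group_hom(1)[OF module_C module_C]) (use P_bilinear in \<open>auto simp: bilinear_map_def\<close>)
  show "k \<in> carrier (C n) \<Longrightarrow> P m n \<zero>\<^bsub>C m\<^esub> k = \<zero>\<^bsub>C (m + n)\<^esub>"
    by (rule linear_map_group_hom(1)[OF module_C module_C, where f = "\<lambda>x. P m n x k"]) (use P_bilinear in \<open>auto simp: bilinear_map_def\<close>)
qed

lemma zero_sign: "add_pow (C n) ((-1::int) ^ k) \<zero>\<^bsub>C n\<^esub> = \<zero>\<^bsub>C n\<^esub>"
proof -
  interpret Cn: module R "C n" by (rule module_C)
  show ?thesis by (cases "even k") (simp_all add: Cn.M.add_pow_one Cn.M.add_pow_neg_one)
qed

lemma P_Z:
  assumes f: "f \<in> K.Z m" and k: "k \<in> K.Z n"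
  shows "P m n f k \<in> K.Z (m + n)"
proof (rule K.ZI)
  interpret Cs: module R "C (Suc (m + n))" by (rule module_C)
  note fc = K.ZD(1)[OF f] and kc = K.ZD(1)[OF k]
  show "P m n f k \<in> carrier (C (m + n))" by (rule P_simps(1)[OF fc kc])
  show "d (m + n) (P m n f k) = \<zero>\<^bsub>C (Suc (m + n))\<^esub>"
    using P_zero(1)[OF fc, of "Suc n"] P_zero(2)[OF kc, of "Suc m"]
    by (simp add: P_leibniz[OF fc kc] K.ZD(2)[OF f] K.ZD(2)[OF k] zero_sign)
qed

text \<open>For b = d a and d k = 0 the Leibniz rule reads d(a k) = (d a) k. In degree 0 the only
  coboundary is 0.\<close>

lemma P_B_left:
  assumes b: "b \<in> K.B m" and k: "k \<in> K.Z n"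
  shows "P m n b k \<in> K.B (m + n)"
  using b
proof (cases rule: K.B_cases)
  case 1
  then show ?thesis using P_zero(2)[OF K.ZD(1)[OF k], of m] K.B_closed(1) by simp
next
  case (2 l a)
  interpret Cs: module R "C (Suc (l + n))" by (rule module_C)
  note kc = K.ZD(1)[OF k]
  have "P m n b k \<in> carrier (C (Suc (l + n)))"
    using P_simps(1)[OF linear_mapD(1)[OF d_linear 2(2)] kc] 2 by simp
  then have "d (l + n) (P l n a k) = P m n b k"
    using P_leibniz[OF 2(2) kc] P_zero(1)[OF 2(2), of "Suc n"] by (simp add: K.ZD(2)[OF k] zero_sign 2)
  then show ?thesis using K.d_in_B[OF P_simps(1)[OF 2(2) kc]] 2 by simp
qed

text \<open>Antisymmetry reduces this to a coboundary in the left factor, and signs preserve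
  coboundaries.\<close>

lemma P_B_right:
  assumes f: "f \<in> K.Z m" and b: "b \<in> K.B n"
  shows "P m n f b \<in> K.B (m + n)"
proof -
  interpret Cn: module R "C (m + n)" by (rule module_C)
  note fc = K.ZD(1)[OF f] and bc = K.BC[OF b]
  have p: "P n m b f \<in> K.B (m + n)" using P_B_left[OF b f] by (simp add: add.commute)
  then have "add_pow (C (m + n)) ((-1::int) ^ (m * n)) (P n m b f) \<in> K.B (m + n)"
    using K.BC[OF p] K.B_closed(4) by (cases "even (m * n)") (simp_all add: Cn.M.add_pow_one Cn.M.add_pow_neg_one)
  then show ?thesis unfolding P_antisym[OF fc bc] by (rule K.B_closed(4))
qed

lemma class_product_cls:
  assumes f: "f \<in> K.Z m" and k: "k \<in> K.Z n"
  shows "class_product m n (K.cls m f) (K.cls n k) = K.cls (m + n) (P m n f k)"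
  unfolding class_product_def
proof (rule K.UN_cls[OF K.ZD(1)[OF f]])
  interpret Cn: module R "C (m + n)" by (rule module_C)
  fix f' assume f': "f' \<in> K.cls m f"
  then obtain a where a: "a \<in> K.B m" "f' = a \<oplus>\<^bsub>C m\<^esub> f" using K.cls_memD K.ZD(1)[OF f] by blast
  \<comment> \<open>Representatives are changed one factor at a time; while the second factor
    changes, the first is already f' and must be known to be a cocycle.\<close>
  have f'Z: "f' \<in> K.Z m" by (rule K.cls_mem_Z[OF f' f])
  show "(\<Union>k'\<in>K.cls n k. K.cls (m + n) (P m n f' k')) = K.cls (m + n) (P m n f k)"
  proof (rule K.UN_cls[OF K.ZD(1)[OF k]])
    fix k' assume "k' \<in> K.cls n k"
    then obtain b where b: "b \<in> K.B n" "k' = b \<oplus>\<^bsub>C n\<^esub> k" using K.cls_memD K.ZD(1)[OF k] by blast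
    have "P m n f' k' = P m n f' b \<oplus>\<^bsub>C (m + n)\<^esub> P m n f' k"
      unfolding b(2) by (rule P_simps(3)[OF K.ZD(1)[OF f'Z] K.BC[OF b(1)] K.ZD(1)[OF k]])
    then have "K.cls (m + n) (P m n f' k') = K.cls (m + n) (P m n f' k)"
      using K.cls_eqI[OF K.ZD(1)[OF P_Z[OF f'Z k]] P_B_right[OF f'Z b(1)]] by simp
    also have "P m n f' k = P m n a k \<oplus>\<^bsub>C (m + n)\<^esub> P m n f k"
      unfolding a(2) by (rule P_simps(2)[OF K.BC[OF a(1)] K.ZD(1)[OF k] K.ZD(1)[OF f]])
    also have "K.cls (m + n) \<dots> = K.cls (m + n) (P m n f k)"
      by (rule K.cls_eqI[OF K.ZD(1)[OF P_Z[OF f k]] P_B_left[OF a(1) k]])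
    finally show "K.cls (m + n) (P m n f' k') = K.cls (m + n) (P m n f k)" .
  qed
qed

sublocale GF: graded_lie_family R "cohomology C d" class_product
proof (unfold_locales)
  note z = P_Z K.ZD(1) K.Z_closed
  show "bilinear_map R (K.H m) (K.H n) (K.H (m + n)) (class_product m n)" for m n
    unfolding bilinear_map_def
    by (intro conjI ballI linear_mapI)
      (auto elim!: K.H_cases simp: class_product_cls K.H_add K.H_smult K.cls_in_H z P_simps)
  show "class_product m n f k = \<ominus>\<^bsub>K.H (m + n)\<^esub> (add_pow (K.H (m + n)) ((-1::int) ^ (m * n)) (class_product n m k f))"
    if "f \<in> carrier (K.H m)" "k \<in> carrier (K.H n)" for f m k n
    using that
  proof (elim K.H_cases)
    fix a b assume a: "a \<in> K.Z m" "f = K.cls m a" and b: "b \<in> K.Z n" "k = K.cls n b"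
    have "P n m b a \<in> K.Z (m + n)" using P_Z[OF b(1) a(1)] by (simp add: add.commute)
    then show ?thesis
      using P_antisym[OF K.ZD(1)[OF a(1)] K.ZD(1)[OF b(1)]]
      by (simp add: a b class_product_cls add.commute[of n m] K.H_sign K.H_uminus K.Z_sign)
  qed
  show "class_product i (j + n) f (class_product j n k l) = class_product (i + j) n (class_product i j f k) l
      \<oplus>\<^bsub>K.H (i + j + n)\<^esub> add_pow (K.H (i + j + n)) ((-1::int) ^ (i * j)) (class_product j (i + n) k (class_product i n f l))"
    if "f \<in> carrier (K.H i)" "k \<in> carrier (K.H j)" "l \<in> carrier (K.H n)" for f i k j l n
    using that
  proof (elim K.H_cases)
    fix a b c assume a: "a \<in> K.Z i" "f = K.cls i a" and b: "b \<in> K.Z j" "k = K.cls j b" and c: "c \<in> K.Z n" "l = K.cls n c"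
    have e: "j + (i + n) = i + j + n" "i + (j + n) = i + j + n" by simp_all
    have q: "P j (i + n) b (P i n a c) \<in> K.Z (i + j + n)" using P_Z[OF b(1) P_Z[OF a(1) c(1)]] unfolding e .
    have q': "P (i + j) n (P i j a b) c \<in> K.Z (i + j + n)" by (rule P_Z[OF P_Z[OF a(1) b(1)] c(1)])
    show ?thesis
      using P_jacobi[OF K.ZD(1)[OF a(1)] K.ZD(1)[OF b(1)] K.ZD(1)[OF c(1)]] a b c
      by (simp add: class_product_cls P_Z e K.H_sign[OF q] K.H_add[OF K.ZD(1)[OF q'] K.ZD(1)[OF K.Z_sign[OF q]]])
  qed
  show "class_product i i f f = \<zero>\<^bsub>K.H (i + i)\<^esub>" if "even i" "f \<in> carrier (K.H i)" for i f
    using that by (auto elim!: K.H_cases simp: class_product_cls P_even K.ZD K.H_zero)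
  show "class_product i (i + i) f (class_product i i f f) = \<zero>\<^bsub>K.H (i + (i + i))\<^esub>" if "odd i" "f \<in> carrier (K.H i)" for i f
    using that by (auto elim!: K.H_cases simp: class_product_cls P_Z P_odd K.ZD K.H_zero)
qed

lemma induced_product_eq: "induced_product C d P = GF.product"
proof (intro ext)
  fix u v k
  have "(\<Union>f\<in>u i. \<Union>f'\<in>v (k - i). K.cls k (P i (k - i) f f')) = class_product i (k - i) (u i) (v (k - i))" if "i \<le> k" for i
    using that by (simp add: class_product_def)
  \<comment> \<open>The families u and v are arbitrary, so the summands are rewritten without
    knowing that they are cohomology classes.\<close>
  then show "induced_product C d P u v k = GF.product u v k"
    unfolding induced_product_def GF.product_def
    by (intro finsum_cong_always) simp
qed

end

section \<open>The Green functor of cohomology modules\<close>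

text \<open>The chain map need not be multiplicative: u' and v' are tied to u and v only through
  their products. For the Frobenius identities the pair in the target is t(x), b and the pair in the
  source is x, r(b).\<close>

lemma (in chain_map) induced_product_map:
  assumes "dg_lie R C d P" "dg_lie R C' d' P'"
    and u: "u \<in> carrier (direct_sum X.H)" "v \<in> carrier (direct_sum X.H)"
    and e: "\<And>i j. dg_lie.class_product C' d' P' i j (u' i) (v' j) =
      induced_map C' d' (i + j) (\<phi> (i + j)) (dg_lie.class_product C d P i j (u i) (v j))"
  shows "induced_product C' d' P' u' v' = (\<lambda>n. induced_map C' d' n (\<phi> n) (induced_product C d P u v n))"
proof
  interpret P: dg_lie R C d P by (rule assms(1))
  interpret P': dg_lie R C' d' P' by (rule assms(2))
  fix k
  have e': "P'.class_product i (k - i) (u' i) (v' (k - i)) =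
      induced_map C' d' k (\<phi> k) (P.class_product i (k - i) (u i) (v (k - i)))" if "i \<in> {..k}" for i
    using e[of i "k - i"] that by simp
  have "P'.GF.product u' v' k = (\<Oplus>\<^bsub>Y.H k\<^esub>i\<in>{..k}. induced_map C' d' k (\<phi> k) (P.class_product i (k - i) (u i) (v (k - i))))"
    unfolding P'.GF.product_def by (rule finsum_cong_always) (rule e')
  also have "\<dots> = induced_map C' d' k (\<phi> k) (P.GF.product u v k)"
    unfolding P.GF.product_def
    by (rule linear_map_group_hom(4)[OF X.H_module Y.H_module induced_linear, symmetric])
      (use P.GF.Q_term u in auto)
  finally show "induced_product C' d' P' u' v' k = induced_map C' d' k (\<phi> k) (induced_product C d P u v k)"
    by (simp add: P.induced_product_eq P'.induced_product_eq)
qed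

section \<open>Mackey axioms, brackets and gradation on cohomology\<close>

context green_coefficients begin

abbreviation CE where "CE \<equiv> alt_maps R (at_e L) (at_e M)"

sublocale Res: chain_map R CC dC CE Y.CE "\<lambda>n. snd"
  by (intro chain_map.intro chain_map_axioms.intro C.cochain_complex E.cochain_complex snd_linear)
    (auto simp: CC_carrier dC_apply)

sublocale Trf: chain_map R CE Y.CE CC dC T
  by (intro chain_map.intro chain_map_axioms.intro C.cochain_complex E.cochain_complex T_linear T_ce_diff)

lemma conj_chain_map: "h \<in> carrier G \<Longrightarrow> chain_map R CE Y.CE CE Y.CE (\<lambda>n. conj n h)"
  by (intro chain_map.intro chain_map_axioms.intro E.cochain_complex conj_linear conj_ce_diff[symmetric])

abbreviation HG where "HG \<equiv> cohomology_green R G p g L M act_Cp act_e"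

lemma HG_simps:
  "at_Cp HG = direct_sum C.K.H" "at_e HG = direct_sum E.K.H"
  "res HG u = (\<lambda>n. induced_map CE Y.CE n snd (u n))"
  "trf HG v = (\<lambda>n. induced_map CC dC n (T n) (v n))"
  "cnj HG h v = (\<lambda>n. induced_map CE Y.CE n (conj n h) (v n))"
  "br_Cp HG = induced_product CC dC cupC" "br_e HG = induced_product CE Y.CE Y.CUP"
  "gr_Cp HG = direct_sum_grading C.K.H" "gr_e HG = direct_sum_grading E.K.H"
proof -
  have e: "C_e R L M = CE" "b_e L M act_e = Y.CE" "cup_e L M = Y.CUP"
    by (simp_all add: C_e_def b_e_def cup_e_def fun_eq_iff)
  show "at_Cp HG = direct_sum C.K.H" "at_e HG = direct_sum E.K.H"
    "res HG u = (\<lambda>n. induced_map CE Y.CE n snd (u n))"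
    "trf HG v = (\<lambda>n. induced_map CC dC n (T n) (v n))"
    "cnj HG h v = (\<lambda>n. induced_map CE Y.CE n (conj n h) (v n))"
    "br_Cp HG = induced_product CC dC cupC" "br_e HG = induced_product CE Y.CE Y.CUP"
    "gr_Cp HG = direct_sum_grading C.K.H" "gr_e HG = direct_sum_grading E.K.H"
    unfolding cohomology_green_def Let_def e by simp_all
qed

text \<open>Each relation is compared degree by degree on a cocycle representing the component,
  where the corresponding equation already holds for cochains.\<close>

lemma HG_mackey: "mackey_functor R G HG"
proof (rule mackey_functor.intro)
  show "module R (at_Cp HG)" "module R (at_e HG)"
    unfolding HG_simps by (rule C.K.HF.DS_module E.K.HF.DS_module)+
  show "linear_map R (at_Cp HG) (at_e HG) (res HG)"
    using Res.induced_direct_sum_linear unfolding HG_simps(1,2) by (simp add: HG_simps(3)[abs_def])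
  show "linear_map R (at_e HG) (at_Cp HG) (trf HG)"
    using Trf.induced_direct_sum_linear unfolding HG_simps(1,2) by (simp add: HG_simps(4)[abs_def])
  show "linear_map R (at_e HG) (at_e HG) (cnj HG h)" if "h \<in> carrier G" for h
    using chain_map.induced_direct_sum_linear[OF conj_chain_map[OF that]] unfolding HG_simps(1,2) by (simp add: HG_simps(5)[abs_def])
  note cc = chain_map.induced_cls[OF conj_chain_map] chain_map.maps_Z[OF conj_chain_map]
  note ez = E.K.ZD(1)
  {
    fix u assume u: "u \<in> carrier (at_e HG)"
    have u': "u \<in> carrier (direct_sum E.K.H)" using u by (simp add: HG_simps)
    have un: "\<exists>f\<in>E.K.Z n. u n = E.K.cls n f" for n
      using E.K.HF.DS_value[OF u', of n] E.K.H_cases by metis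
    show "cnj HG \<one>\<^bsub>G\<^esub> u = u"
    proof (rule ext)
      fix n
      obtain f where f: "f \<in> E.K.Z n" "u n = E.K.cls n f" using un by blast
      then show "cnj HG \<one>\<^bsub>G\<^esub> u n = u n" by (simp add: HG_simps cc conj_one ez)
    qed
    show "cnj HG (h \<otimes>\<^bsub>G\<^esub> k) u = cnj HG h (cnj HG k u)" if "h \<in> carrier G" "k \<in> carrier G" for h k
    proof (rule ext)
      fix n
      obtain f where f: "f \<in> E.K.Z n" "u n = E.K.cls n f" using un by blast
      then show "cnj HG (h \<otimes>\<^bsub>G\<^esub> k) u n = cnj HG h (cnj HG k u) n"
        using that by (simp add: HG_simps cc conj_mult ez)
    qed
    show "trf HG (cnj HG h u) = trf HG u" if "h \<in> carrier G" for h
    proof (rule ext)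
      fix n
      obtain f where f: "f \<in> E.K.Z n" "u n = E.K.cls n f" using un by blast
      then show "trf HG (cnj HG h u) n = trf HG u n"
        using that by (simp add: HG_simps cc Trf.induced_cls T_conj ez)
    qed
    show "res HG (trf HG u) = (\<Oplus>\<^bsub>at_e HG\<^esub>h\<in>carrier G. cnj HG h u)"
    proof (rule ext)
      fix n
      obtain f where f: "f \<in> E.K.Z n" "u n = E.K.cls n f" using un by blast
      have cl: "cnj HG h u \<in> carrier (direct_sum E.K.H)" if "h \<in> carrier G" for h
        using linear_mapD(1)[OF chain_map.induced_direct_sum_linear[OF conj_chain_map[OF that]] u']
        by (simp add: HG_simps)
      have "(\<Oplus>\<^bsub>at_e HG\<^esub>h\<in>carrier G. cnj HG h u) n = (\<Oplus>\<^bsub>E.K.H n\<^esub>h\<in>carrier G. cnj HG h u n)"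
        unfolding HG_simps(2) by (rule E.K.HF.DS_sum[OF finite_G cl])
      also have "\<dots> = (\<Oplus>\<^bsub>E.K.H n\<^esub>h\<in>carrier G. E.K.cls n (conj n h f))"
        by (rule finsum_cong_always) (simp add: HG_simps f cc)
      also have "\<dots> = E.K.cls n (\<Oplus>\<^bsub>CE n\<^esub>h\<in>carrier G. conj n h f)"
        using E.K.H_sum[OF finite_G, of "\<lambda>h. conj n h f" n] cc(2) f(1) by simp
      also have "\<dots> = res HG (trf HG u) n"
        using f by (simp add: HG_simps Trf.induced_cls Trf.maps_Z Res.induced_cls snd_T ez)
      finally show "res HG (trf HG u) n = (\<Oplus>\<^bsub>at_e HG\<^esub>h\<in>carrier G. cnj HG h u) n" ..
    qed
  }
  show "cnj HG h (res HG m) = res HG m" if h: "h \<in> carrier G" and m: "m \<in> carrier (at_Cp HG)" for h m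
  proof (rule ext)
    fix n
    have "m \<in> carrier (direct_sum C.K.H)" using m by (simp add: HG_simps)
    then obtain w where w: "w \<in> C.K.Z n" "m n = C.K.cls n w"
      using C.K.HF.DS_value[of m n] C.K.H_cases by metis
    \<comment> \<open>The second component of a compatible pair is equivariant, which means fixed by
      conjugation of cochains.\<close>
    have "conj n h (snd w) = snd w"
      using C.K.ZD(1)[OF w(1)] conj_fixed h by (auto simp: CC_carrier)
    then show "cnj HG h (res HG m) n = res HG m n"
      using w h by (simp add: HG_simps Res.induced_cls cc Res.maps_Z)
  qed
qed

lemma snd_cupC:
  "u \<in> carrier (CC m) \<Longrightarrow> v \<in> carrier (CC n) \<Longrightarrow> snd (cupC m n u v) = Y.CUP m n (snd u) (snd v)"
  by (auto simp: CC_carrier cupC_apply)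

lemma HG_green: "graded_lie_green_functor R G HG"
proof -
  have el: "graded_lie_algebra R (direct_sum E.K.H) (direct_sum_grading E.K.H) (induced_product CE Y.CE Y.CUP)"
    unfolding E.induced_product_eq by (rule E.GF.graded_lie_direct_sum)
  have cl: "graded_lie_algebra R (direct_sum C.K.H) (direct_sum_grading C.K.H) (induced_product CC dC cupC)"
    unfolding C.induced_product_eq by (rule C.GF.graded_lie_direct_sum)
  note cc = chain_map.induced_cls[OF conj_chain_map] chain_map.maps_Z[OF conj_chain_map]
  have eu: "\<exists>f\<in>E.K.Z n. u n = E.K.cls n f" if "u \<in> carrier (direct_sum E.K.H)" for u n
    using E.K.HF.DS_value[OF that, of n] E.K.H_cases by metis
  have cu: "\<exists>f\<in>C.K.Z n. u n = C.K.cls n f" if "u \<in> carrier (direct_sum C.K.H)" for u n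
    using C.K.HF.DS_value[OF that, of n] C.K.H_cases by metis
  have rc: "(\<lambda>n. induced_map CE Y.CE n snd (u n)) \<in> carrier (direct_sum E.K.H)" if "u \<in> carrier (direct_sum C.K.H)" for u
    by (rule linear_mapD(1)[OF Res.induced_direct_sum_linear that])
  have br: "green_brackets R G HG"
  proof (intro green_brackets.intro green_brackets_axioms.intro HG_mackey)
    show "res HG (br_Cp HG a b) = br_e HG (res HG a) (res HG b)"
      if a: "a \<in> carrier (at_Cp HG)" and b: "b \<in> carrier (at_Cp HG)" for a b
      unfolding HG_simps
    proof (rule Res.induced_product_map[OF C.dg_lie_axioms E.dg_lie_axioms, symmetric])
      show ab: "a \<in> carrier (direct_sum C.K.H)" "b \<in> carrier (direct_sum C.K.H)" using a b by (simp_all add: HG_simps)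
      fix i j
      obtain f k where "f \<in> C.K.Z i" "a i = C.K.cls i f" "k \<in> C.K.Z j" "b j = C.K.cls j k"
        using cu[OF ab(1), of i] cu[OF ab(2), of j] by blast
      then show "E.class_product i j (induced_map CE Y.CE i snd (a i)) (induced_map CE Y.CE j snd (b j)) =
          induced_map CE Y.CE (i + j) snd (C.class_product i j (a i) (b j))"
        by (simp add: Res.induced_cls Res.maps_Z E.class_product_cls C.class_product_cls C.P_Z snd_cupC C.K.ZD)
    qed
    show "cnj HG h (br_e HG x y) = br_e HG (cnj HG h x) (cnj HG h y)"
      if h: "h \<in> carrier G" and x: "x \<in> carrier (at_e HG)" and y: "y \<in> carrier (at_e HG)" for h x y
      unfolding HG_simps
    proof (rule chain_map.induced_product_map[OF conj_chain_map[OF h] E.dg_lie_axioms E.dg_lie_axioms, symmetric])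
      show xy: "x \<in> carrier (direct_sum E.K.H)" "y \<in> carrier (direct_sum E.K.H)" using x y by (simp_all add: HG_simps)
      fix i j
      obtain f k where "f \<in> E.K.Z i" "x i = E.K.cls i f" "k \<in> E.K.Z j" "y j = E.K.cls j k"
        using eu[OF xy(1), of i] eu[OF xy(2), of j] by blast
      then show "E.class_product i j (induced_map CE Y.CE i (conj i h) (x i)) (induced_map CE Y.CE j (conj j h) (y j)) =
          induced_map CE Y.CE (i + j) (conj (i + j) h) (E.class_product i j (x i) (y j))"
        using h by (simp add: cc E.class_product_cls E.P_Z conj_cup E.K.ZD)
    qed
    fix x b assume x: "x \<in> carrier (at_e HG)" and b: "b \<in> carrier (at_Cp HG)"
    have xb: "x \<in> carrier (direct_sum E.K.H)" "b \<in> carrier (direct_sum C.K.H)" using x b by (simp_all add: HG_simps)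
    show "br_Cp HG (trf HG x) b = trf HG (br_e HG x (res HG b))"
      unfolding HG_simps
    proof (rule Trf.induced_product_map[OF E.dg_lie_axioms C.dg_lie_axioms xb(1) rc[OF xb(2)]])
      fix i j
      obtain f k where "f \<in> E.K.Z i" "x i = E.K.cls i f" "k \<in> C.K.Z j" "b j = C.K.cls j k"
        using eu[OF xb(1), of i] cu[OF xb(2), of j] by blast
      then show "C.class_product i j (induced_map CC dC i (T i) (x i)) (b j) =
          induced_map CC dC (i + j) (T (i + j)) (E.class_product i j (x i) (induced_map CE Y.CE j snd (b j)))"
        by (simp add: Trf.induced_cls Trf.maps_Z Res.induced_cls Res.maps_Z E.class_product_cls C.class_product_cls
          E.P_Z T_frobenius E.K.ZD(1) C.K.ZD(1))
    qed
    show "br_Cp HG b (trf HG x) = trf HG (br_e HG (res HG b) x)"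
      unfolding HG_simps
    proof (rule Trf.induced_product_map[OF E.dg_lie_axioms C.dg_lie_axioms rc[OF xb(2)] xb(1)])
      fix i j
      obtain f k where "f \<in> E.K.Z j" "x j = E.K.cls j f" "k \<in> C.K.Z i" "b i = C.K.cls i k"
        using eu[OF xb(1), of j] cu[OF xb(2), of i] by blast
      then show "C.class_product i j (b i) (induced_map CC dC j (T j) (x j)) =
          induced_map CC dC (i + j) (T (i + j)) (E.class_product i j (induced_map CE Y.CE i snd (b i)) (x j))"
        by (simp add: Trf.induced_cls Trf.maps_Z Res.induced_cls Res.maps_Z E.class_product_cls C.class_product_cls
          E.P_Z T_frobenius E.K.ZD(1) C.K.ZD(1))
    qed
  qed
  show ?thesis
  proof (intro graded_lie_green_functor.intro[OF br] graded_lie_green_functor_axioms.intro)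
    show "graded_lie_algebra R (at_Cp HG) (gr_Cp HG) (br_Cp HG)" using cl by (simp add: HG_simps)
    show "graded_lie_algebra R (at_e HG) (gr_e HG) (br_e HG)" using el by (simp add: HG_simps)
    show "res HG \<in> gr_Cp HG n \<rightarrow> gr_e HG n" for n
      using Res.induced_graded by (simp add: HG_simps(3)[abs_def] HG_simps(8,9))
    show "trf HG \<in> gr_e HG n \<rightarrow> gr_Cp HG n" for n
      using Trf.induced_graded by (simp add: HG_simps(4)[abs_def] HG_simps(8,9))
    show "cnj HG h \<in> gr_e HG n \<rightarrow> gr_e HG n" if "h \<in> carrier G" for h n
      using chain_map.induced_graded[OF conj_chain_map[OF that]] by (simp add: HG_simps(5)[abs_def] HG_simps(9))
  qed
qed

end

theorem mainTheorem2:
  fixes R :: "('r, 'n) ring_scheme"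
    and G :: "('g, 'q) monoid_scheme" and p :: nat and g :: 'g
    and L :: "('r, 'g, 'lc, 'le, 'z) green_scheme"
    and M :: "('r, 'g, 'mc, 'me, 'w) green_scheme"
    and act_Cp :: "'lc \<Rightarrow> 'mc \<Rightarrow> 'mc" and act_e :: "'le \<Rightarrow> 'me \<Rightarrow> 'me"
  assumes "cring R" and "char_zero R"
    and "prime_cyclic_group G p g"
    and "lie_green_functor R G L"
    and "green_module R G L M act_Cp act_e"
    and "lie_green_functor R G M"
    and "acts_by_derivations (at_Cp L) (at_Cp M) (br_Cp M) act_Cp"
    and "acts_by_derivations (at_e L) (at_e M) (br_e M) act_e"
  shows "graded_lie_green_functor R G (cohomology_green R G p g L M act_Cp act_e)"
proof -
  interpret green_coefficients R G p g L M act_Cp act_e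
    by (intro green_coefficients.intro green_coefficients_axioms.intro assms)
  show ?thesis by (rule HG_green)
qed

end
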